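(* Let $\psi\in C_c^\infty((2M,\infty)\times\mathbb{S}^2)$. If $\mathcal{R}_{E_1^+}(0,\psi)\equiv0$, then $\psi=0$. Similarly, if $\mathcal{R}_{S_1^+}(0,\psi)\equiv0$, then $\psi=0$.
   Context: Fix $M>0$. The Schwarzschild exterior is $\mathbb{R}_t\times(2M,\infty)_r\times\mathbb{S}^2_\omega$ with Lorentzian metric $g_S=-\frac{r-2M}{r}dt^2+\frac{r}{r-2M}dr^2+r^2d\omega^2$, where $d\omega^2$ is the round metric on the unit sphere. Its D'Alembertian is $\Box_S=-\frac{r}{r-2M}\partial_t^2+\frac{r-2M}{r}\partial_r^2+\frac1{r^2}\Delta_\omega+\frac{2(r-M)}{r^2}\partial_r$. Given smooth compactly supported data $(\phi,\psi)$, $u=u(t,r,\omega)$ denotes the solution of $\Box_Su=0$, $(u,\partial_tu)|_{t=0}=(\phi,\psi)$. The components of the forward radiation field at the event horizon and at null infinity are $$\mathcal{R}_{E_1^+}(\phi,\psi)(\tau,\omega)=\lim_{r\to2M}\partial_tu(\tau-r-2M\log(r-2M),r,\omega),$$ $$\mathcal{R}_{S_1^+}(\phi,\psi)(\bar\tau,\omega)=\lim_{r\to\infty}r\,\partial_tu(\bar\tau+r+2M\log(r-2M),r,\omega).$$ *)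

theory Defs
  imports "HOL-Analysis.Analysis"
begin

text \<open>
  Points of the exterior are triples \<open>(t, r, \<omega>)\<close> with \<open>r > 2 * M\<close> and \<open>\<omega>\<close> in the unit sphere
  \<open>sphere 0 1\<close> of \<^typ>\<open>real ^ 3\<close>. A function on the exterior is a total function
  \<^typ>\<open>real \<Rightarrow> real \<Rightarrow> real ^ 3 \<Rightarrow> complex\<close> whose values elsewhere are never used. In a variable
  ranging over the sphere, smoothness and the Laplacian are those of the extension that is
  constant along rays, \<open>x \<mapsto> f (x / |x|)\<close> for \<open>x \<noteq> 0\<close>; note \<open>sgn x = x / |x|\<close>.
\<close>

primrec Ck_on :: "nat \<Rightarrow> ('a::euclidean_space \<Rightarrow> 'b::real_normed_vector) \<Rightarrow> 'a set \<Rightarrow> bool" where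
  "Ck_on 0 f S \<longleftrightarrow> continuous_on S f"
| "Ck_on (Suc k) f S \<longleftrightarrow>
     (\<forall>x\<in>S. f differentiable (at x)) \<and> (\<forall>v. Ck_on k (\<lambda>x. frechet_derivative f (at x) v) S)"

text \<open>Only meant for open \<open>S\<close>.\<close>

definition smooth_on :: "('a::euclidean_space \<Rightarrow> 'b::real_normed_vector) \<Rightarrow> 'a set \<Rightarrow> bool" where
  "smooth_on f S \<longleftrightarrow> (\<forall>k. Ck_on k f S)"

abbreviation D :: "(real \<Rightarrow> complex) \<Rightarrow> real \<Rightarrow> complex" where
  "D f s \<equiv> vector_derivative f (at s)"

definition laplacian :: "(real ^ 3 \<Rightarrow> complex) \<Rightarrow> real ^ 3 \<Rightarrow> complex" where
  "laplacian F x = (\<Sum>b\<in>Basis. D (D (\<lambda>s. F (x + s *\<^sub>R b))) 0)"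

text \<open>
  The Laplace--Beltrami operator of the round unit sphere: in polar coordinates the Euclidean
  Laplacian is \<open>\<partial>\<^sub>\<rho>\<^sup>2 + (2/\<rho>) \<partial>\<^sub>\<rho> + \<rho>\<^sup>-\<^sup>2 \<Delta>\<^sub>\<omega>\<close>, and the radial terms vanish on the ray-constant
  extension.
\<close>

definition sphere_laplacian :: "(real ^ 3 \<Rightarrow> complex) \<Rightarrow> real ^ 3 \<Rightarrow> complex" where
  "sphere_laplacian f \<omega> = laplacian (\<lambda>x. f (sgn x)) \<omega>"

definition schwarzschild_box ::
    "real \<Rightarrow> (real \<Rightarrow> real \<Rightarrow> real ^ 3 \<Rightarrow> complex) \<Rightarrow> real \<Rightarrow> real \<Rightarrow> real ^ 3 \<Rightarrow> complex" where
  "schwarzschild_box M u t r \<omega> =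
     - (r / (r - 2 * M)) *\<^sub>R D (D (\<lambda>s. u s r \<omega>)) t
     + ((r - 2 * M) / r) *\<^sub>R D (D (\<lambda>s. u t s \<omega>)) r
     + (1 / r\<^sup>2) *\<^sub>R sphere_laplacian (u t r) \<omega>
     + (2 * (r - M) / r\<^sup>2) *\<^sub>R D (\<lambda>s. u t s \<omega>) r"

definition test_data :: "real \<Rightarrow> (real \<Rightarrow> real ^ 3 \<Rightarrow> complex) \<Rightarrow> bool" where
  "test_data M \<psi> \<longleftrightarrow>
     smooth_on (\<lambda>(r, x). \<psi> r (sgn x)) ({2 * M<..} \<times> (- {0})) \<and>
     (\<exists>K. compact K \<and> K \<subseteq> {2 * M<..} \<times> sphere 0 1 \<and>
        (\<forall>r>2 * M. \<forall>\<omega>\<in>sphere 0 1. (r, \<omega>) \<notin> K \<longrightarrow> \<psi> r \<omega> = 0))"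

definition wave_solution ::
    "real \<Rightarrow> (real \<Rightarrow> real ^ 3 \<Rightarrow> complex) \<Rightarrow> (real \<Rightarrow> real ^ 3 \<Rightarrow> complex)
      \<Rightarrow> (real \<Rightarrow> real \<Rightarrow> real ^ 3 \<Rightarrow> complex) \<Rightarrow> bool" where
  "wave_solution M \<phi> \<psi> u \<longleftrightarrow>
     smooth_on (\<lambda>(t, r, x). u t r (sgn x)) (UNIV \<times> {2 * M<..} \<times> (- {0})) \<and>
     (\<forall>t. \<forall>r>2 * M. \<forall>\<omega>\<in>sphere 0 1. schwarzschild_box M u t r \<omega> = 0) \<and>
     (\<forall>r>2 * M. \<forall>\<omega>\<in>sphere 0 1. u 0 r \<omega> = \<phi> r \<omega> \<and> D (\<lambda>s. u s r \<omega>) 0 = \<psi> r \<omega>)"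

text \<open>
  The radiation field components are relations between the solution \<open>u\<close> and a function \<open>R\<close>, so
  that convergence of the limits is part of the notion.
\<close>

definition has_horizon_radiation_field ::
    "real \<Rightarrow> (real \<Rightarrow> real \<Rightarrow> real ^ 3 \<Rightarrow> complex) \<Rightarrow> (real \<Rightarrow> real ^ 3 \<Rightarrow> complex) \<Rightarrow> bool" where
  "has_horizon_radiation_field M u R \<longleftrightarrow>
     (\<forall>\<tau>. \<forall>\<omega>\<in>sphere 0 1.
        ((\<lambda>r. D (\<lambda>s. u s r \<omega>) (\<tau> - r - 2 * M * ln (r - 2 * M))) \<longlongrightarrow> R \<tau> \<omega>) (at_right (2 * M)))"

definition has_null_infinity_radiation_field ::
    "real \<Rightarrow> (real \<Rightarrow> real \<Rightarrow> real ^ 3 \<Rightarrow> complex) \<Rightarrow> (real \<Rightarrow> real ^ 3 \<Rightarrow> complex) \<Rightarrow> bool" where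
  "has_null_infinity_radiation_field M u R \<longleftrightarrow>
     (\<forall>\<tau>. \<forall>\<omega>\<in>sphere 0 1.
        ((\<lambda>r. r *\<^sub>R D (\<lambda>s. u s r \<omega>) (\<tau> + r + 2 * M * ln (r - 2 * M))) \<longlongrightarrow> R \<tau> \<omega>) at_top)"

end

theory Submission
  imports Defs
begin

text \<open>
  In the tortoise coordinate \<open>x = r + 2M log (r - 2M)\<close> the function \<open>z = r \<partial>\<^sub>t u\<close> solves
  \<open>z\<^sub>t\<^sub>t - z\<^sub>x\<^sub>x + V z - q \<Delta>\<^sub>\<omega> z = 0\<close> with \<open>V, q \<ge> 0\<close> and initial data \<open>(r \<psi>, 0)\<close>; hence it is even in
  time. Its moments against \<open>(\<omega> \<bullet> \<xi>)\<^sup>n\<close> over the sphere satisfy one-dimensional wave equations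
  with a potential, in which only the moment of order \<open>n - 2\<close> occurs as a source.

  Suppose that the data vanish for \<open>x < a\<close>. By finite speed of propagation a moment vanishes on
  \<open>x + t = a\<close>, \<open>t \<ge> 0\<close>, and by assumption it tends to zero along every line \<open>x + t = const\<close> as \<open>x \<rightarrow> -\<infinity>\<close>.
  These are zero data for a characteristic (Goursat) problem, so the moment vanishes for
  \<open>t \<ge> |x - a|\<close>, by evenness for \<open>|t| \<ge> |x - a|\<close>, and therefore for all times to the left of \<open>a\<close>. Since \<open>t\<close>
  and \<open>x\<close> play the same role in one dimension, it vanishes identically. Null infinity is the
  mirror image under \<open>x \<mapsto> -x\<close>.

  The radiation field is a limit for each \<open>\<omega>\<close> separately. The conserved energy of \<open>z\<close> bounds its
  \<open>L\<^sup>2\<close> norm over the sphere along the characteristic lines, and this allows to pass to the limit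
  under the integral. The moments determine \<open>z\<close> by the theorem of Stone and Weierstrass.
\<close>

subsection \<open>One-dimensional wave equations\<close>

text \<open>The vanishing of the first datum enters through evenness: zeros in a future wedge are
  reflected into the past, so a single component of the radiation field empties a whole half plane x
  < p and provides data for an evolution in x.

  The Goursat problem is posed at infinity, and on the side of null infinity the potential decays
  only like 1 / x^2, so integrating it twice from infinity diverges. The remedy is to work in thin
  strips between characteristic lines: the inner integral runs over a bounded distance, and only
  increments of the second primitive appear. The admissible width depends only on a bound for the
  first primitive, so finitely many equal strips reach any point.

  Moments stand in for spherical harmonics. The function (\<open>\<omega>\<close> .
  \<open>\<xi>\<close>)^n is not an eigenfunction of the spherical Laplacian, but the defect has
  degree n - 2; strong induction over n therefore removes the source from each equation.

  The energy has two tasks: it supplies the finite a priori bound from which the halving argument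
  starts, and the uniform integrability over the sphere that pointwise limits lack.\<close>

text \<open>The jet has a single mixed derivative, so the symmetry of second derivatives is built in.\<close>

definition C2_jet ::
    "(real \<Rightarrow> real \<Rightarrow> 'a::real_normed_vector) \<Rightarrow> (real \<Rightarrow> real \<Rightarrow> 'a) \<Rightarrow> (real \<Rightarrow> real \<Rightarrow> 'a) \<Rightarrow>
     (real \<Rightarrow> real \<Rightarrow> 'a) \<Rightarrow> (real \<Rightarrow> real \<Rightarrow> 'a) \<Rightarrow> (real \<Rightarrow> real \<Rightarrow> 'a) \<Rightarrow> bool" where
  "C2_jet y yt yx ytt ytx yxx \<longleftrightarrow> (\<forall>t x.
     ((\<lambda>(t, x). y t x) has_derivative (\<lambda>(a, b). a *\<^sub>R yt t x + b *\<^sub>R yx t x)) (at (t, x)) \<and>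
     ((\<lambda>(t, x). yt t x) has_derivative (\<lambda>(a, b). a *\<^sub>R ytt t x + b *\<^sub>R ytx t x)) (at (t, x)) \<and>
     ((\<lambda>(t, x). yx t x) has_derivative (\<lambda>(a, b). a *\<^sub>R ytx t x + b *\<^sub>R yxx t x)) (at (t, x)))"

lemma has_vector_derivative_along_line:
  assumes "((\<lambda>(t, x). y t x) has_derivative (\<lambda>(a, b). a *\<^sub>R yt + b *\<^sub>R yx)) (at (t0 + \<alpha> * s, x0 + \<beta> * s))"
  shows "((\<lambda>s. y (t0 + \<alpha> * s) (x0 + \<beta> * s)) has_vector_derivative \<alpha> *\<^sub>R yt + \<beta> *\<^sub>R yx) (at s within S)"
proof -
  have "((\<lambda>s. (t0 + \<alpha> * s, x0 + \<beta> * s)) has_derivative (\<lambda>h. (\<alpha> * h, \<beta> * h))) (at s within S)"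
    by (auto intro!: derivative_eq_intros)
  from has_derivative_compose[OF this, of "\<lambda>(t, x). y t x"] assms
  show ?thesis
    unfolding has_vector_derivative_def by (force simp: algebra_simps)
qed

text \<open>One statement serves the coordinate axes and both families of characteristics. Its
  instances are left unsimplified so that they unify, which is where terms such as
  \<open>0 + 1 * s\<close> below come from.\<close>

lemma C2_jet_line:
  assumes "C2_jet y yt yx ytt ytx yxx"
  shows "((\<lambda>s. y (t0 + \<alpha> * s) (x0 + \<beta> * s)) has_vector_derivative
           \<alpha> *\<^sub>R yt (t0 + \<alpha> * s) (x0 + \<beta> * s) + \<beta> *\<^sub>R yx (t0 + \<alpha> * s) (x0 + \<beta> * s)) (at s within S)"
    and "((\<lambda>s. yt (t0 + \<alpha> * s) (x0 + \<beta> * s)) has_vector_derivative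
           \<alpha> *\<^sub>R ytt (t0 + \<alpha> * s) (x0 + \<beta> * s) + \<beta> *\<^sub>R ytx (t0 + \<alpha> * s) (x0 + \<beta> * s)) (at s within S)"
    and "((\<lambda>s. yx (t0 + \<alpha> * s) (x0 + \<beta> * s)) has_vector_derivative
           \<alpha> *\<^sub>R ytx (t0 + \<alpha> * s) (x0 + \<beta> * s) + \<beta> *\<^sub>R yxx (t0 + \<alpha> * s) (x0 + \<beta> * s)) (at s within S)"
  using assms unfolding C2_jet_def by (blast intro: has_vector_derivative_along_line)+

lemma C2_jet_continuous:
  assumes "C2_jet y yt yx ytt ytx yxx"
  shows "continuous_on S (\<lambda>(t, x). y t x)" "continuous_on S (\<lambda>(t, x). yt t x)"
    "continuous_on S (\<lambda>(t, x). yx t x)"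
  using assms unfolding C2_jet_def
  by (metis continuous_at_imp_continuous_on has_derivative_continuous surj_pair)+

text \<open>The one-dimensional wave operator only changes its sign when \<open>t\<close> and
  \<open>x\<close> are exchanged; this permits an evolution in the space direction.\<close>

lemma C2_jet_swap:
  assumes "C2_jet y yt yx ytt ytx yxx"
  shows "C2_jet (\<lambda>t x. y x t) (\<lambda>t x. yx x t) (\<lambda>t x. yt x t) (\<lambda>t x. yxx x t) (\<lambda>t x. ytx x t) (\<lambda>t x. ytt x t)"
proof -
  have swap: "((\<lambda>(t, x). f x t) has_derivative (\<lambda>(a, b). a *\<^sub>R fx + b *\<^sub>R ft)) (at (t, x))"
    if "((\<lambda>(t, x). f t x) has_derivative (\<lambda>(a, b). a *\<^sub>R ft + b *\<^sub>R fx)) (at (x, t))"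
    for f :: "real \<Rightarrow> real \<Rightarrow> 'a" and ft fx t x
  proof -
    have "((\<lambda>(t, x). (x, t)) has_derivative (\<lambda>(a, b). (b, a))) (at (t, x))"
      unfolding split_beta by (auto intro!: derivative_eq_intros)
    moreover have "((\<lambda>(t, x). f t x) has_derivative (\<lambda>(a, b). a *\<^sub>R ft + b *\<^sub>R fx))
        (at ((\<lambda>(t, x). (x, t)) (t, x)))"
      using that by simp
    ultimately have "((\<lambda>z. (\<lambda>(t, x). f t x) ((\<lambda>(t, x). (x, t)) z)) has_derivative
        (\<lambda>z. (\<lambda>(a, b). a *\<^sub>R ft + b *\<^sub>R fx) ((\<lambda>(a, b). (b, a)) z))) (at (t, x))"
      by (rule has_derivative_compose)
    then show ?thesis
      by (simp add: case_prod_unfold add.commute)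
  qed
  show ?thesis
    using assms unfolding C2_jet_def by (blast intro: swap)
qed

text \<open>Used with \<open>\<sigma> = -1\<close> for time reversal, with
  \<open>\<tau> = -1\<close> for the reflection that exchanges horizon and null infinity, and with
  \<open>p\<close> as a shift of the starting line.\<close>

lemma C2_jet_affine:
  assumes "C2_jet y yt yx ytt ytx yxx"
  shows "C2_jet (\<lambda>t x. y (p + \<sigma> * t) (q + \<tau> * x)) (\<lambda>t x. \<sigma> *\<^sub>R yt (p + \<sigma> * t) (q + \<tau> * x))
    (\<lambda>t x. \<tau> *\<^sub>R yx (p + \<sigma> * t) (q + \<tau> * x)) (\<lambda>t x. (\<sigma> * \<sigma>) *\<^sub>R ytt (p + \<sigma> * t) (q + \<tau> * x))
    (\<lambda>t x. (\<sigma> * \<tau>) *\<^sub>R ytx (p + \<sigma> * t) (q + \<tau> * x)) (\<lambda>t x. (\<tau> * \<tau>) *\<^sub>R yxx (p + \<sigma> * t) (q + \<tau> * x))"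
proof -
  have aff: "((\<lambda>(t, x). c *\<^sub>R f (p + \<sigma> * t) (q + \<tau> * x)) has_derivative (\<lambda>(a, b). a *\<^sub>R ft' + b *\<^sub>R fx')) (at (t, x))"
    if "((\<lambda>(t, x). f t x) has_derivative (\<lambda>(a, b). a *\<^sub>R ft + b *\<^sub>R fx)) (at (p + \<sigma> * t, q + \<tau> * x))"
      "ft' = (c * \<sigma>) *\<^sub>R ft" "fx' = (c * \<tau>) *\<^sub>R fx"
    for f :: "real \<Rightarrow> real \<Rightarrow> 'a" and ft fx ft' fx' c t x
  proof -
    have "((\<lambda>(t, x). (p + \<sigma> * t, q + \<tau> * x)) has_derivative (\<lambda>(a, b). (\<sigma> * a, \<tau> * b))) (at (t, x))"
      unfolding split_beta by (auto intro!: derivative_eq_intros)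
    moreover have "((\<lambda>(t, x). f t x) has_derivative (\<lambda>(a, b). a *\<^sub>R ft + b *\<^sub>R fx))
        (at ((\<lambda>(t, x). (p + \<sigma> * t, q + \<tau> * x)) (t, x)))"
      using that(1) by simp
    ultimately have "((\<lambda>z. (\<lambda>(t, x). f t x) ((\<lambda>(t, x). (p + \<sigma> * t, q + \<tau> * x)) z)) has_derivative
        (\<lambda>z. (\<lambda>(a, b). a *\<^sub>R ft + b *\<^sub>R fx) ((\<lambda>(a, b). (\<sigma> * a, \<tau> * b)) z))) (at (t, x))"
      by (rule has_derivative_compose)
    then have "((\<lambda>(t, x). f (p + \<sigma> * t) (q + \<tau> * x)) has_derivative
        (\<lambda>(a, b). (a * \<sigma>) *\<^sub>R ft + (b * \<tau>) *\<^sub>R fx)) (at (t, x))"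
      by (simp add: case_prod_unfold mult.commute)
    from has_derivative_scaleR_right[OF this, of c] that(2,3) show ?thesis
      by (simp add: case_prod_unfold algebra_simps)
  qed
  have "((\<lambda>(t, x). y (p + \<sigma> * t) (q + \<tau> * x)) has_derivative
      (\<lambda>(a, b). a *\<^sub>R (\<sigma> *\<^sub>R yt (p + \<sigma> * t) (q + \<tau> * x)) + b *\<^sub>R (\<tau> *\<^sub>R yx (p + \<sigma> * t) (q + \<tau> * x)))) (at (t, x))" for t x
    using aff[of y "yt (p + \<sigma> * t) (q + \<tau> * x)" "yx (p + \<sigma> * t) (q + \<tau> * x)" t x _ 1] assms
    unfolding C2_jet_def by auto
  moreover have "((\<lambda>(t, x). \<sigma> *\<^sub>R yt (p + \<sigma> * t) (q + \<tau> * x)) has_derivative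
      (\<lambda>(a, b). a *\<^sub>R ((\<sigma> * \<sigma>) *\<^sub>R ytt (p + \<sigma> * t) (q + \<tau> * x)) + b *\<^sub>R ((\<sigma> * \<tau>) *\<^sub>R ytx (p + \<sigma> * t) (q + \<tau> * x)))) (at (t, x))"
      "((\<lambda>(t, x). \<tau> *\<^sub>R yx (p + \<sigma> * t) (q + \<tau> * x)) has_derivative
      (\<lambda>(a, b). a *\<^sub>R ((\<sigma> * \<tau>) *\<^sub>R ytx (p + \<sigma> * t) (q + \<tau> * x)) + b *\<^sub>R ((\<tau> * \<tau>) *\<^sub>R yxx (p + \<sigma> * t) (q + \<tau> * x)))) (at (t, x))" for t x
    by (rule aff[OF assms[unfolded C2_jet_def, rule_format, THEN conjunct2, THEN conjunct1]]
        aff[OF assms[unfolded C2_jet_def, rule_format, THEN conjunct2, THEN conjunct2]]; simp)+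
  ultimately show ?thesis
    unfolding C2_jet_def by blast
qed

lemma C2_jet_diff:
  assumes "C2_jet y yt yx ytt ytx yxx" "C2_jet z zt zx ztt ztx zxx"
  shows "C2_jet (\<lambda>t x. y t x - z t x) (\<lambda>t x. yt t x - zt t x) (\<lambda>t x. yx t x - zx t x)
    (\<lambda>t x. ytt t x - ztt t x) (\<lambda>t x. ytx t x - ztx t x) (\<lambda>t x. yxx t x - zxx t x)"
proof -
  have diff: "((\<lambda>(t, x). f t x - g t x) has_derivative (\<lambda>(a, b). a *\<^sub>R (ft - gt) + b *\<^sub>R (fx - gx))) (at p)"
    if "((\<lambda>(t, x). f t x) has_derivative (\<lambda>(a, b). a *\<^sub>R ft + b *\<^sub>R fx)) (at p)"
      "((\<lambda>(t, x). g t x) has_derivative (\<lambda>(a, b). a *\<^sub>R gt + b *\<^sub>R gx)) (at p)"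
    for f g :: "real \<Rightarrow> real \<Rightarrow> 'a" and ft fx gt gx p
    using has_derivative_diff[OF that] by (simp add: case_prod_unfold algebra_simps)
  show ?thesis
    using assms unfolding C2_jet_def by (blast intro: diff)
qed

lemma derivative_zero_if_locally_zero:
  assumes "(f has_vector_derivative f') (at s)" "\<forall>\<^sub>F s in nhds s. f s = 0"
  shows "f' = 0"
proof -
  have "((\<lambda>s. 0) has_vector_derivative f') (at s)"
    using assms(1) by (rule has_vector_derivative_cong_ev[THEN iffD1, rotated 2])
      (use assms(2) eventually_nhds_x_imp_x[OF assms(2)] in \<open>auto elim: eventually_mono\<close>)
  then show ?thesis using vector_derivative_unique_at has_vector_derivative_const by blast
qed

text \<open>A contraction argument without a function space: if every bound implies one half as
  large, a single finite bound forces zero. The weight \<open>w\<close> is exponential in time for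
  the Cauchy problem and constant for the Goursat problem.\<close>

lemma zero_if_bounds_halve:
  fixes f :: "'p \<Rightarrow> real"
  assumes bd: "\<exists>K. \<forall>p\<in>S. \<bar>f p\<bar> \<le> K * w p"
    and halve: "\<And>K. \<forall>p\<in>S. \<bar>f p\<bar> \<le> K * w p \<Longrightarrow> \<forall>p\<in>S. \<bar>f p\<bar> \<le> K / 2 * w p"
    and p: "p \<in> S"
  shows "f p = 0"
proof -
  obtain K where K: "\<forall>p\<in>S. \<bar>f p\<bar> \<le> K * w p" using bd by blast
  have "\<forall>p\<in>S. \<bar>f p\<bar> \<le> K / 2 ^ n * w p" for n
  proof (induction n)
    case (Suc n)
    from halve[OF this] show ?case by (simp add: mult.commute)
  qed (use K in simp)
  then have *: "\<bar>f p\<bar> \<le> K * w p * (1 / 2) ^ n" for n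
    using p by (simp add: power_divide algebra_simps)
  have "(\<lambda>n. K * w p * (1 / 2) ^ n) \<longlonglongrightarrow> K * w p * 0"
    by (intro tendsto_mult tendsto_const LIMSEQ_realpow_zero) auto
  from LIMSEQ_le_const[OF this, of "\<bar>f p\<bar>"] * show ?thesis by auto
qed

text \<open>Integrating an exponential of rate \<open>\<kappa>\<close> gains the factor 1 /
  \<open>\<kappa>\<close>; for large \<open>\<kappa>\<close> this gain produces the halving.\<close>

lemma norm_le_exp_bound:
  fixes f :: "real \<Rightarrow> 'a::real_normed_vector"
  assumes "0 \<le> t" "0 < \<kappa>" "f 0 = 0" "0 \<le> B"
    and d: "\<And>s. 0 \<le> s \<Longrightarrow> s \<le> t \<Longrightarrow> (f has_vector_derivative f' s) (at s)"
    and b: "\<And>s. 0 \<le> s \<Longrightarrow> s \<le> t \<Longrightarrow> norm (f' s) \<le> B * exp (\<kappa> * s)"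
  shows "norm (f t) \<le> B / \<kappa> * exp (\<kappa> * t)"
proof (cases "t = 0")
  case False
  then have t: "0 < t" using assms(1) by simp
  have "norm (f t - f 0) \<le> B / \<kappa> * exp (\<kappa> * t) - B / \<kappa> * exp (\<kappa> * 0)"
  proof (rule differentiable_bound_general[OF t, where f' = f' and \<phi>' = "\<lambda>s. B * exp (\<kappa> * s)"])
    show "continuous_on {0..t} f"
      by (rule continuous_on_vector_derivative, rule has_vector_derivative_at_within, rule d) auto
    show "continuous_on {0..t} (\<lambda>s. B / \<kappa> * exp (\<kappa> * s))" by (intro continuous_intros)
    show "((\<lambda>s. B / \<kappa> * exp (\<kappa> * s)) has_vector_derivative B * exp (\<kappa> * x)) (at x)" for x
      unfolding has_real_derivative_iff_has_vector_derivative[symmetric]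
      using assms(2) by (auto intro!: derivative_eq_intros simp: field_simps)
  qed (use d b in auto)
  also have "\<dots> \<le> B / \<kappa> * exp (\<kappa> * t)" using assms by simp
  finally show ?thesis using assms by simp
qed (use assms in auto)

text \<open>The characteristic derivatives \<open>P\<close> and \<open>Q\<close> are transported
  along x + t and x - t constant, respectively, with source \<open>ytt - yxx\<close>, and
  \<open>y\<close> is the time integral of their mean. Hence a bound weighted by an exponential in
  time improves by the factor 2 in each round. The equation enters only as an inequality, so the
  potential may depend on either variable; this matters once time and space are exchanged.\<close>

lemma domain_of_dependence:
  fixes y :: "real \<Rightarrow> real \<Rightarrow> 'a::real_normed_vector"
  assumes J: "C2_jet y yt yx ytt ytx yxx"
    and pde: "\<And>t x. 0 \<le> t \<Longrightarrow> \<bar>x - c\<bar> < h - t \<Longrightarrow> norm (ytt t x - yxx t x) \<le> C * norm (y t x)"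
    and y0: "\<And>x. \<bar>x - c\<bar> < h \<Longrightarrow> y 0 x = 0" and yt0: "\<And>x. \<bar>x - c\<bar> < h \<Longrightarrow> yt 0 x = 0"
    and tx: "0 \<le> t" "\<bar>x - c\<bar> < h - t"
  shows "y t x = 0"
proof -
  \<comment> \<open>The open cone is replaced by a compact one through the given point, with
    \<open>k\<close> halfway between t + |x - c| and \<open>h\<close>. Compactness gives the first
    bound, and \<open>k < h\<close> keeps the base strictly inside the interval of vanishing
    data.\<close>
  define k where "k = (h + (t + \<bar>x - c\<bar>)) / 2"
  define T where "T = {(s, z). 0 \<le> s \<and> \<bar>z - c\<bar> \<le> k - s}"
  \<comment> \<open>The derivatives along the three lines carry at most (|C| + 1) K times the
    weight; division by \<open>\<kappa>\<close> leaves K / 2.\<close>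
  define \<kappa> where "\<kappa> = 2 * (\<bar>C\<bar> + 1)"
  have kh: "k < h" and inT: "(t, x) \<in> T" using tx by (auto simp: k_def T_def field_simps)
  have \<kappa>: "0 < \<kappa>" by (simp add: \<kappa>_def)
  define P Q where "P s z = yt s z + yx s z" and "Q s z = yt s z - yx s z" for s z
  define w :: "real \<times> real \<Rightarrow> real" where "w p = exp (\<kappa> * fst p)" for p
  define m where "m = (\<lambda>(s, z). max (norm (y s z)) (max (norm (P s z)) (norm (Q s z))))"
  have T_eq: "T = {0..k} \<times> {c - k..c + k} \<inter> {p. \<bar>snd p - c\<bar> \<le> k - fst p}"
    unfolding T_def by (auto simp: abs_le_iff)
  have "closed {p :: real \<times> real. \<bar>snd p - c\<bar> \<le> k - fst p}"
    by (intro closed_Collect_le continuous_intros)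
  then have "compact T"
    unfolding T_eq by (intro compact_Int_closed compact_Times compact_Icc)
  have "continuous_on T m"
    using C2_jet_continuous[OF J, of T] unfolding m_def P_def Q_def split_beta
    by (intro continuous_intros) auto
  with \<open>compact T\<close> obtain K0 where K0: "\<forall>p\<in>T. \<bar>m p\<bar> \<le> K0"
    by (metis bounded_iff compact_continuous_image compact_imp_bounded imageI real_norm_def)
  have "\<forall>p\<in>T. \<bar>m p\<bar> \<le> K0 * w p"
  proof
    fix p assume p: "p \<in> T"
    then have "1 \<le> w p" using \<kappa> by (auto simp: T_def w_def)
    moreover have "0 \<le> K0" using K0 p by force
    ultimately show "\<bar>m p\<bar> \<le> K0 * w p"
      using K0 p by (smt (verit) mult_left_le_imp_le mult_le_cancel_left1)
  qed
  moreover have "\<forall>p\<in>T. \<bar>m p\<bar> \<le> K / 2 * w p" if K: "\<forall>p\<in>T. \<bar>m p\<bar> \<le> K * w p" for K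
  proof
    fix p assume pT: "p \<in> T"
    obtain t x where p: "p = (t, x)" by (cases p)
    have t: "0 \<le> t" and x: "\<bar>x - c\<bar> \<le> k - t" using pT by (auto simp: p T_def)
    have "0 \<le> K" using K pT by (smt (verit) exp_gt_zero w_def zero_le_mult_iff)
    have in_T: "(s, x + \<tau> * (t - s)) \<in> T" if "0 \<le> s" "s \<le> t" "\<bar>\<tau>\<bar> \<le> 1" for s \<tau>
    proof -
      have "\<bar>\<tau> * (t - s)\<bar> \<le> 1 * (t - s)" unfolding abs_mult using that by (intro mult_mono) auto
      then show ?thesis using x that unfolding T_def by auto
    qed
    have bd: "norm (y s z) \<le> K * exp (\<kappa> * s)" "norm (P s z) \<le> K * exp (\<kappa> * s)" "norm (Q s z) \<le> K * exp (\<kappa> * s)"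
      if "(s, z) \<in> T" for s z
      using K that by (auto simp: m_def w_def abs_le_iff)
    have src: "norm (ytt s z - yxx s z) \<le> \<bar>C\<bar> * K * exp (\<kappa> * s)" if "(s, z) \<in> T" for s z
    proof -
      have "norm (ytt s z - yxx s z) \<le> C * norm (y s z)"
        using that kh by (intro pde) (auto simp: T_def)
      also have "\<dots> \<le> \<bar>C\<bar> * (K * exp (\<kappa> * s))"
        using bd(1)[OF that] by (intro mult_mono) auto
      finally show ?thesis by (simp add: mult.assoc)
    qed
    have base: "\<bar>z - c\<bar> < h" if "(0, z) \<in> T" for z using that kh by (auto simp: T_def)
    have yx0: "yx 0 z = 0" if "\<bar>z - c\<bar> < h" for z
    proof -
      have "((\<lambda>s. y (0 + 0 * s) (z + 1 * s)) has_vector_derivative yx 0 z) (at 0)"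
        using C2_jet_line(1)[OF J, of 0 0 z 1 0] by simp
      moreover have "\<forall>\<^sub>F s in nhds (0::real). y (0 + 0 * s) (z + 1 * s) = (0::'a)"
      proof -
        have "\<forall>\<^sub>F s in nhds (0::real). dist s 0 < h - \<bar>z - c\<bar>"
          using that by (auto simp: eventually_nhds_metric intro!: exI[of _ "h - \<bar>z - c\<bar>"])
        then show ?thesis by eventually_elim (auto intro!: y0 simp: dist_real_def)
      qed
      ultimately show ?thesis by (rule derivative_zero_if_locally_zero)
    qed
    have half: "B / \<kappa> * exp (\<kappa> * t) \<le> K / 2 * exp (\<kappa> * t)" if "B \<le> (\<bar>C\<bar> + 1) * K" for B
      using that \<kappa> by (intro mult_right_mono) (auto simp: \<kappa>_def field_simps)
    have cP: "((\<lambda>s. P (0 + 1 * s) (x + t + - 1 * s)) has_vector_derivative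
        (ytt (0 + 1 * s) (x + t + - 1 * s) - yxx (0 + 1 * s) (x + t + - 1 * s))) (at s)" for s
      using has_vector_derivative_add[OF C2_jet_line(2,3)[OF J, of 0 1 "x + t" "-1" s]]
      by (simp add: P_def)
    have cQ: "((\<lambda>s. Q (0 + 1 * s) (x - t + 1 * s)) has_vector_derivative
        (ytt (0 + 1 * s) (x - t + 1 * s) - yxx (0 + 1 * s) (x - t + 1 * s))) (at s)" for s
      using has_vector_derivative_diff[OF C2_jet_line(2,3)[OF J, of 0 1 "x - t" "1" s]]
      by (simp add: Q_def)
    have "norm (P (0 + 1 * t) (x + t + - 1 * t)) \<le> (\<bar>C\<bar> * K) / \<kappa> * exp (\<kappa> * t)"
    proof (rule norm_le_exp_bound[OF t \<kappa> _ _ cP])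
      show "P (0 + 1 * 0) (x + t + - 1 * 0) = 0"
        using in_T[of 0 1] t base[of "x + t"] by (simp add: P_def yt0 yx0)
      show "norm (ytt (0 + 1 * s) (x + t + - 1 * s) - yxx (0 + 1 * s) (x + t + - 1 * s)) \<le> \<bar>C\<bar> * K * exp (\<kappa> * s)"
        if "0 \<le> s" "s \<le> t" for s
        using src[OF in_T[OF that, of 1]] by (simp add: algebra_simps)
    qed (use \<open>0 \<le> K\<close> in auto)
    moreover have "norm (Q (0 + 1 * t) (x - t + 1 * t)) \<le> (\<bar>C\<bar> * K) / \<kappa> * exp (\<kappa> * t)"
    proof (rule norm_le_exp_bound[OF t \<kappa> _ _ cQ])
      show "Q (0 + 1 * 0) (x - t + 1 * 0) = 0"
        using in_T[of 0 "-1"] t base[of "x - t"] by (simp add: Q_def yt0 yx0)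
      show "norm (ytt (0 + 1 * s) (x - t + 1 * s) - yxx (0 + 1 * s) (x - t + 1 * s)) \<le> \<bar>C\<bar> * K * exp (\<kappa> * s)"
        if "0 \<le> s" "s \<le> t" for s
        using src[OF in_T[OF that, of "-1"]] by (simp add: algebra_simps)
    qed (use \<open>0 \<le> K\<close> in auto)
    moreover have "norm (y (0 + 1 * t) (x + 0 * t)) \<le> K / \<kappa> * exp (\<kappa> * t)"
    proof (rule norm_le_exp_bound[OF t \<kappa> _ \<open>0 \<le> K\<close> C2_jet_line(1)[OF J]])
      show "y (0 + 1 * 0) (x + 0 * 0) = 0"
        using in_T[of 0 0] t base[of x] by (simp add: y0)
      show "norm (1 *\<^sub>R yt (0 + 1 * s) (x + 0 * s) + 0 *\<^sub>R yx (0 + 1 * s) (x + 0 * s)) \<le> K * exp (\<kappa> * s)"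
        if "0 \<le> s" "s \<le> t" for s
      proof -
        have sx: "(s, x) \<in> T" using in_T[OF that, of 0] by simp
        have "yt s x = (1/2) *\<^sub>R (P s x + Q s x)" by (simp add: P_def Q_def flip: scaleR_2)
        then have "norm (yt s x) \<le> (1/2) * (norm (P s x) + norm (Q s x))"
          using norm_triangle_ineq[of "P s x" "Q s x"] by simp
        then show ?thesis using bd(2,3)[OF sx] by simp
      qed
    qed
    moreover have "\<bar>C\<bar> * K \<le> (\<bar>C\<bar> + 1) * K" "K \<le> (\<bar>C\<bar> + 1) * K"
      using \<open>0 \<le> K\<close> by (auto simp: algebra_simps)
    note this[THEN half]
    ultimately have "norm (P (0 + 1 * t) (x + t + - 1 * t)) \<le> K / 2 * exp (\<kappa> * t)"
      "norm (Q (0 + 1 * t) (x - t + 1 * t)) \<le> K / 2 * exp (\<kappa> * t)"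
      "norm (y (0 + 1 * t) (x + 0 * t)) \<le> K / 2 * exp (\<kappa> * t)"
      by (blast intro: order_trans)+
    then show "\<bar>m p\<bar> \<le> K / 2 * w p"
      unfolding p m_def w_def by (auto simp: max_def)
  qed
  ultimately have "m (t, x) = 0"
    using zero_if_bounds_halve[of T m w, OF _ _ inT] by blast
  then show ?thesis by (auto simp: m_def max_def split: if_splits)
qed

text \<open>
  On a strip of width \<open>d\<close>, integrating the source first along \<open>t - x = const\<close> costs an increment of
  \<open>g\<close> over a distance at most \<open>d / 2\<close>, and integrating this increment along \<open>t + x = const\<close> up to infinity costs
  an increment of \<open>G\<close> over the same distance, hence at most \<open>B d\<close>: any bound for \<open>y\<close> improves by a factor \<open>2\<close>.
\<close>

lemma Goursat_strip:
  fixes y :: "real \<Rightarrow> real \<Rightarrow> 'a::real_normed_vector"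
  assumes J: "C2_jet y yt yx ytt ytx yxx"
    and pde: "\<And>t x. norm (ytt t x - yxx t x) \<le> g' x * norm (y t x)"
    and g: "\<And>x. (g has_real_derivative g' x) (at x)" "\<And>x. 0 \<le> g' x" "\<And>x. \<bar>g x\<bar> \<le> B"
    and G: "\<And>x. (G has_real_derivative g x) (at x)"
    and bdd: "\<And>t x. p \<le> t + x \<Longrightarrow> t + x \<le> p + d \<Longrightarrow> u0 < t - x \<Longrightarrow> norm (y t x) \<le> K"
    and lim: "\<And>v. ((\<lambda>s. y (v + s) (- s)) \<longlongrightarrow> 0) at_top"
    and y0: "\<And>t x. t + x = p \<Longrightarrow> u0 < t - x \<Longrightarrow> y t x = 0"
    and d: "d * B \<le> 1 / 2"
    and tx: "p \<le> t + x" "t + x \<le> p + d" "u0 < t - x"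
  shows "y t x = 0"
proof -
  define S where "S = {(t, x). p \<le> t + x \<and> t + x \<le> p + d \<and> u0 < t - x}"
  have B: "0 \<le> B" using g(3)[of 0] by simp
  have "\<forall>q\<in>S. \<bar>case q of (t, x) \<Rightarrow> norm (y t x)\<bar> \<le> K / 2 * 1"
    if K: "\<forall>q\<in>S. \<bar>case q of (t, x) \<Rightarrow> norm (y t x)\<bar> \<le> K * 1" for K
  proof
    fix q assume "q \<in> S"
    then obtain t x where q: "q = (t, x)" and tx: "(t, x) \<in> S" by (cases q) auto
    \<comment> \<open>A step of length s in both variables raises t + x by 2 s, so \<open>e\<close>
      is the parameter distance from the line t + x = \<open>p\<close>.\<close>
    define e where "e = (t + x - p) / 2"
    have e: "0 \<le> e" "2 * e \<le> d" using tx by (auto simp: e_def S_def)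
    have K': "norm (y t x) \<le> K" if "(t, x) \<in> S" for t x using bspec[OF K that] by simp
    have K0: "0 \<le> K" using order_trans[OF norm_ge_zero K'[OF tx]] .
    have Q: "norm (yt t' x' - yx t' x') \<le> K * (g x' - g (x' - e))"
      if tx': "t' + x' = t + x" "u0 < t' - x'" for t' x'
    proof -
      define F where "F s = yt (t' - e + 1 * s) (x' - e + 1 * s) - yx (t' - e + 1 * s) (x' - e + 1 * s)" for s
      define \<phi> where "\<phi> s = K * g (x' - e + s)" for s
      have F: "(F has_vector_derivative (ytt (t' - e + 1 * s) (x' - e + 1 * s) - yxx (t' - e + 1 * s) (x' - e + 1 * s))) (at s)" for s
        using has_vector_derivative_diff[OF C2_jet_line(2,3)[OF J, of "t' - e" 1 "x' - e" "1" s]]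
        by (simp add: F_def[abs_def])
      have \<phi>: "(\<phi> has_vector_derivative K * g' (x' - e + s)) (at s)" for s
      proof -
        have "((\<lambda>s. x' - e + s) has_real_derivative 1) (at s)"
          by (auto intro!: derivative_eq_intros)
        from DERIV_cmult[OF DERIV_chain2[OF g(1) this], of K] show ?thesis
          unfolding \<phi>_def has_real_derivative_iff_has_vector_derivative by simp
      qed
      \<comment> \<open>\<open>yt - yx\<close> differentiates along t + x constant, hence
        tangentially to the line on which \<open>y\<close> vanishes; the strict inequality for
        \<open>u0\<close> leaves room on both sides.\<close>
      have F0: "F 0 = 0"
      proof -
        let ?l = "\<lambda>s. y (t' - e + 1 * s) (x' - e + - 1 * s)"
        have "(?l has_vector_derivative F 0) (at 0)"
          using C2_jet_line(1)[OF J, of "t' - e" 1 "x' - e" "-1" 0] by (simp add: F_def)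
        moreover have "\<forall>\<^sub>F s in nhds (0::real). ?l s = 0"
        proof -
          have "\<forall>\<^sub>F s in nhds (0::real). dist s 0 < (t' - x' - u0) / 2"
            using tx' by (auto simp: eventually_nhds_metric intro!: exI[of _ "(t' - x' - u0) / 2"])
          then show ?thesis
          proof eventually_elim
            case (elim s)
            then have "\<bar>s\<bar> < (t' - x' - u0) / 2" by (simp add: dist_real_def)
            then have "2 * \<bar>s\<bar> < t' - x' - u0" by simp
            then have "u0 < (t' - e + 1 * s) - (x' - e + - 1 * s)" by linarith
            moreover have "(t' - e + 1 * s) + (x' - e + - 1 * s) = p" using tx' by (simp add: e_def)
            ultimately show ?case by (intro y0)
          qed
        qed
        ultimately show ?thesis by (rule derivative_zero_if_locally_zero)
      qed
      show ?thesis
      proof (cases "e = 0")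
        case True
        then show ?thesis using F0 by (simp add: F_def)
      next
        case False
        have "norm (F e - F 0) \<le> \<phi> e - \<phi> 0"
        proof (rule differentiable_bound_general[where f = F and \<phi> = \<phi> and a = 0 and b = e and
            \<phi>' = "\<lambda>s. K * g' (x' - e + s)" and
            f' = "\<lambda>s. ytt (t' - e + 1 * s) (x' - e + 1 * s) - yxx (t' - e + 1 * s) (x' - e + 1 * s)"])
          show "0 < e" using e False by simp
          show "continuous_on {0..e} F" "continuous_on {0..e} \<phi>"
            by (rule continuous_on_vector_derivative, rule has_vector_derivative_at_within, rule F \<phi>)+
          show "(F has_vector_derivative (ytt (t' - e + 1 * s) (x' - e + 1 * s) - yxx (t' - e + 1 * s) (x' - e + 1 * s))) (at s)"
            "(\<phi> has_vector_derivative K * g' (x' - e + s)) (at s)" for s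
            by (fact F \<phi>)+
          fix s assume s: "0 < s" "s < e"
          have "(t' - e + s, x' - e + s) \<in> S"
          proof -
            have "t' - e + s + (x' - e + s) = p + 2 * s" using tx' by (simp add: e_def)
            then show ?thesis using s tx' e by (simp add: S_def)
          qed
          from K'[OF this] have "norm (y (t' - e + s) (x' - e + s)) \<le> K" .
          then have "g' (x' - e + s) * norm (y (t' - e + s) (x' - e + s)) \<le> g' (x' - e + s) * K"
            by (rule mult_left_mono[OF _ g(2)])
          with pde[of "t' - e + s" "x' - e + s"]
          show "norm (ytt (t' - e + 1 * s) (x' - e + 1 * s) - yxx (t' - e + 1 * s) (x' - e + 1 * s)) \<le> K * g' (x' - e + s)"
            by (simp add: mult.commute)
        qed
        then show ?thesis by (simp add: F0) (simp add: F_def \<phi>_def algebra_simps)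
      qed
    qed
    define L where "L s = y (t + 1 * s) (x + - 1 * s)" for s
    have L: "(L has_vector_derivative (yt (t + 1 * s) (x + - 1 * s) - yx (t + 1 * s) (x + - 1 * s))) (at s)" for s
      using C2_jet_line(1)[OF J, of t 1 x "-1" s] by (simp add: L_def[abs_def])
    define \<phi> where "\<phi> s = - (K * (G (x - s) - G (x - s - e)))" for s
    have \<phi>: "(\<phi> has_vector_derivative K * (g (x - s) - g (x - s - e))) (at s)" for s
    proof -
      have "((\<lambda>s. x - s) has_real_derivative -1) (at s)" "((\<lambda>s. x - s - e) has_real_derivative -1) (at s)"
        by (auto intro!: derivative_eq_intros)
      note this[THEN DERIV_chain2[OF G]]
      from DERIV_minus[OF DERIV_cmult[OF DERIV_diff[OF this], of K]] show ?thesis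
        unfolding \<phi>_def has_real_derivative_iff_has_vector_derivative by (simp add: algebra_simps)
    qed
    \<comment> \<open>\<open>G\<close> itself may be unbounded; its increment over the distance
      \<open>e\<close> is controlled by the bound for its derivative \<open>g\<close>.\<close>
    have \<phi>_bd: "\<bar>\<phi> s\<bar> \<le> K * (B * e)" for s
    proof -
      have "norm (G (x - s) - G (x - s - e)) \<le> B * norm (x - s - (x - s - e))"
        by (rule field_differentiable_bound[where S = UNIV and f' = g])
          (use G g(3) in \<open>auto simp: has_field_derivative_at_within\<close>)
      then show ?thesis
        using K0 e unfolding \<phi>_def by (simp add: abs_mult mult_left_mono)
    qed
    have "norm (y t x) \<le> norm (L s) + K / 2" if s: "0 < s" for s
    proof -
      have "norm (L s - L 0) \<le> \<phi> s - \<phi> 0"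
      proof (rule differentiable_bound_general[where f = L and \<phi> = \<phi> and a = 0 and b = s and
            \<phi>' = "\<lambda>s. K * (g (x - s) - g (x - s - e))" and
            f' = "\<lambda>s. yt (t + 1 * s) (x + - 1 * s) - yx (t + 1 * s) (x + - 1 * s)"])
        show "0 < s" by (fact s)
        show "continuous_on {0..s} L" "continuous_on {0..s} \<phi>"
          by (rule continuous_on_vector_derivative, rule has_vector_derivative_at_within, rule L \<phi>)+
        show "(L has_vector_derivative yt (t + 1 * r) (x + - 1 * r) - yx (t + 1 * r) (x + - 1 * r)) (at r)"
          "(\<phi> has_vector_derivative K * (g (x - r) - g (x - r - e))) (at r)" for r
          by (fact L \<phi>)+
        fix r assume "0 < r" "r < s"
        then show "norm (yt (t + 1 * r) (x + - 1 * r) - yx (t + 1 * r) (x + - 1 * r)) \<le> K * (g (x - r) - g (x - r - e))"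
          using Q[of "t + r" "x - r"] tx by (auto simp: S_def)
      qed
      also have "\<dots> \<le> 2 * (K * (B * e))" using \<phi>_bd[of s] \<phi>_bd[of 0] by linarith
      also have "\<dots> = K * (B * (2 * e))" by simp
      also have "\<dots> \<le> K * (B * d)" using K0 B e by (intro mult_left_mono) auto
      also have "\<dots> \<le> K * (1 / 2)" using K0 d by (intro mult_left_mono) (auto simp: mult.commute)
      finally have "norm (L s - L 0) \<le> K / 2" by simp
      then show ?thesis using norm_triangle_sub[of "L 0" "L s"] by (simp add: L_def norm_minus_commute)
    qed
    then have ev: "\<forall>\<^sub>F s in at_top. norm (y t x) \<le> norm (L s) + K / 2"
      by (rule eventually_mono[OF eventually_gt_at_top[of 0]])
    have "(L \<longlongrightarrow> 0) at_top"
    proof -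
      have "((\<lambda>s. y (t + x + (- x + s)) (- (- x + s))) \<longlongrightarrow> 0) at_top"
        by (rule filterlim_compose[OF lim filterlim_tendsto_add_at_top[OF tendsto_const filterlim_ident]])
      then show ?thesis by (simp add: L_def[abs_def] algebra_simps)
    qed
    then have "((\<lambda>s. norm (L s) + K / 2) \<longlongrightarrow> norm (0::'a) + K / 2) at_top"
      by (rule tendsto_add[OF tendsto_norm tendsto_const])
    from tendsto_lowerbound[OF this ev] have "norm (y t x) \<le> norm (0::'a) + K / 2" by simp
    then show "\<bar>case q of (t, x) \<Rightarrow> norm (y t x)\<bar> \<le> K / 2 * 1"
      by (simp add: q)
  qed
  note halve = this
  have "\<exists>K. \<forall>q\<in>S. \<bar>case q of (t, x) \<Rightarrow> norm (y t x)\<bar> \<le> K * 1"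
    using bdd by (intro exI[of _ K]) (simp add: S_def split_beta)
  moreover have "(t, x) \<in> S" using tx by (simp add: S_def)
  ultimately have "(case (t, x) of (t, x) \<Rightarrow> norm (y t x)) = 0"
    by (intro zero_if_bounds_halve[of S "\<lambda>(t, x). norm (y t x)" "\<lambda>_. 1", OF _ halve])
  then show ?thesis by simp
qed

text \<open>The bounds in \<open>bdd\<close> may depend on \<open>v\<close> in any way, since on
  each strip a finite bound merely starts the halving. The bound \<open>B\<close> for
  \<open>g\<close> fixes the width of the strips, while \<open>G\<close> is free to grow.\<close>

lemma wave_zero_if_radiation_zero:
  fixes y :: "real \<Rightarrow> real \<Rightarrow> 'a::real_normed_vector"
  assumes J: "C2_jet y yt yx ytt ytx yxx"
    and pde: "\<And>t x. ytt t x - yxx t x = - (W x *\<^sub>R y t x)"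
    and W: "continuous_on UNIV W" "\<And>x. \<bar>W x\<bar> \<le> g' x"
    and g: "\<And>x. (g has_real_derivative g' x) (at x)" "\<And>x. \<bar>g x\<bar> \<le> B"
    and G: "\<And>x. (G has_real_derivative g x) (at x)"
    and yt0: "\<And>x. yt 0 x = 0"
    and y0: "\<And>x. x < a \<Longrightarrow> y 0 x = 0"
    and bdd: "\<And>v. \<exists>K. \<forall>t x. 0 \<le> t \<longrightarrow> t + x \<le> v \<longrightarrow> norm (y t x) \<le> K"
    and lim: "\<And>v. ((\<lambda>s. y (v + s) (- s)) \<longlongrightarrow> 0) at_top"
  shows "y t x = 0"
proof -
  have W_bdd: "\<exists>C. \<forall>z. \<bar>z - c\<bar> < h \<longrightarrow> \<bar>W z\<bar> \<le> C" for c h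
  proof -
    have "compact (W ` cball c h)"
      by (intro compact_continuous_image continuous_on_subset[OF W(1)]) auto
    then obtain C where "\<forall>z\<in>cball c h. \<bar>W z\<bar> \<le> C"
      by (metis bounded_iff compact_imp_bounded imageI real_norm_def)
    then show ?thesis by (intro exI[of _ C]) (auto simp: dist_real_def abs_minus_commute)
  qed
  have dep: "y t x = 0" if tx: "0 \<le> t" "t + x < a" for t x
  proof -
    obtain C where C: "\<forall>z. \<bar>z - x\<bar> < a - x \<longrightarrow> \<bar>W z\<bar> \<le> C" using W_bdd by blast
    show ?thesis
    proof (rule domain_of_dependence[OF J, of x "a - x" C])
      show "norm (ytt s z - yxx s z) \<le> C * norm (y s z)" if "0 \<le> s" "\<bar>z - x\<bar> < a - x - s" for s z
        using C that by (simp add: pde mult_right_mono)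
    qed (use tx in \<open>auto simp: yt0 intro: y0\<close>)
  qed
  \<comment> \<open>The difference of \<open>y\<close> and its time reversal satisfies the same
    equation and has zero data, because \<open>yt\<close> vanishes initially.\<close>
  have even: "y t x = y (- t) x" if t: "0 \<le> t" for t x
  proof -
    obtain C where C: "\<forall>z. \<bar>z - x\<bar> < t + 1 \<longrightarrow> \<bar>W z\<bar> \<le> C" using W_bdd by blast
    have J': "C2_jet (\<lambda>t x. y t x - y (- t) x) (\<lambda>t x. yt t x - - yt (- t) x) (\<lambda>t x. yx t x - yx (- t) x)
      (\<lambda>t x. ytt t x - ytt (- t) x) (\<lambda>t x. ytx t x - - ytx (- t) x) (\<lambda>t x. yxx t x - yxx (- t) x)"
      using C2_jet_diff[OF J C2_jet_affine[OF J, of 0 "-1" 0 1]] by simp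
    have "y t x - y (- t) x = 0"
    proof (rule domain_of_dependence[OF J', where c = x and h = "t + 1" and C = C])
      fix s z :: real assume "0 \<le> s" and z: "\<bar>z - x\<bar> < t + 1 - s"
      have "ytt s z - ytt (- s) z - (yxx s z - yxx (- s) z) = (ytt s z - yxx s z) - (ytt (- s) z - yxx (- s) z)"
        by (simp add: algebra_simps)
      also have "\<dots> = - (W z *\<^sub>R (y s z - y (- s) z))"
        by (simp only: pde) (simp add: scaleR_diff_right)
      finally show "norm (ytt s z - ytt (- s) z - (yxx s z - yxx (- s) z)) \<le> C * norm (y s z - y (- s) z)"
        using C z \<open>0 \<le> s\<close> by (simp add: mult_right_mono)
    qed (use t in \<open>auto simp: yt0\<close>)
    then show ?thesis by simp
  qed
  \<comment> \<open>Since \<open>p < a\<close>, the line t + x = \<open>p\<close> runs through the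
    region emptied by \<open>dep\<close>. The other side \<open>- p < t - x\<close> of the wedge
    makes t positive, as \<open>dep\<close> and \<open>bdd\<close> require.\<close>
  define p where "p = a - 1"
  \<comment> \<open>The summand 1 avoids a division by zero when \<open>B = 0\<close>.\<close>
  define d where "d = 1 / (2 * (B + 1))"
  have B: "0 \<le> B" using g(2)[of 0] by simp
  have d: "0 < d" "d * B \<le> 1 / 2" using B by (auto simp: d_def field_simps)
  have strip: "\<forall>t x. p \<le> t + x \<longrightarrow> t + x \<le> p + n * d \<longrightarrow> - p < t - x \<longrightarrow> y t x = 0" for n :: nat
  proof (induction n)
    case 0
    show ?case by (auto intro!: dep simp: p_def)
  next
    case (Suc n)
    obtain K where K: "\<forall>t x. 0 \<le> t \<longrightarrow> t + x \<le> p + n * d + d \<longrightarrow> norm (y t x) \<le> K"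
      using bdd by blast
    show ?case
    proof safe
      fix t x assume tx: "p \<le> t + x" "t + x \<le> p + real (Suc n) * d" "- p < t - x"
      show "y t x = 0"
      proof (cases "t + x \<le> p + n * d")
        case True
        then show ?thesis using Suc.IH tx by blast
      next
        case False
        show ?thesis
        proof (rule Goursat_strip[OF J _ g(1) _ g(2) G _ lim _ d(2), of "p + n * d" "- p" K])
          show "norm (ytt t x - yxx t x) \<le> g' x * norm (y t x)" for t x
            using W(2)[of x] by (auto simp: pde intro!: mult_right_mono)
          show "0 \<le> g' z" for z using W(2)[of z] by linarith
          show "norm (y t x) \<le> K" if "p + n * d \<le> t + x" "t + x \<le> p + n * d + d" "- p < t - x" for t x
          proof -
            have "0 \<le> n * d" using d by simp
            then have "0 \<le> t" using that by linarith
            then show ?thesis using K that by blast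
          qed
          show "y t x = 0" if "t + x = p + n * d" "- p < t - x" for t x
            using Suc.IH that d(1) by simp
        qed (use tx False in \<open>auto simp: algebra_simps\<close>)
      qed
    qed
  qed
  have wedge: "y t x = 0" if "p \<le> t + x" "- p < t - x" for t x
  proof -
    obtain n :: nat where "(t + x - p) / d \<le> n" using real_arch_simple by blast
    then have "t + x \<le> p + n * d" using d by (simp add: field_simps)
    then show ?thesis using strip that by blast
  qed
  \<comment> \<open>For nonnegative t, a point left of \<open>p\<close> is either below the line t +
    x = \<open>a\<close> or inside the wedge; evenness covers negative times.\<close>
  have left: "y t x = 0" if x: "x < p" for t x
  proof -
    have *: "y t x = 0" if t: "0 \<le> t" for t
      using dep[OF t, of x] wedge[of t x] x by (cases "t + x < a") (auto simp: p_def)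
    show ?thesis
      using *[of t] *[of "- t"] even[of "- t" x] by (cases "0 \<le> t") auto
  qed
  \<comment> \<open>One unit to the left of \<open>p\<close>, so \<open>y\<close> vanishes near the
    line x = \<open>q\<close>, and both \<open>y\<close> and \<open>yx\<close> are zero on it for
    all times: Cauchy data for the evolution in x.\<close>
  define q where "q = p - 1"
  show ?thesis
  proof (cases "x < p")
    case False
    obtain C where C: "\<forall>z. \<bar>z - x\<bar> < x - q + 1 \<longrightarrow> \<bar>W z\<bar> \<le> C" using W_bdd by blast
    have J': "C2_jet (\<lambda>s z. y z (q + s)) (\<lambda>s z. yx z (q + s)) (\<lambda>s z. yt z (q + s))
        (\<lambda>s z. yxx z (q + s)) (\<lambda>s z. ytx z (q + s)) (\<lambda>s z. ytt z (q + s))"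
      using C2_jet_affine[OF C2_jet_swap[OF J], where p = q and \<sigma> = 1 and q = 0 and \<tau> = 1] by simp
    have "y t (q + (x - q)) = 0"
    proof (rule domain_of_dependence[OF J', where c = t and h = "x - q + 1" and C = C])
      fix s z assume s: "0 \<le> s" "\<bar>z - t\<bar> < x - q + 1 - s"
      then have "\<bar>W (q + s)\<bar> \<le> C" using False by (intro C[rule_format]) (auto simp: q_def)
      then show "norm (yxx z (q + s) - ytt z (q + s)) \<le> C * norm (y z (q + s))"
        using arg_cong[OF pde[of z "q + s"], of norm] by (simp add: norm_minus_commute mult_right_mono)
    next
      fix z :: real
      show "y z (q + 0) = 0" using left[of q] by (simp add: q_def)
      have "((\<lambda>s. y (z + 0 * s) (q + 1 * s)) has_vector_derivative yx z q) (at 0)"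
        using C2_jet_line(1)[OF J, of z 0 q 1 0] by simp
      moreover have "\<forall>\<^sub>F s in nhds (0::real). y (z + 0 * s) (q + 1 * s) = 0"
      proof -
        have "\<forall>\<^sub>F s in nhds (0::real). dist s 0 < 1"
          by (auto simp: eventually_nhds_metric intro!: exI[of _ 1])
        then show ?thesis by eventually_elim (auto intro!: left simp: q_def dist_real_def)
      qed
      ultimately show "yx z (q + 0) = 0"
        using derivative_zero_if_locally_zero by fastforce
    qed (use False in \<open>auto simp: q_def\<close>)
    then show ?thesis by simp
  qed (rule left)
qed

subsection \<open>Integration over the unit sphere\<close>

text \<open>
  A multiple of the surface measure. It is rotation invariant because Lebesgue measure on the ball
  is; its space is the sphere itself, so that continuity on the sphere suffices for measurability.
\<close>

definition sphere_measure :: "(real ^ 3) measure" where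
  "sphere_measure = distr (restrict_space lborel (ball 0 1 - {0})) (restrict_space borel (sphere 0 1)) sgn"

lemma space_sphere_measure [simp]: "space sphere_measure = sphere 0 1"
  by (simp add: sphere_measure_def space_restrict_space)

lemma sets_sphere_measure [measurable_cong]: "sets sphere_measure = sets (restrict_space borel (sphere 0 1))"
  by (simp add: sphere_measure_def)

lemma sgn_measurable_sphere:
  "sgn \<in> measurable (restrict_space lborel (ball 0 1 - {0::real^3})) (restrict_space borel (sphere 0 1))"
proof (rule measurable_restrict_space2)
  show "sgn \<in> borel_measurable (restrict_space lborel (ball 0 1 - {0::real^3}))"
    by (rule measurable_restrict_space1) (simp add: sgn_div_norm[abs_def])
qed (auto simp: space_restrict_space norm_sgn)

lemma emeasure_sphere_measure:
  assumes "A \<in> sets sphere_measure"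
  shows "emeasure sphere_measure A = emeasure lborel {y \<in> ball 0 1 - {0}. sgn y \<in> A}"
proof -
  have "emeasure sphere_measure A =
      emeasure (restrict_space lborel (ball 0 1 - {0::real^3})) (sgn -` A \<inter> space (restrict_space lborel (ball 0 1 - {0})))"
    unfolding sphere_measure_def
    by (rule emeasure_distr[OF sgn_measurable_sphere]) (use assms in \<open>simp add: sets_sphere_measure\<close>)
  also have "\<dots> = emeasure lborel (sgn -` A \<inter> space (restrict_space lborel (ball 0 1 - {0::real^3})))"
    by (rule emeasure_restrict_space) (auto simp: space_restrict_space)
  also have "sgn -` A \<inter> space (restrict_space lborel (ball 0 1 - {0::real^3})) = {y \<in> ball 0 1 - {0}. sgn y \<in> A}"
    by (auto simp: space_restrict_space)
  finally show ?thesis .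
qed

lemma sphere_preimage_borel:
  assumes "A \<in> sets sphere_measure"
  shows "{y \<in> ball 0 1 - {0::real^3}. sgn y \<in> A} \<in> sets borel"
proof -
  obtain A' where A': "A' \<in> sets borel" "A = sphere 0 1 \<inter> A'"
    using assms by (auto simp: sets_sphere_measure sets_restrict_space)
  have "{y \<in> ball 0 1 - {0::real^3}. sgn y \<in> A} = (ball 0 1 - {0}) \<inter> (sgn -` A' \<inter> space borel)"
    using A' by (auto simp: norm_sgn)
  moreover have "sgn -` A' \<inter> space borel \<in> sets (borel :: (real^3) measure)"
    by (rule measurable_sets[OF _ A'(1)]) (simp add: sgn_div_norm[abs_def])
  ultimately show ?thesis by auto
qed

lemma finite_measure_sphere: "finite_measure sphere_measure"
proof (rule finite_measureI)
  have "emeasure lborel {y \<in> ball 0 1 - {0}. sgn y \<in> sphere (0::real^3) 1} \<le> emeasure lborel (cball (0::real^3) 1)"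
    by (rule emeasure_mono) auto
  also have "\<dots> < \<infinity>" by (rule emeasure_lborel_cball_finite)
  finally show "emeasure sphere_measure (space sphere_measure) \<noteq> \<infinity>"
    using emeasure_sphere_measure[of "sphere 0 1"] sets.top[of sphere_measure] by auto
qed

interpretation sphere: finite_measure sphere_measure by (rule finite_measure_sphere)

lemma borel_measurable_sphere:
  fixes f :: "real^3 \<Rightarrow> 'b::{second_countable_topology, real_normed_vector}"
  assumes "continuous_on (sphere 0 1) f"
  shows "f \<in> borel_measurable sphere_measure"
  using borel_measurable_continuous_on_restrict[OF assms]
  by (simp add: measurable_cong_sets[OF sets_sphere_measure])

lemma integrable_sphere:
  fixes f :: "real^3 \<Rightarrow> 'b::{second_countable_topology, banach}"
  assumes "continuous_on (sphere 0 1) f"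
  shows "integrable sphere_measure f"
proof -
  obtain B where "\<And>x. x \<in> sphere 0 1 \<Longrightarrow> norm (f x) \<le> B"
    using continuous_on_compact_bound[OF compact_sphere assms] by blast
  then show ?thesis
    by (intro sphere.integrable_const_bound[of _ B] borel_measurable_sphere assms AE_I2) simp
qed

text \<open>\<open>T\<close> commutes with \<open>sgn\<close>, so the cone over the preimage of a
  set is the image of the cone over the set under the inverse of \<open>T\<close>, which preserves
  Lebesgue measure.\<close>

lemma distr_sphere_measure_orthogonal:
  assumes T: "orthogonal_transformation T"
  shows "distr sphere_measure sphere_measure T = sphere_measure"
    and "T \<in> measurable sphere_measure sphere_measure"
proof -
  have "continuous_on UNIV T"
    by (rule linear_continuous_on[OF linear_conv_bounded_linear[THEN iffD1, OF orthogonal_transformation_linear[OF T]]])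
  then have "continuous_on (sphere 0 1) T" by (rule continuous_on_subset) simp
  from borel_measurable_sphere[OF this] show Tm: "T \<in> measurable sphere_measure sphere_measure"
    unfolding measurable_cong_sets[OF refl sets_sphere_measure]
    by (rule measurable_restrict_space2[rotated]) (auto simp: orthogonal_transformation_norm[OF T])
  show "distr sphere_measure sphere_measure T = sphere_measure"
  proof (rule measure_eqI)
    fix A assume "A \<in> sets (distr sphere_measure sphere_measure T)"
    then have A: "A \<in> sets sphere_measure" by simp
    let ?C = "{y \<in> ball 0 1 - {0}. sgn y \<in> A}"
    have A_sub: "A \<subseteq> sphere 0 1" using sets.sets_into_space[OF A] by simp
    have TA: "T -` A \<inter> space sphere_measure \<in> sets sphere_measure"
      by (rule measurable_sets[OF Tm A])
    have T0: "T y = 0 \<longleftrightarrow> y = 0" for y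
      using orthogonal_transformation_norm[OF T, of y] by auto
    have T_sgn: "T (sgn y) = sgn (T y)" for y
      using orthogonal_transformation_linear[OF T]
      by (simp add: sgn_div_norm orthogonal_transformation_norm[OF T] linear_cmul)
    have "{y \<in> ball 0 1 - {0}. sgn y \<in> T -` A \<inter> space sphere_measure} = T -` ?C"
      using A_sub by (auto simp: T_sgn T0 orthogonal_transformation_norm[OF T] norm_sgn)
    also have "\<dots> = inv T ` ?C"
      by (rule bij_vimage_eq_inv_image[OF orthogonal_transformation_bij[OF T]])
    finally have eq: "{y \<in> ball 0 1 - {0}. sgn y \<in> T -` A \<inter> space sphere_measure} = inv T ` ?C" .
    have C: "?C \<in> lmeasurable"
      by (rule bounded_set_imp_lmeasurable)
        (use sphere_preimage_borel[OF A] in \<open>auto intro: bounded_subset[OF bounded_ball[of 0 1]]\<close>)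
    note inv = orthogonal_transformation_inv[OF T]
    have "emeasure (distr sphere_measure sphere_measure T) A = emeasure lborel (inv T ` ?C)"
      unfolding emeasure_distr[OF Tm A] emeasure_sphere_measure[OF TA] eq ..
    also have "inv T ` ?C \<in> sets borel"
      using sphere_preimage_borel[OF TA] unfolding eq .
    then have "emeasure lborel (inv T ` ?C) = emeasure lebesgue (inv T ` ?C)" by simp
    also have "\<dots> = emeasure lebesgue ?C"
      using measure_orthogonal_image[OF inv C] measurable_orthogonal_image[OF inv C] C
      by (simp add: emeasure_eq_measure2)
    also have "\<dots> = emeasure lborel ?C" using sphere_preimage_borel[OF A] by simp
    also have "\<dots> = emeasure sphere_measure A" by (simp add: emeasure_sphere_measure[OF A])
    finally show "emeasure (distr sphere_measure sphere_measure T) A = emeasure sphere_measure A" .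
  qed simp
qed

lemma integral_sphere_orthogonal:
  fixes f :: "real^3 \<Rightarrow> 'b::{second_countable_topology, banach}"
  assumes T: "orthogonal_transformation T" and f: "continuous_on (sphere 0 1) f"
  shows "(\<integral>\<omega>. f (T \<omega>) \<partial>sphere_measure) = (\<integral>\<omega>. f \<omega> \<partial>sphere_measure)"
  using integral_distr[OF distr_sphere_measure_orthogonal(2)[OF T] borel_measurable_sphere[OF f]]
  by (simp add: distr_sphere_measure_orthogonal(1)[OF T])

text \<open>The measure charges every nonempty relatively open set: the cone over the points where
  \<open>f\<close> does not vanish is open in space, and an open negligible set is empty.\<close>

lemma integral_sphere_eq_0D:
  fixes f :: "real^3 \<Rightarrow> real"
  assumes f: "continuous_on (sphere 0 1) f" and nn: "\<And>\<omega>. \<omega> \<in> sphere 0 1 \<Longrightarrow> 0 \<le> f \<omega>"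
    and int: "(\<integral>\<omega>. f \<omega> \<partial>sphere_measure) = 0" and \<omega>: "\<omega> \<in> sphere 0 1"
  shows "f \<omega> = 0"
proof (rule ccontr)
  assume "f \<omega> \<noteq> 0"
  have "AE \<omega> in sphere_measure. f \<omega> = 0"
  proof (rule integral_nonneg_eq_0_iff_AE[OF integrable_sphere[OF f], THEN iffD1])
    show "AE \<omega> in sphere_measure. 0 \<le> f \<omega>" by (rule AE_I2) (use nn in simp)
  qed (rule int)
  then obtain N where N: "N \<in> sets sphere_measure" "emeasure sphere_measure N = 0"
      "{\<omega> \<in> sphere 0 1. f \<omega> \<noteq> 0} \<subseteq> N"
    by (auto elim!: AE_E)
  let ?C = "{y \<in> ball 0 1 - {0}. sgn y \<in> N}"
  let ?O = "{y \<in> ball 0 1 - {0::real^3}. f (sgn y) \<in> - {0}}"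
  have "emeasure lborel ?C = 0" using N(1,2) by (simp add: emeasure_sphere_measure)
  then have "?C \<in> null_sets lborel" using sphere_preimage_borel[OF N(1)] by auto
  then have "negligible ?C"
    by (simp add: negligible_iff_null_sets null_sets_completionI)
  moreover have "?O \<subseteq> ?C" using N(3) by (auto simp: norm_sgn)
  ultimately have "negligible ?O" by (rule negligible_subset)
  moreover have "open ?O"
  proof -
    have "continuous_on (ball 0 1 - {0::real^3}) (\<lambda>y. f (sgn y))"
    proof (rule continuous_on_compose2[OF f])
      show "continuous_on (ball 0 1 - {0::real^3}) sgn"
        by (auto intro!: continuous_intros simp: sgn_div_norm[abs_def])
    qed (auto simp: norm_sgn split: if_splits)
    then have "open ((ball 0 1 - {0::real^3}) \<inter> (\<lambda>y. f (sgn y)) -` (- {0}))"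
      by (rule continuous_open_preimage) (auto intro: open_delete)
    then show ?thesis by (simp add: vimage_def Int_def conj_commute)
  qed
  moreover have "\<omega> /\<^sub>R 2 \<in> ?O"
    using \<omega> \<open>f \<omega> \<noteq> 0\<close> by (auto simp: sgn_div_norm)
  ultimately show False using open_not_negligible by blast
qed

section \<open>Integrals over the sphere that depend on a parameter\<close>

lemma linear_expand:
  fixes v :: "'a::euclidean_space"
  assumes "linear f"
  shows "f v = (\<Sum>b\<in>Basis. (v \<bullet> b) *\<^sub>R f b)"
  using linear_sum[OF assms, of "\<lambda>b. (v \<bullet> b) *\<^sub>R b" Basis]
  by (simp add: euclidean_representation linear_cmul[OF assms])

lemma continuous_on_section:
  fixes F :: "'p::topological_space \<Rightarrow> 's::topological_space \<Rightarrow> 'b::topological_space"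
  assumes F: "continuous_on (U \<times> S) (\<lambda>(p, \<omega>). F p \<omega>)"
  shows "p \<in> U \<Longrightarrow> continuous_on S (F p)" and "\<omega> \<in> S \<Longrightarrow> continuous_on U (\<lambda>p. F p \<omega>)"
proof -
  show "continuous_on S (F p)" if "p \<in> U"
    using continuous_on_compose2[OF F continuous_on_Pair[OF continuous_on_const continuous_on_id, of S p]] that
    by auto
  show "continuous_on U (\<lambda>p. F p \<omega>)" if "\<omega> \<in> S"
    using continuous_on_compose2[OF F continuous_on_Pair[OF continuous_on_id continuous_on_const, of U \<omega>]] that
    by auto
qed

text \<open>A convergent sequence together with its limit is compact, and so is its product with the
  sphere; the integrand is bounded there, which gives a constant dominating function.\<close>

lemma continuous_on_sphere_integral:
  fixes F :: "'p::heine_borel \<Rightarrow> real^3 \<Rightarrow> 'b::{second_countable_topology, banach}"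
  assumes F: "continuous_on (U \<times> sphere 0 1) (\<lambda>(p, \<omega>). F p \<omega>)"
  shows "continuous_on U (\<lambda>p. \<integral>\<omega>. F p \<omega> \<partial>sphere_measure)"
proof (rule continuous_on_sequentiallyI)
  fix u a assume u: "\<forall>n. u n \<in> U" "a \<in> U" "u \<longlonglongrightarrow> a"
  have Fp: "continuous_on (sphere 0 1) (F p)" if "p \<in> U" for p
    by (rule continuous_on_section(1)[OF F that])
  have "compact (insert a (range u) \<times> sphere (0::real^3) 1)"
    using u(3) by (intro compact_Times compact_sequence_with_limit) auto
  then obtain B where B: "\<And>q. q \<in> insert a (range u) \<times> sphere 0 1 \<Longrightarrow> norm (case q of (p, \<omega>) \<Rightarrow> F p \<omega>) \<le> B"
    by (rule continuous_on_compact_bound[where f = "\<lambda>(p, \<omega>). F p \<omega>"]) (use u in \<open>auto intro: continuous_on_subset[OF F]\<close>)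
  show "(\<lambda>n. \<integral>\<omega>. F (u n) \<omega> \<partial>sphere_measure) \<longlonglongrightarrow> (\<integral>\<omega>. F a \<omega> \<partial>sphere_measure)"
  proof (rule integral_dominated_convergence[where w = "\<lambda>_. B"])
    show "AE \<omega> in sphere_measure. (\<lambda>n. F (u n) \<omega>) \<longlonglongrightarrow> F a \<omega>"
    proof (intro AE_I2)
      fix \<omega> :: "real^3" assume "\<omega> \<in> space sphere_measure"
      then have "continuous_on U (\<lambda>p. F p \<omega>)"
        by (intro continuous_on_section(2)[OF F]) simp
      then show "(\<lambda>n. F (u n) \<omega>) \<longlonglongrightarrow> F a \<omega>"
        using u by (auto simp: continuous_on_sequentially o_def)
    qed
    show "AE \<omega> in sphere_measure. norm (F (u n) \<omega>) \<le> B" for n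
      using B[of "(u n, \<omega>)" for \<omega>] by (intro AE_I2) auto
  qed (use u in \<open>auto intro!: borel_measurable_sphere Fp\<close>)
qed

text \<open>The derivative is total because the jets need it in (t, r) jointly. Uniform continuity
  of \<open>F'\<close> on a closed ball times the sphere makes the error in the mean value
  inequality uniform in \<open>\<omega>\<close>.\<close>

lemma has_derivative_sphere_integral:
  fixes F :: "'p::euclidean_space \<Rightarrow> real^3 \<Rightarrow> 'b::{second_countable_topology, banach}"
  assumes U: "open U" "p \<in> U"
    and F: "\<And>q. q \<in> U \<Longrightarrow> continuous_on (sphere 0 1) (F q)"
    and F': "\<And>q \<omega>. q \<in> U \<Longrightarrow> \<omega> \<in> sphere 0 1 \<Longrightarrow> ((\<lambda>q. F q \<omega>) has_derivative F' q \<omega>) (at q)"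
    and cont: "\<And>v. continuous_on (U \<times> sphere 0 1) (\<lambda>(q, \<omega>). F' q \<omega> v)"
  shows "((\<lambda>q. \<integral>\<omega>. F q \<omega> \<partial>sphere_measure) has_derivative (\<lambda>v. \<integral>\<omega>. F' p \<omega> v \<partial>sphere_measure)) (at p)"
proof -
  have cF': "continuous_on (sphere 0 1) (\<lambda>\<omega>. F' q \<omega> v)" if "q \<in> U" for q v
    by (rule continuous_on_section(1)[OF cont that])
  have lin: "linear (F' q \<omega>)" if "q \<in> U" "\<omega> \<in> sphere 0 1" for q \<omega>
    using has_derivative_linear[OF F'[OF that]] .
  have "linear (\<lambda>v. \<integral>\<omega>. F' p \<omega> v \<partial>sphere_measure)"
  proof (rule linearI)
    fix v w
    have "(\<integral>\<omega>. F' p \<omega> (v + w) \<partial>sphere_measure) = (\<integral>\<omega>. F' p \<omega> v + F' p \<omega> w \<partial>sphere_measure)"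
      by (rule Bochner_Integration.integral_cong) (use lin[OF U(2)] in \<open>auto simp: linear_add\<close>)
    then show "(\<integral>\<omega>. F' p \<omega> (v + w) \<partial>sphere_measure) = (\<integral>\<omega>. F' p \<omega> v \<partial>sphere_measure) + (\<integral>\<omega>. F' p \<omega> w \<partial>sphere_measure)"
      using cF'[OF U(2)] by (simp add: integrable_sphere)
  next
    fix c v
    have "(\<integral>\<omega>. F' p \<omega> (c *\<^sub>R v) \<partial>sphere_measure) = (\<integral>\<omega>. c *\<^sub>R F' p \<omega> v \<partial>sphere_measure)"
      by (rule Bochner_Integration.integral_cong) (use lin[OF U(2)] in \<open>auto simp: linear_cmul\<close>)
    then show "(\<integral>\<omega>. F' p \<omega> (c *\<^sub>R v) \<partial>sphere_measure) = c *\<^sub>R (\<integral>\<omega>. F' p \<omega> v \<partial>sphere_measure)"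
      by simp
  qed
  moreover have "\<exists>d>0. \<forall>q\<in>UNIV. norm (q - p) < d \<longrightarrow>
      norm ((\<integral>\<omega>. F q \<omega> \<partial>sphere_measure) - (\<integral>\<omega>. F p \<omega> \<partial>sphere_measure) - (\<integral>\<omega>. F' p \<omega> (q - p) \<partial>sphere_measure))
        \<le> e * norm (q - p)" if e: "e > 0" for e
  proof -
    obtain r where r: "r > 0" "cball p r \<subseteq> U" using U open_contains_cball by blast
    \<comment> \<open>The summand 1 makes \<open>m\<close> positive. The dimension in
      \<open>e'\<close> pays for bounding the operator norm through the values on
      \<open>Basis\<close>, since continuity is assumed for one direction at a time.\<close>
    define m where "m = measure sphere_measure (sphere 0 1) + 1"
    define e' where "e' = e / (m * DIM('p))"
    have m: "0 < m" unfolding m_def by (simp add: add_nonneg_pos)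
    have e': "0 < e'" using e m by (simp add: e'_def)
    have "\<exists>d>0. \<forall>q\<in>cball p r. \<forall>\<omega>\<in>sphere 0 1. dist q p < d \<longrightarrow> norm (F' q \<omega> b - F' p \<omega> b) \<le> e'" for b
    proof -
      have "uniformly_continuous_on (cball p r \<times> sphere 0 1) (\<lambda>(q, \<omega>). F' q \<omega> b)"
        by (intro compact_uniformly_continuous compact_Times continuous_on_subset[OF cont]) (use r in auto)
      then obtain d where d: "d > 0" "\<And>x y. x \<in> cball p r \<times> sphere 0 1 \<Longrightarrow> y \<in> cball p r \<times> sphere 0 1 \<Longrightarrow>
          dist y x < d \<Longrightarrow> dist (case y of (q, \<omega>) \<Rightarrow> F' q \<omega> b) (case x of (q, \<omega>) \<Rightarrow> F' q \<omega> b) < e'"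
        using e' unfolding uniformly_continuous_on_def by metis
      have "norm (F' q \<omega> b - F' p \<omega> b) \<le> e'" if "q \<in> cball p r" "\<omega> \<in> sphere 0 1" "dist q p < d" for q \<omega>
        using d(2)[of "(p, \<omega>)" "(q, \<omega>)"] that r by (simp add: dist_Pair_Pair dist_norm[symmetric] less_imp_le)
      then show ?thesis using d(1) by blast
    qed
    then obtain d where d: "\<And>b. d b > 0" "\<And>b q \<omega>. q \<in> cball p r \<Longrightarrow> \<omega> \<in> sphere 0 1 \<Longrightarrow> dist q p < d b \<Longrightarrow>
        norm (F' q \<omega> b - F' p \<omega> b) \<le> e'"
      by metis
    define d0 where "d0 = min r (Min (d ` Basis))"
    have d0: "d0 > 0" "d0 \<le> r" "\<And>b. b \<in> Basis \<Longrightarrow> d0 \<le> d b"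
      using d r by (auto simp: d0_def intro!: min.coboundedI2 Min_le)
    have "norm ((\<integral>\<omega>. F q \<omega> \<partial>sphere_measure) - (\<integral>\<omega>. F p \<omega> \<partial>sphere_measure) - (\<integral>\<omega>. F' p \<omega> (q - p) \<partial>sphere_measure))
        \<le> e * norm (q - p)" if q: "norm (q - p) < d0" for q
    proof -
      have in_U: "z \<in> U" "z \<in> cball p r" if "z \<in> ball p d0" for z
        using that r d0 by auto
      have qU: "q \<in> U" using in_U[of q] q by (simp add: dist_norm norm_minus_commute)
      have pt: "norm (F q \<omega> - F p \<omega> - F' p \<omega> (q - p)) \<le> norm (q - p) * (e' * DIM('p))" if \<omega>: "\<omega> \<in> sphere 0 1" for \<omega>
      proof (rule differentiable_bound_linearization[where S = "ball p d0" and f' = "\<lambda>z. F' z \<omega>"])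
        show "p + t *\<^sub>R (q - p) \<in> ball p d0" if "t \<in> {0..1}" for t
        proof -
          have "\<bar>t\<bar> * norm (q - p) \<le> 1 * norm (q - p)" using that by (intro mult_right_mono) auto
          then show ?thesis using q by (simp add: dist_norm)
        qed
        show "((\<lambda>q. F q \<omega>) has_derivative F' z \<omega>) (at z within ball p d0)" if "z \<in> ball p d0" for z
          by (rule has_derivative_at_withinI[OF F'[OF in_U(1)[OF that] \<omega>]])
        show "p \<in> ball p d0" using d0 by simp
        show "onorm (F' z \<omega> - F' p \<omega>) \<le> e' * DIM('p)" if z: "z \<in> ball p d0" for z
        proof (rule onorm_le)
          fix v
          have "(F' z \<omega> - F' p \<omega>) v = (\<Sum>b\<in>Basis. (v \<bullet> b) *\<^sub>R (F' z \<omega> b - F' p \<omega> b))"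
            using linear_expand[OF lin[OF in_U(1)[OF z] \<omega>], of v] 
              linear_expand[OF lin[OF U(2) \<omega>], of v]
            by (simp add: scaleR_diff_right sum_subtractf)
          also have "norm \<dots> \<le> (\<Sum>b\<in>(Basis :: 'p set). norm v * e')"
          proof (rule sum_norm_le)
            fix b :: 'p assume b: "b \<in> Basis"
            have "norm (F' z \<omega> b - F' p \<omega> b) \<le> e'"
              using d(2)[OF in_U(2)[OF z] \<omega>, of b] z d0(3)[OF b] by (simp add: dist_commute)
            then show "norm ((v \<bullet> b) *\<^sub>R (F' z \<omega> b - F' p \<omega> b)) \<le> norm v * e'"
              using Basis_le_norm[OF b, of v] by (simp add: mult_mono)
          qed
          also have "\<dots> = e' * DIM('p) * norm v" by simp
          finally show "norm ((F' z \<omega> - F' p \<omega>) v) \<le> e' * DIM('p) * norm v" .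
        qed
      qed
      note ints = integrable_sphere[OF F[OF qU]] integrable_sphere[OF F[OF U(2)]] integrable_sphere[OF cF'[OF U(2)]]
      have "(\<integral>\<omega>. F q \<omega> \<partial>sphere_measure) - (\<integral>\<omega>. F p \<omega> \<partial>sphere_measure) - (\<integral>\<omega>. F' p \<omega> (q - p) \<partial>sphere_measure)
          = (\<integral>\<omega>. F q \<omega> - F p \<omega> - F' p \<omega> (q - p) \<partial>sphere_measure)"
        using ints by simp
      also have "norm \<dots> \<le> (\<integral>\<omega>. norm (q - p) * (e' * DIM('p)) \<partial>sphere_measure)"
      proof (rule Bochner_Integration.integral_norm_bound_integral)
        show "integrable sphere_measure (\<lambda>\<omega>. F q \<omega> - F p \<omega> - F' p \<omega> (q - p))" using ints by simp
      qed (use pt in auto)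
      also have "\<dots> = measure sphere_measure (sphere 0 1) * (norm (q - p) * (e' * DIM('p)))" by simp
      also have "\<dots> \<le> m * (norm (q - p) * (e' * DIM('p)))"
        using e' by (intro mult_right_mono) (auto simp: m_def)
      also have "\<dots> = e * norm (q - p)" using m by (simp add: e'_def)
      finally show ?thesis .
    qed
    then show ?thesis using d0(1) by blast
  qed
  ultimately show ?thesis
    unfolding has_derivative_within_alt by (simp add: linear_conv_bounded_linear)
qed

section \<open>Rotations as the source of integration by parts on the sphere\<close>

definition rotation :: "real^3 \<Rightarrow> real \<Rightarrow> real^3 \<Rightarrow> real^3" where
  "rotation a \<theta> y = y + sin \<theta> *\<^sub>R (cross3 a y) + (1 - cos \<theta>) *\<^sub>R cross3 a (cross3 a y)"

text \<open>\<open>rotation\<close> is Rodrigues' formula. For a unit vector \<open>a\<close> the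
  vectors \<open>p\<close> and \<open>q\<close> are orthogonal and equally long, and invariance of
  the length reduces to sin^2 + (1 - cos)^2 = 2 (1 - cos).\<close>

lemma orthogonal_transformation_rotation:
  assumes "norm a = 1"
  shows "orthogonal_transformation (rotation a \<theta>)"
  unfolding orthogonal_transformation
proof
  show "linear (rotation a \<theta>)"
    unfolding rotation_def[abs_def]
    by (rule linearI) (simp_all add: cross_add_right cross_mult_right algebra_simps)
  show "\<forall>y. norm (rotation a \<theta> y) = norm y"
  proof
    fix y
    define p q where "p = cross3 a y" and "q = cross3 a p"
    have "y \<bullet> p = 0" "p \<bullet> q = 0" by (simp_all add: p_def q_def dot_cross_self)
    moreover have "y \<bullet> q = - (p \<bullet> p)"
      by (simp add: p_def q_def cross3_simps)
    moreover have "q \<bullet> q = p \<bullet> p"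
      using norm_cross_dot[of a p] assms by (simp add: p_def q_def dot_cross_self power2_norm_eq_inner)
    ultimately have *: "y \<bullet> p = 0" "p \<bullet> q = 0" "y \<bullet> q = - (p \<bullet> p)" "q \<bullet> q = p \<bullet> p" by auto
    have "rotation a \<theta> y \<bullet> rotation a \<theta> y
        = y \<bullet> y + ((sin \<theta>)\<^sup>2 + (1 - cos \<theta>)\<^sup>2 - 2 * (1 - cos \<theta>)) * (p \<bullet> p)"
    proof -
      have "cos \<theta> * (cos \<theta> * z) + sin \<theta> * (sin \<theta> * z) = z" for z
        using sin_cos_squared_add3[of \<theta>] by (simp flip: mult.assoc distrib_right)
      note trig = this
      show ?thesis
        unfolding rotation_def p_def[symmetric] q_def[symmetric] using *
        by (simp add: inner_commute algebra_simps power2_eq_square) (rule trig)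
    qed
    also have "(sin \<theta>)\<^sup>2 + (1 - cos \<theta>)\<^sup>2 - 2 * (1 - cos \<theta>) = 0"
      by (simp add: sin_squared_eq power2_eq_square algebra_simps)
    finally show "norm (rotation a \<theta> y) = norm y" by (simp add: norm_eq)
  qed
qed

lemma has_vector_derivative_rotation:
  "((\<lambda>\<theta>. rotation a \<theta> y) has_vector_derivative cos \<theta> *\<^sub>R (cross3 a y) + sin \<theta> *\<^sub>R cross3 a (cross3 a y)) (at \<theta>)"
  unfolding rotation_def by (auto intro!: derivative_eq_intros simp: has_vector_derivative_def algebra_simps)

text \<open>Turns continuity in each fixed direction into continuity with a varying direction, as a
  linear map in finite dimension is determined by its values on \<open>Basis\<close>.\<close>

lemma continuous_on_linear_family:
  fixes f' :: "'q::topological_space \<Rightarrow> 'v::euclidean_space \<Rightarrow> 'b::real_normed_vector"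
  assumes "\<And>v. continuous_on S (\<lambda>q. f' q v)" "continuous_on S w" "\<And>q. q \<in> S \<Longrightarrow> linear (f' q)"
  shows "continuous_on S (\<lambda>q. f' q (w q))"
proof -
  have "continuous_on S (\<lambda>q. \<Sum>b\<in>Basis. (w q \<bullet> b) *\<^sub>R f' q b)"
    using assms(1,2) by (intro continuous_intros)
  then show ?thesis
    by (rule continuous_on_cong[THEN iffD1, rotated -1, OF _ refl]) (rule linear_expand[OF assms(3), symmetric])
qed

text \<open>By invariance the integral over rotated points does not depend on the angle;
  differentiating at angle 0 gives the integral of the derivative along the rotation field. All
  integration by parts on the sphere rests on this.\<close>

lemma integral_sphere_angular_derivative:
  fixes f :: "real^3 \<Rightarrow> 'b::{second_countable_topology, banach}"
  assumes a: "norm a = 1"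
    and f': "\<And>y. y \<noteq> 0 \<Longrightarrow> (f has_derivative f' y) (at y)"
    and cont: "\<And>v. continuous_on (- {0}) (\<lambda>y. f' y v)"
  shows "(\<integral>\<omega>. f' \<omega> (cross3 a \<omega>) \<partial>sphere_measure) = 0"
proof -
  define r' where "r' \<theta> y = cos \<theta> *\<^sub>R (cross3 a y) + sin \<theta> *\<^sub>R cross3 a (cross3 a y)" for \<theta> y
  have rot_norm: "norm (rotation a \<theta> y) = norm y" for \<theta> y
    by (rule orthogonal_transformation_norm[OF orthogonal_transformation_rotation[OF a]])
  then have rot0: "rotation a \<theta> y \<noteq> 0" if "y \<in> sphere 0 1" for \<theta> y
    using that by (metis mem_sphere_0 norm_zero zero_neq_one)
  have f_cont: "continuous_on (- {0}) f"
    using f' by (intro continuous_at_imp_continuous_on) (auto intro: has_derivative_continuous)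
  have rot_cont: "continuous_on S (\<lambda>(\<theta>, \<omega>). rotation a \<theta> \<omega>)" for S
    unfolding rotation_def split_beta by (intro continuous_intros continuous_on_cross)
  have r'_cont: "continuous_on S (\<lambda>(\<theta>, \<omega>). r' \<theta> \<omega>)" for S
    unfolding r'_def split_beta by (intro continuous_intros continuous_on_cross)
  have fr: "continuous_on (UNIV \<times> sphere 0 1) (\<lambda>(\<theta>, \<omega>). f (rotation a \<theta> \<omega>))"
    using continuous_on_compose2[OF f_cont rot_cont[of "UNIV \<times> sphere 0 1"]] rot0 by (force simp: split_beta)
  have "((\<lambda>\<theta>. \<integral>\<omega>. f (rotation a \<theta> \<omega>) \<partial>sphere_measure) has_derivative
      (\<lambda>h. \<integral>\<omega>. f' (rotation a 0 \<omega>) (h *\<^sub>R r' 0 \<omega>) \<partial>sphere_measure)) (at 0)"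
  proof (rule has_derivative_sphere_integral[where U = UNIV])
    show "continuous_on (sphere 0 1) (\<lambda>\<omega>. f (rotation a \<theta> \<omega>))" for \<theta>
      by (rule continuous_on_section(1)[OF fr]) simp
    show "((\<lambda>\<theta>. f (rotation a \<theta> \<omega>)) has_derivative (\<lambda>h. f' (rotation a \<theta> \<omega>) (h *\<^sub>R r' \<theta> \<omega>))) (at \<theta>)"
      if "\<omega> \<in> sphere 0 1" for \<theta> \<omega>
      using has_derivative_compose[OF has_vector_derivative_rotation[unfolded has_vector_derivative_def] f'[OF rot0[OF that]]]
      by (simp add: r'_def)
    show "continuous_on (UNIV \<times> sphere 0 1) (\<lambda>(\<theta>, \<omega>). f' (rotation a \<theta> \<omega>) (h *\<^sub>R r' \<theta> \<omega>))" for h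
      unfolding split_beta
    proof (rule continuous_on_linear_family)
      show "continuous_on (UNIV \<times> sphere 0 1) (\<lambda>q. f' (rotation a (fst q) (snd q)) v)" for v
        using continuous_on_compose2[OF cont[of v] rot_cont[of "UNIV \<times> sphere 0 1"]] rot0 by (force simp: split_beta)
      show "continuous_on (UNIV \<times> sphere 0 1) (\<lambda>q. h *\<^sub>R r' (fst q) (snd q))"
        using r'_cont by (intro continuous_intros) (simp add: split_beta)
      show "linear (f' (rotation a (fst q) (snd q)))" if "q \<in> UNIV \<times> sphere 0 1" for q
        using that rot0 by (intro has_derivative_linear[OF f']) auto
    qed
  qed auto
  moreover have const: "(\<lambda>\<theta>. \<integral>\<omega>. f (rotation a \<theta> \<omega>) \<partial>sphere_measure) = (\<lambda>\<theta>. \<integral>\<omega>. f \<omega> \<partial>sphere_measure)"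
    by (rule ext, rule integral_sphere_orthogonal[OF orthogonal_transformation_rotation[OF a]])
      (rule continuous_on_subset[OF f_cont], auto)
  then have "((\<lambda>\<theta>. \<integral>\<omega>. f (rotation a \<theta> \<omega>) \<partial>sphere_measure) has_derivative (\<lambda>h. 0)) (at 0)"
    by (simp only: has_derivative_const)
  ultimately have "(\<lambda>h. \<integral>\<omega>. f' (rotation a 0 \<omega>) (h *\<^sub>R r' 0 \<omega>) \<partial>sphere_measure) = (\<lambda>h. 0)"
    by (intro has_derivative_unique)
  from fun_cong[OF this, of 1] show ?thesis by (simp add: rotation_def r'_def)
qed

text \<open>
  The exponentials are limits of combinations of the functions \<open>(\<omega> \<bullet> \<xi>)\<^sup>n\<close>, and unlike these they
  span an algebra without further work.
\<close>

inductive exp_algebra :: "(real^3 \<Rightarrow> real) \<Rightarrow> bool" where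
  exp: "exp_algebra (\<lambda>\<omega>. exp (\<omega> \<bullet> \<xi>))"
| add: "exp_algebra f \<Longrightarrow> exp_algebra g \<Longrightarrow> exp_algebra (\<lambda>\<omega>. f \<omega> + g \<omega>)"
| scale: "exp_algebra f \<Longrightarrow> exp_algebra (\<lambda>\<omega>. c * f \<omega>)"

lemma exp_algebra_mult:
  assumes "exp_algebra f" "exp_algebra g"
  shows "exp_algebra (\<lambda>\<omega>. f \<omega> * g \<omega>)"
  using assms
proof (induction f)
  case (exp \<xi>)
  from exp.prems show ?case
  proof (induction g)
    case (exp \<eta>)
    then show ?case using exp_algebra.exp[of "\<xi> + \<eta>"] by (simp add: inner_add_right exp_add)
  next
    case (add f g)
    then show ?case using exp_algebra.add by (simp add: distrib_left)
  next
    case (scale f c)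
    then show ?case using exp_algebra.scale[of _ c] by (simp add: mult.left_commute)
  qed
next
  case (add f g)
  then show ?case using exp_algebra.add by (simp add: distrib_right)
next
  case (scale f c)
  then show ?case using exp_algebra.scale[of _ c] by (simp add: mult.assoc)
qed

lemma exp_algebra_continuous: "exp_algebra f \<Longrightarrow> continuous_on S f"
  by (induction rule: exp_algebra.induct) (auto intro!: continuous_intros)

lemma exp_algebra_const: "exp_algebra (\<lambda>_. c)"
  using scale[OF exp[of 0], of c] by simp

text \<open>Partial sums of the exponential series show that \<open>f\<close> is orthogonal to the
  exponentials, hence to the algebra that they span. If \<open>g\<close> in this algebra is
  uniformly within e of \<open>f\<close>, the integral of f^2 equals that of (f - g) f and is at
  most e times that of |f|.\<close>

lemma zero_if_moments_zero_real:
  fixes f :: "real^3 \<Rightarrow> real"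
  assumes f: "continuous_on (sphere 0 1) f"
    and mom: "\<And>\<xi> n. (\<integral>\<omega>. (\<omega> \<bullet> \<xi>) ^ n * f \<omega> \<partial>sphere_measure) = 0"
    and \<omega>: "\<omega> \<in> sphere 0 1"
  shows "f \<omega> = 0"
proof -
  have exp0: "(\<integral>\<omega>. exp (\<omega> \<bullet> \<xi>) * f \<omega> \<partial>sphere_measure) = 0" for \<xi>
  proof -
    let ?s = "\<lambda>N \<omega>. (\<Sum>n<N. (\<omega> \<bullet> \<xi>) ^ n /\<^sub>R fact n) * f \<omega>"
    have "(\<lambda>N. \<integral>\<omega>. ?s N \<omega> \<partial>sphere_measure) \<longlonglongrightarrow> (\<integral>\<omega>. exp (\<omega> \<bullet> \<xi>) * f \<omega> \<partial>sphere_measure)"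
    proof (rule integral_dominated_convergence[where w = "\<lambda>\<omega>. exp (norm \<xi>) * norm (f \<omega>)"])
      show "integrable sphere_measure (\<lambda>\<omega>. exp (norm \<xi>) * norm (f \<omega>))"
        using f by (intro integrable_sphere continuous_intros)
      show "AE \<omega> in sphere_measure. (\<lambda>N. ?s N \<omega>) \<longlonglongrightarrow> exp (\<omega> \<bullet> \<xi>) * f \<omega>"
      proof (intro AE_I2 tendsto_mult_right)
        show "(\<lambda>N. \<Sum>n<N. (\<omega> \<bullet> \<xi>) ^ n /\<^sub>R fact n) \<longlonglongrightarrow> exp (\<omega> \<bullet> \<xi>)" for \<omega>
          using exp_converges[of "\<omega> \<bullet> \<xi>"] unfolding sums_def .
      qed
      show "AE \<omega> in sphere_measure. norm (?s N \<omega>) \<le> exp (norm \<xi>) * norm (f \<omega>)" for N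
      proof (intro AE_I2)
        fix \<omega> :: "real^3" assume "\<omega> \<in> space sphere_measure"
        then have *: "\<bar>\<omega> \<bullet> \<xi>\<bar> \<le> norm \<xi>" using Cauchy_Schwarz_ineq2[of \<omega> \<xi>] by simp
        have "norm (\<Sum>n<N. (\<omega> \<bullet> \<xi>) ^ n /\<^sub>R fact n) \<le> (\<Sum>n<N. \<bar>\<omega> \<bullet> \<xi>\<bar> ^ n /\<^sub>R fact n)"
          by (rule sum_norm_le) (simp add: abs_mult power_abs)
        also have "\<dots> \<le> (\<Sum>n. \<bar>\<omega> \<bullet> \<xi>\<bar> ^ n /\<^sub>R fact n)"
          by (rule sum_le_suminf[OF summable_exp_generic]) auto
        also have "\<dots> = exp \<bar>\<omega> \<bullet> \<xi>\<bar>" by (simp add: exp_def)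
        also have "\<dots> \<le> exp (norm \<xi>)" using * by simp
        finally show "norm (?s N \<omega>) \<le> exp (norm \<xi>) * norm (f \<omega>)"
          by (simp add: abs_mult mult_right_mono)
      qed
    qed (auto intro!: borel_measurable_sphere continuous_intros f)
    moreover have "(\<integral>\<omega>. ?s N \<omega> \<partial>sphere_measure) = 0" for N
    proof -
      have "(\<integral>\<omega>. ?s N \<omega> \<partial>sphere_measure) = (\<integral>\<omega>. (\<Sum>n<N. ((\<omega> \<bullet> \<xi>) ^ n * f \<omega>) /\<^sub>R fact n) \<partial>sphere_measure)"
        by (simp add: sum_distrib_right mult.assoc)
      also have "\<dots> = (\<Sum>n<N. \<integral>\<omega>. ((\<omega> \<bullet> \<xi>) ^ n * f \<omega>) /\<^sub>R fact n \<partial>sphere_measure)"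
        by (intro Bochner_Integration.integral_sum integrable_sphere continuous_intros f)
      also have "\<dots> = 0" by (simp add: mom)
      finally show ?thesis .
    qed
    ultimately show ?thesis using LIMSEQ_unique[OF _ tendsto_const] by force
  qed
  have alg0: "(\<integral>\<omega>. g \<omega> * f \<omega> \<partial>sphere_measure) = 0" if "exp_algebra g" for g
    using that
  proof induction
    case (add g h)
    have "(\<integral>\<omega>. (g \<omega> + h \<omega>) * f \<omega> \<partial>sphere_measure) = (\<integral>\<omega>. g \<omega> * f \<omega> + h \<omega> * f \<omega> \<partial>sphere_measure)"
      by (simp add: distrib_right)
    also have "\<dots> = (\<integral>\<omega>. g \<omega> * f \<omega> \<partial>sphere_measure) + (\<integral>\<omega>. h \<omega> * f \<omega> \<partial>sphere_measure)"
      by (intro Bochner_Integration.integral_add integrable_sphere continuous_intros f exp_algebra_continuous add.hyps)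
    finally show ?case using add.IH by simp
  qed (simp_all add: exp0 mult.assoc)
  have ff: "integrable sphere_measure (\<lambda>\<omega>. f \<omega> * f \<omega>)" "integrable sphere_measure (\<lambda>\<omega>. \<bar>f \<omega>\<bar>)"
    by (intro integrable_sphere continuous_intros f)+
  have "(\<integral>\<omega>. f \<omega> * f \<omega> \<partial>sphere_measure) \<le> e * (\<integral>\<omega>. \<bar>f \<omega>\<bar> \<partial>sphere_measure)" if e: "e > 0" for e
  proof -
    have "\<exists>g. exp_algebra g \<and> (\<forall>x\<in>sphere 0 1. \<bar>f x - g x\<bar> < e)"
    proof (rule Stone_Weierstrass_HOL)
      show "\<exists>g. exp_algebra g \<and> g x \<noteq> g y" if "x \<in> sphere 0 1 \<and> y \<in> sphere 0 1 \<and> x \<noteq> y" for x y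
      proof (intro exI conjI)
        have "x \<bullet> (x - y) - y \<bullet> (x - y) = (x - y) \<bullet> (x - y)" by (simp add: inner_diff_left)
        then show "exp (x \<bullet> (x - y)) \<noteq> exp (y \<bullet> (x - y))" using that by (metis eq_iff_diff_eq_0 exp_inj_iff inner_eq_zero_iff)
      qed (rule exp_algebra.exp)
    qed (use e f exp_algebra_mult in \<open>auto intro: exp_algebra_const exp_algebra.add exp_algebra_continuous\<close>)
    then obtain g where g: "exp_algebra g" "\<And>x. x \<in> sphere 0 1 \<Longrightarrow> \<bar>f x - g x\<bar> \<le> e"
      using less_imp_le by metis
    have gf: "integrable sphere_measure (\<lambda>\<omega>. g \<omega> * f \<omega>)"
      by (intro integrable_sphere continuous_intros f exp_algebra_continuous g)
    have "(\<integral>\<omega>. f \<omega> * f \<omega> \<partial>sphere_measure) = (\<integral>\<omega>. (f \<omega> - g \<omega>) * f \<omega> \<partial>sphere_measure)"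
      using ff gf alg0[OF g(1)] by (simp add: left_diff_distrib)
    also have "\<dots> \<le> (\<integral>\<omega>. e * \<bar>f \<omega>\<bar> \<partial>sphere_measure)"
    proof (rule integral_mono)
      show "(f \<omega> - g \<omega>) * f \<omega> \<le> e * \<bar>f \<omega>\<bar>" if "\<omega> \<in> space sphere_measure" for \<omega>
      proof -
        have "(f \<omega> - g \<omega>) * f \<omega> \<le> \<bar>f \<omega> - g \<omega>\<bar> * \<bar>f \<omega>\<bar>" by (metis abs_ge_self abs_mult)
        also have "\<dots> \<le> e * \<bar>f \<omega>\<bar>" using g(2) that by (intro mult_right_mono) auto
        finally show ?thesis .
      qed
    qed (use ff gf in \<open>auto simp: left_diff_distrib\<close>)
    finally show ?thesis by simp
  qed
  note small = this
  have "(\<integral>\<omega>. f \<omega> * f \<omega> \<partial>sphere_measure) \<le> 0"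
  proof (rule field_le_epsilon)
    fix e :: real assume e: "e > 0"
    let ?A = "\<integral>\<omega>. \<bar>f \<omega>\<bar> \<partial>sphere_measure"
    have A: "0 \<le> ?A" by simp
    have "(\<integral>\<omega>. f \<omega> * f \<omega> \<partial>sphere_measure) \<le> e / (?A + 1) * ?A" using small[of "e / (?A + 1)"] e A by simp
    also have "\<dots> \<le> e / (?A + 1) * (?A + 1)" using e A by (intro mult_left_mono) auto
    also have "?A + 1 \<noteq> 0" using A by linarith
    then have "e / (?A + 1) * (?A + 1) = e" by simp
    finally show "(\<integral>\<omega>. f \<omega> * f \<omega> \<partial>sphere_measure) \<le> 0 + e" by simp
  qed
  moreover have "0 \<le> (\<integral>\<omega>. f \<omega> * f \<omega> \<partial>sphere_measure)" by simp
  ultimately have "f \<omega> * f \<omega> = 0"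
    by (intro integral_sphere_eq_0D[OF _ _ _ \<omega>, of "\<lambda>\<omega>. f \<omega> * f \<omega>"] continuous_intros f) auto
  then show ?thesis by simp
qed

lemma zero_if_moments_zero:
  fixes f :: "real^3 \<Rightarrow> complex"
  assumes f: "continuous_on (sphere 0 1) f"
    and mom: "\<And>\<xi> n. (\<integral>\<omega>. (\<omega> \<bullet> \<xi>) ^ n *\<^sub>R f \<omega> \<partial>sphere_measure) = 0"
    and \<omega>: "\<omega> \<in> sphere 0 1"
  shows "f \<omega> = 0"
proof -
  have int: "integrable sphere_measure (\<lambda>\<omega>. (\<omega> \<bullet> \<xi>) ^ n *\<^sub>R f \<omega>)" for \<xi> n
    by (intro integrable_sphere continuous_intros f)
  have "Re (f \<omega>) = 0"
  proof (rule zero_if_moments_zero_real[OF _ _ \<omega>])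
    show "(\<integral>\<omega>. (\<omega> \<bullet> \<xi>) ^ n * Re (f \<omega>) \<partial>sphere_measure) = 0" for \<xi> n
      using integral_Re[OF int[of \<xi> n]] mom[of \<xi> n] by simp
  qed (intro continuous_intros f)
  moreover have "Im (f \<omega>) = 0"
  proof (rule zero_if_moments_zero_real[OF _ _ \<omega>])
    show "(\<integral>\<omega>. (\<omega> \<bullet> \<xi>) ^ n * Im (f \<omega>) \<partial>sphere_measure) = 0" for \<xi> n
      using integral_Im[OF int[of \<xi> n]] mom[of \<xi> n] by simp
  qed (intro continuous_intros f)
  ultimately show ?thesis by (simp add: complex_eq_iff)
qed

text \<open>No dominating function is available, but the bound in L^2 gives uniform integrability:
  |F| is at most min |F| K + |F|^2 / K. The truncated part tends to zero by dominated convergence,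
  and the remainder contributes at most C / K.\<close>

lemma sphere_integral_tendsto_0:
  fixes F :: "real \<Rightarrow> real^3 \<Rightarrow> 'b::{second_countable_topology, banach}"
  assumes F: "\<And>s. continuous_on (sphere 0 1) (F s)"
    and lim: "\<And>\<omega>. \<omega> \<in> sphere 0 1 \<Longrightarrow> ((\<lambda>s. F s \<omega>) \<longlongrightarrow> 0) at_top"
    and bd: "\<forall>\<^sub>F s in at_top. (\<integral>\<omega>. (norm (F s \<omega>))\<^sup>2 \<partial>sphere_measure) \<le> C"
  shows "((\<lambda>s. \<integral>\<omega>. F s \<omega> \<partial>sphere_measure) \<longlongrightarrow> 0) at_top"
proof (rule tendstoI)
  fix e :: real assume e: "e > 0"
  \<comment> \<open>Large enough for C / K < e / 2; the summand 1 makes \<open>K\<close> positive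
    and the inequality strict.\<close>
  define K where "K = 2 * \<bar>C\<bar> / e + 1"
  have K: "0 < K" "C / K < e / 2"
  proof -
    show "0 < K" using e by (simp add: K_def add_nonneg_pos)
    then show "C / K < e / 2" using e by (auto simp: K_def field_simps abs_if)
  qed
  have "((\<lambda>s. \<integral>\<omega>. min (norm (F s \<omega>)) K \<partial>sphere_measure) \<longlongrightarrow> (\<integral>\<omega>. (0::real) \<partial>sphere_measure)) at_top"
  proof (rule integral_dominated_convergence_at_top[where w = "\<lambda>_. K"])
    show "AE \<omega> in sphere_measure. ((\<lambda>s. min (norm (F s \<omega>)) K) \<longlongrightarrow> 0) at_top"
    proof (rule AE_I2)
      fix \<omega> :: "real^3" assume "\<omega> \<in> space sphere_measure"
      then have "((\<lambda>s. min (norm (F s \<omega>)) K) \<longlongrightarrow> min (norm (0::'b)) K) at_top"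
        by (intro tendsto_intros lim) simp
      then show "((\<lambda>s. min (norm (F s \<omega>)) K) \<longlongrightarrow> 0) at_top" using K by simp
    qed
  qed (use K in \<open>auto intro!: borel_measurable_sphere continuous_intros F\<close>)
  then have "\<forall>\<^sub>F s in at_top. (\<integral>\<omega>. min (norm (F s \<omega>)) K \<partial>sphere_measure) < e / 2"
    by (rule order_tendstoD(2)) (use e in simp)
  then show "\<forall>\<^sub>F s in at_top. dist (\<integral>\<omega>. F s \<omega> \<partial>sphere_measure) 0 < e"
    using bd
  proof eventually_elim
    case (elim s)
    have i1: "integrable sphere_measure (\<lambda>\<omega>. min (norm (F s \<omega>)) K)" "integrable sphere_measure (\<lambda>\<omega>. (norm (F s \<omega>))\<^sup>2)"
      by (intro integrable_sphere continuous_intros F)+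
    have "norm (\<integral>\<omega>. F s \<omega> \<partial>sphere_measure) \<le> (\<integral>\<omega>. min (norm (F s \<omega>)) K + (norm (F s \<omega>))\<^sup>2 / K \<partial>sphere_measure)"
    proof (rule Bochner_Integration.integral_norm_bound_integral)
      show "norm (F s \<omega>) \<le> min (norm (F s \<omega>)) K + (norm (F s \<omega>))\<^sup>2 / K" for \<omega>
      proof (cases "norm (F s \<omega>) \<le> K")
        case False
        then have "K * norm (F s \<omega>) \<le> norm (F s \<omega>) * norm (F s \<omega>)" by (intro mult_right_mono) auto
        then have "norm (F s \<omega>) \<le> (norm (F s \<omega>))\<^sup>2 / K" using K by (simp add: field_simps power2_eq_square)
        then show ?thesis using K False by simp
      qed (use K in auto)
    qed (use i1 integrable_sphere[OF F] in auto)
    also have "\<dots> = (\<integral>\<omega>. min (norm (F s \<omega>)) K \<partial>sphere_measure) + (\<integral>\<omega>. (norm (F s \<omega>))\<^sup>2 \<partial>sphere_measure) / K"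
      using i1 by simp
    also have "\<dots> < e / 2 + e / 2"
    proof (rule add_strict_mono)
      have "(\<integral>\<omega>. (norm (F s \<omega>))\<^sup>2 \<partial>sphere_measure) / K \<le> C / K"
        using elim(2) K by (intro divide_right_mono) auto
      then show "(\<integral>\<omega>. (norm (F s \<omega>))\<^sup>2 \<partial>sphere_measure) / K < e / 2" using K by linarith
    qed (fact elim(1))
    finally show ?case by simp
  qed
qed

subsection \<open>Partial derivatives of smooth functions\<close>

text \<open>The direction comes first so that derivatives nest as operators, as in
  \<open>pd v (pd w F)\<close>.\<close>

definition pd :: "'a::euclidean_space \<Rightarrow> ('a \<Rightarrow> 'b::real_normed_vector) \<Rightarrow> 'a \<Rightarrow> 'b" where
  "pd v F p = frechet_derivative F (at p) v"

lemma smooth_on_pd: "smooth_on F S \<Longrightarrow> smooth_on (pd v F) S"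
  unfolding smooth_on_def pd_def[abs_def]
proof
  fix k assume "\<forall>k. Ck_on k F S"
  then have "Ck_on (Suc k) F S" by blast
  then show "Ck_on k (\<lambda>p. frechet_derivative F (at p) v) S" by simp
qed

lemma smooth_on_has_derivative:
  assumes "smooth_on F S" "p \<in> S"
  shows "(F has_derivative (\<lambda>v. pd v F p)) (at p)"
proof -
  have "Ck_on (Suc 0) F S" using assms(1) unfolding smooth_on_def by blast
  then have "F differentiable (at p)" using assms(2) by simp
  then show ?thesis unfolding pd_def using frechet_derivative_works by blast
qed

lemma smooth_on_continuous: "smooth_on F S \<Longrightarrow> continuous_on S F"
  unfolding smooth_on_def by (metis Ck_on.simps(1))

lemma linear_pd: "smooth_on F S \<Longrightarrow> p \<in> S \<Longrightarrow> linear (\<lambda>v. pd v F p)"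
  by (rule has_derivative_linear[OF smooth_on_has_derivative])

lemma pd_cong:
  assumes "open S" "p \<in> S" "\<And>q. q \<in> S \<Longrightarrow> F q = G q"
  shows "pd v F p = pd v G p"
proof -
  have "(F has_derivative F') (at p) = (G has_derivative F') (at p)" for F'
    using has_derivative_transform_within_open[OF _ assms(1,2), of F F' UNIV G]
      has_derivative_transform_within_open[OF _ assms(1,2), of G F' UNIV F] assms(3) by auto
  then show ?thesis by (simp add: pd_def frechet_derivative_def)
qed

lemma has_vector_derivative_pd:
  assumes "smooth_on F S" "p + s *\<^sub>R v \<in> S"
  shows "((\<lambda>s. F (p + s *\<^sub>R v)) has_vector_derivative pd v F (p + s *\<^sub>R v)) (at s within T)"
proof -
  have "((\<lambda>s. p + s *\<^sub>R v) has_derivative (\<lambda>h. h *\<^sub>R v)) (at s within T)"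
    by (auto intro!: derivative_eq_intros)
  from has_derivative_compose[OF this smooth_on_has_derivative[OF assms]]
  show ?thesis
    unfolding has_vector_derivative_def
    using linear_cmul[OF linear_pd[OF assms]] by simp
qed

section \<open>Symmetry of second derivatives\<close>

lemma norm_increment_le:
  fixes f :: "real \<Rightarrow> 'b::real_normed_vector"
  assumes s: "0 < s" and f: "\<And>r. 0 \<le> r \<Longrightarrow> r \<le> s \<Longrightarrow> (f has_vector_derivative f' r) (at r)"
    and le: "\<And>r. 0 \<le> r \<Longrightarrow> r \<le> s \<Longrightarrow> norm (f' r) \<le> c"
  shows "norm (f s - f 0) \<le> c * s"
proof -
  have "norm (f s - f 0) \<le> (\<lambda>r. c * r) s - (\<lambda>r. c * r) 0"
  proof (rule differentiable_bound_general[OF s, where f = f and f' = f' and \<phi> = "\<lambda>r. c * r" and \<phi>' = "\<lambda>_. c"])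
    show "continuous_on {0..s} f"
      by (rule continuous_on_vector_derivative, rule has_vector_derivative_at_within, rule f) auto
    show "((*) c has_vector_derivative c) (at r)" for r
      unfolding has_real_derivative_iff_has_vector_derivative[symmetric]
      by (auto intro!: derivative_eq_intros)
  qed (use f le in \<open>auto intro!: continuous_intros\<close>)
  then show ?thesis by simp
qed

text \<open>The mean value inequality is applied twice after subtracting the linear model with slope
  \<open>B\<close>: in direction \<open>v\<close> to \<open>pd w F\<close>, then in direction
  \<open>w\<close> to the first difference of \<open>F\<close>.\<close>

lemma second_difference_bound:
  assumes F: "smooth_on F S" and S: "ball p d \<subseteq> S" and s: "0 < s" "s * (norm v + norm w) < d"
    and B: "\<And>q. q \<in> ball p d \<Longrightarrow> norm (pd v (pd w F) q - B) \<le> e"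
  shows "norm (F (p + s *\<^sub>R v + s *\<^sub>R w) - F (p + s *\<^sub>R v) - F (p + s *\<^sub>R w) + F p - (s * s) *\<^sub>R B) \<le> e * (s * s)"
proof -
  have inb: "p + \<tau> *\<^sub>R v + \<sigma> *\<^sub>R w \<in> ball p d" if "0 \<le> \<sigma>" "\<sigma> \<le> s" "0 \<le> \<tau>" "\<tau> \<le> s" for \<sigma> \<tau>
  proof -
    have "norm (\<tau> *\<^sub>R v + \<sigma> *\<^sub>R w) \<le> \<tau> * norm v + \<sigma> * norm w"
      using that by (intro norm_triangle_le) auto
    also have "\<dots> \<le> s * norm v + s * norm w" using that by (intro add_mono mult_right_mono) auto
    also have "\<dots> < d" using s(2) by (simp add: distrib_left)
    finally show ?thesis by (simp add: dist_norm norm_minus_commute algebra_simps)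
  qed
  then have inS: "p + \<tau> *\<^sub>R v + \<sigma> *\<^sub>R w \<in> S" if "0 \<le> \<sigma>" "\<sigma> \<le> s" "0 \<le> \<tau>" "\<tau> \<le> s" for \<sigma> \<tau>
    using S that by blast
  let ?g = "\<lambda>\<sigma> \<tau>. pd w F (p + \<sigma> *\<^sub>R w + \<tau> *\<^sub>R v) - \<tau> *\<^sub>R B"
  have g: "norm (?g \<sigma> s - ?g \<sigma> 0) \<le> e * s" if \<sigma>: "0 \<le> \<sigma>" "\<sigma> \<le> s" for \<sigma>
  proof (rule norm_increment_le[OF s(1)])
    fix \<tau> assume \<tau>: "0 \<le> \<tau>" "\<tau> \<le> s"
    have *: "p + \<sigma> *\<^sub>R w + \<tau> *\<^sub>R v = p + \<tau> *\<^sub>R v + \<sigma> *\<^sub>R w" by (simp add: algebra_simps)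
    show "(?g \<sigma> has_vector_derivative pd v (pd w F) (p + \<sigma> *\<^sub>R w + \<tau> *\<^sub>R v) - B) (at \<tau>)"
      using inS[OF \<sigma> \<tau>] unfolding *[symmetric]
      by (intro has_vector_derivative_diff has_vector_derivative_pd[OF smooth_on_pd[OF F]])
        (auto simp: has_vector_derivative_def intro!: derivative_eq_intros)
    show "norm (pd v (pd w F) (p + \<sigma> *\<^sub>R w + \<tau> *\<^sub>R v) - B) \<le> e"
      unfolding * by (rule B[OF inb[OF \<sigma> \<tau>]])
  qed
  let ?k = "\<lambda>\<sigma>. F (p + s *\<^sub>R v + \<sigma> *\<^sub>R w) - F (p + \<sigma> *\<^sub>R w) - \<sigma> *\<^sub>R (s *\<^sub>R B)"
  have "norm (?k s - ?k 0) \<le> (e * s) * s"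
  proof (rule norm_increment_le[OF s(1)])
    fix \<sigma> assume \<sigma>: "0 \<le> \<sigma>" "\<sigma> \<le> s"
    show "(?k has_vector_derivative pd w F (p + s *\<^sub>R v + \<sigma> *\<^sub>R w) - pd w F (p + \<sigma> *\<^sub>R w) - s *\<^sub>R B) (at \<sigma>)"
      using inS[OF \<sigma>, of s] inS[OF \<sigma>, of 0] s(1)
      by (intro has_vector_derivative_diff has_vector_derivative_pd[OF F])
        (auto simp: has_vector_derivative_def intro!: derivative_eq_intros)
    show "norm (pd w F (p + s *\<^sub>R v + \<sigma> *\<^sub>R w) - pd w F (p + \<sigma> *\<^sub>R w) - s *\<^sub>R B) \<le> e * s"
      using g[OF \<sigma>] by (simp add: algebra_simps)
  qed
  then show ?thesis by (simp add: algebra_simps)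
qed

text \<open>The second difference \<open>\<Delta>\<close> is symmetric in \<open>v\<close> and
  \<open>w\<close>, and each mixed derivative times s^2 approximates it up to e / 2 times
  s^2.\<close>

lemma pd_commute:
  assumes F: "smooth_on F S" and S: "open S" "p \<in> S"
  shows "pd v (pd w F) p = pd w (pd v F) p"
proof -
  have "norm (pd v (pd w F) p - pd w (pd v F) p) \<le> 0 + e" if e: "e > 0" for e
  proof -
    obtain d0 where d0: "d0 > 0" "ball p d0 \<subseteq> S" using S open_contains_ball by blast
    have "\<exists>d>0. \<forall>q\<in>ball p d. norm (pd v (pd w F) q - pd v (pd w F) p) \<le> e / 2" for v w
    proof -
      have "isCont (pd v (pd w F)) p"
        using smooth_on_continuous[OF smooth_on_pd[OF smooth_on_pd[OF F]]] S
        by (simp add: continuous_on_eq_continuous_at)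
      then obtain d where "d > 0" "\<forall>q. dist q p < d \<longrightarrow> dist (pd v (pd w F) q) (pd v (pd w F) p) < e / 2"
        using e unfolding continuous_at_eps_delta by (metis half_gt_zero)
      then show ?thesis by (intro exI[of _ d]) (auto simp: dist_norm norm_minus_commute less_imp_le)
    qed
    then obtain d where d: "\<And>v w. d v w > 0"
        "\<And>v w q. q \<in> ball p (d v w) \<Longrightarrow> norm (pd v (pd w F) q - pd v (pd w F) p) \<le> e / 2"
      by metis
    define r where "r = min d0 (min (d v w) (d w v))"
    have r: "r > 0" "ball p r \<subseteq> S" "r \<le> d v w" "r \<le> d w v" using d0 d(1) by (auto simp: r_def)
    \<comment> \<open>The summand 1 keeps \<open>N\<close> positive when both directions vanish; the
      factor 2 in \<open>s\<close> keeps the parallelogram strictly inside the ball.\<close>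
    define N where "N = norm v + norm w + 1"
    define s where "s = r / (2 * N)"
    have nn: "0 < N" by (simp add: N_def add_nonneg_pos)
    have s: "0 < s" unfolding s_def using r(1) nn by (intro divide_pos_pos) auto
    have "s * (norm v + norm w) \<le> s * N" using s by (simp add: N_def)
    also have "\<dots> < r" using nn r(1) by (simp add: s_def)
    finally have sv: "s * (norm v + norm w) < r" "s * (norm w + norm v) < r" by (simp_all add: add.commute)
    define \<Delta> where "\<Delta> = F (p + s *\<^sub>R v + s *\<^sub>R w) - F (p + s *\<^sub>R v) - F (p + s *\<^sub>R w) + F p"
    have "norm (\<Delta> - (s * s) *\<^sub>R pd v (pd w F) p) \<le> e / 2 * (s * s)"
      unfolding \<Delta>_def by (rule second_difference_bound[OF F r(2) s sv(1)]) (use d(2)[of _ v w] r(3) in auto)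
    moreover have "norm (\<Delta> - (s * s) *\<^sub>R pd w (pd v F) p) \<le> e / 2 * (s * s)"
    proof -
      have "\<Delta> = F (p + s *\<^sub>R w + s *\<^sub>R v) - F (p + s *\<^sub>R w) - F (p + s *\<^sub>R v) + F p"
        by (simp add: \<Delta>_def algebra_simps)
      then show ?thesis
        by (simp only:) (rule second_difference_bound[OF F r(2) s sv(2)], use d(2)[of _ w v] r(4) in auto)
    qed
    ultimately have "norm ((\<Delta> - (s * s) *\<^sub>R pd w (pd v F) p) - (\<Delta> - (s * s) *\<^sub>R pd v (pd w F) p)) \<le> e / 2 * (s * s) + e / 2 * (s * s)"
      by (intro norm_triangle_le_diff) auto
    also have "(\<Delta> - (s * s) *\<^sub>R pd w (pd v F) p) - (\<Delta> - (s * s) *\<^sub>R pd v (pd w F) p)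
        = (s * s) *\<^sub>R (pd v (pd w F) p - pd w (pd v F) p)"
      by (simp add: algebra_simps)
    finally have "(s * s) * norm (pd v (pd w F) p - pd w (pd v F) p) \<le> (s * s) * e"
      using s by (simp add: mult_ac)
    then show ?thesis using s by simp
  qed
  then have "norm (pd v (pd w F) p - pd w (pd v F) p) \<le> 0" by (rule field_le_epsilon)
  then show ?thesis by simp
qed

text \<open>Here \<open>w\<close> sits under a further derivative; commuting brings it to the
  outside, where linearity is that of the Frechet derivative.\<close>

lemma linear_pd_inner:
  assumes "smooth_on F S" "open S" "p \<in> S"
  shows "linear (\<lambda>w. pd v (pd w F) p)"
  using linear_pd[OF smooth_on_pd[OF assms(1)] assms(3), of v] pd_commute[OF assms] by simp

subsection \<open>Calculus on the exterior region\<close>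

text \<open>Letting the last variable range over all nonzero vectors makes the region open, so that
  ordinary Frechet derivatives apply.\<close>

definition exterior :: "real \<Rightarrow> (real \<times> real \<times> (real^3)) set" where
  "exterior M = UNIV \<times> {2 * M<..} \<times> (- {0})"

lemma open_exterior: "open (exterior M)"
  unfolding exterior_def by (intro open_Times open_UNIV open_greaterThan open_Compl) simp

lemma mem_exterior [simp]: "(t, r, y) \<in> exterior M \<longleftrightarrow> 2 * M < r \<and> y \<noteq> 0"
  by (auto simp: exterior_def)

abbreviation Dt :: "(real \<times> real \<times> (real^3) \<Rightarrow> complex) \<Rightarrow> real \<times> real \<times> (real^3) \<Rightarrow> complex" where
  "Dt \<equiv> pd (1, 0, 0)"
abbreviation Dr :: "(real \<times> real \<times> (real^3) \<Rightarrow> complex) \<Rightarrow> real \<times> real \<times> (real^3) \<Rightarrow> complex" where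
  "Dr \<equiv> pd (0, 1, 0)"
abbreviation Dx :: "real^3 \<Rightarrow> (real \<times> real \<times> (real^3) \<Rightarrow> complex) \<Rightarrow> real \<times> real \<times> (real^3) \<Rightarrow> complex" where
  "Dx v \<equiv> pd (0, 0, v)"

lemma has_vector_derivative_Dt:
  assumes "smooth_on F (exterior M)" "2 * M < r" "y \<noteq> 0"
  shows "((\<lambda>s. F (s, r, y)) has_vector_derivative Dt F (t, r, y)) (at t within T)"
  using has_vector_derivative_pd[OF assms(1), of "(0, r, y)" t "(1, 0, 0)"] assms by simp

lemma has_vector_derivative_Dr:
  assumes "smooth_on F (exterior M)" "2 * M < r" "y \<noteq> 0"
  shows "((\<lambda>s. F (t, s, y)) has_vector_derivative Dr F (t, r, y)) (at r within T)"
  using has_vector_derivative_pd[OF assms(1), of "(t, 0, y)" r "(0, 1, 0)"] assms by simp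

lemma has_vector_derivative_Dx:
  assumes "smooth_on F (exterior M)" "2 * M < r" "y + s *\<^sub>R v \<noteq> 0"
  shows "((\<lambda>s. F (t, r, y + s *\<^sub>R v)) has_vector_derivative Dx v F (t, r, y + s *\<^sub>R v)) (at s within T)"
  using has_vector_derivative_pd[OF assms(1), of "(t, r, y)" s "(0, 0, v)"] assms by simp

lemma has_derivative_Dx:
  assumes "smooth_on F (exterior M)" "2 * M < r" "y \<noteq> 0"
  shows "((\<lambda>y. F (t, r, y)) has_derivative (\<lambda>v. Dx v F (t, r, y))) (at y)"
proof -
  have "((\<lambda>y. (t, r, y)) has_derivative (\<lambda>v. (0, 0, v))) (at y)"
    by (auto intro!: derivative_eq_intros)
  from has_derivative_compose[OF this smooth_on_has_derivative[OF assms(1)]] assms show ?thesis by simp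
qed

lemma has_derivative_DtDr:
  assumes "smooth_on F (exterior M)" "2 * M < r" "y \<noteq> 0"
  shows "((\<lambda>(t, r). F (t, r, y)) has_derivative (\<lambda>(a, b). a *\<^sub>R Dt F (t, r, y) + b *\<^sub>R Dr F (t, r, y))) (at (t, r))"
proof -
  have "((\<lambda>q. (fst q, snd q, y)) has_derivative (\<lambda>h. (fst h, snd h, 0))) (at (t, r))"
    by (auto intro!: derivative_eq_intros)
  moreover have "(F has_derivative (\<lambda>v. pd v F (t, r, y))) (at (fst (t, r), snd (t, r), y))"
    using smooth_on_has_derivative[OF assms(1), of "(t, r, y)"] assms by simp
  ultimately have D: "((\<lambda>q. F (fst q, snd q, y)) has_derivative (\<lambda>h. pd (fst h, snd h, 0) F (t, r, y))) (at (t, r))"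
    by (rule has_derivative_compose)
  have lin2: "pd (a, b, 0) F (t, r, y) = a *\<^sub>R Dt F (t, r, y) + b *\<^sub>R Dr F (t, r, y)" for a b
  proof -
    have lin: "linear (\<lambda>v. pd v F (t, r, y))" using assms by (intro linear_pd[OF assms(1)]) simp
    have "pd (a, b, 0) F (t, r, y) = pd (a *\<^sub>R (1, 0, 0) + b *\<^sub>R (0, 1, 0)) F (t, r, y)"
      by (simp only: scaleR_Pair add_Pair) simp
    also have "\<dots> = pd (a *\<^sub>R (1, 0, 0)) F (t, r, y) + pd (b *\<^sub>R (0, 1, 0)) F (t, r, y)"
      by (rule linear_add[OF lin])
    also have "\<dots> = a *\<^sub>R Dt F (t, r, y) + b *\<^sub>R Dr F (t, r, y)"
      by (rule arg_cong2[where f = "(+)"]; rule linear_cmul[OF lin])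
    finally show ?thesis .
  qed
  have "(\<lambda>h. pd (fst h, snd h, 0) F (t, r, y)) = (\<lambda>h. fst h *\<^sub>R Dt F (t, r, y) + snd h *\<^sub>R Dr F (t, r, y))"
    by (rule ext, rule lin2)
  with D show ?thesis by (simp only: case_prod_unfold)
qed

lemma
  assumes F: "smooth_on F (exterior M)" and p: "p \<in> exterior M"
  shows linear_Dx: "linear (\<lambda>w. Dx w F p)" and linear_pd_Dx: "linear (\<lambda>w. pd v (Dx w F) p)"
proof -
  have emb: "linear (\<lambda>w. (0::real, 0::real, w::real^3))" by (auto intro!: linearI)
  show "linear (\<lambda>w. Dx w F p)" "linear (\<lambda>w. pd v (Dx w F) p)"
    using linear_compose[OF emb linear_pd[OF F p]] linear_compose[OF emb linear_pd_inner[OF F open_exterior p]]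
    by (simp_all add: o_def)
qed

lemma continuous_on_slice:
  fixes F :: "real \<times> real \<times> (real^3) \<Rightarrow> complex"
  assumes "smooth_on F (exterior M)" "2 * M < r"
  shows "continuous_on (- {0}) (\<lambda>y. F (t, r, y))"
  by (rule continuous_on_compose2[OF smooth_on_continuous[OF assms(1)]]) (use assms(2) in \<open>auto intro!: continuous_intros\<close>)

lemma continuous_on_slice_Dx:
  fixes F :: "real \<times> real \<times> (real^3) \<Rightarrow> complex"
  assumes F: "smooth_on F (exterior M)" and r: "2 * M < r" and w: "continuous_on (- {0}) w"
  shows "continuous_on (- {0}) (\<lambda>y. Dx (w y) F (t, r, y))"
    and "continuous_on (- {0}) (\<lambda>y. Dx v (Dx (w y) F) (t, r, y))"
    and "continuous_on (- {0}) (\<lambda>y. Dx (w y) (Dx (w y) F) (t, r, y))"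
proof -
  show "continuous_on (- {0}) (\<lambda>y. Dx (w y) F (t, r, y))"
    by (rule continuous_on_linear_family[where f' = "\<lambda>y w. Dx w F (t, r, y)"])
      (use r in \<open>auto intro!: continuous_on_slice smooth_on_pd F w linear_Dx\<close>)
  have *: "continuous_on (- {0}) (\<lambda>y. Dx v (Dx (w y) F) (t, r, y))" for v
    by (rule continuous_on_linear_family[where f' = "\<lambda>y w. Dx v (Dx w F) (t, r, y)"])
      (use r in \<open>auto intro!: continuous_on_slice smooth_on_pd F w linear_pd_Dx\<close>)
  then show "continuous_on (- {0}) (\<lambda>y. Dx v (Dx (w y) F) (t, r, y))" .
  show "continuous_on (- {0}) (\<lambda>y. Dx (w y) (Dx (w y) F) (t, r, y))"
    by (rule continuous_on_linear_family[where f' = "\<lambda>y v. Dx v (Dx (w y) F) (t, r, y)"])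
      (use r in \<open>auto intro!: * linear_Dx smooth_on_pd F w\<close>)
qed

section \<open>Derivatives along rotation fields\<close>

lemma continuous_on_cross_right:
  "continuous_on S (cross3 a)" "continuous_on S (\<lambda>\<omega>. cross3 a (cross3 a \<omega>))"
  by (intro continuous_on_cross continuous_intros)+

text \<open>The direction of differentiation varies with the point, which adds a first-order term.
  The expansion in \<open>Basis\<close> separates the two dependences, so that the product rule
  applies.\<close>

lemma has_derivative_angular:
  assumes F: "smooth_on F (exterior M)" and r: "2 * M < r" "y \<noteq> 0"
  shows "((\<lambda>y. Dx (cross3 a y) F (t, r, y)) has_derivative
    (\<lambda>v. Dx (cross3 a v) F (t, r, y) + Dx v (Dx (cross3 a y) F) (t, r, y))) (at y)"
proof -
  have ext: "(t, r, y) \<in> exterior M" using r by simp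
  have exp: "Dx w F (t, r, z) = (\<Sum>b\<in>Basis. (w \<bullet> b) *\<^sub>R Dx b F (t, r, z))" if "z \<noteq> 0" for w z
    by (rule linear_expand[OF linear_Dx[OF F]]) (use that r in simp)
  have "((\<lambda>y. \<Sum>b\<in>Basis. (cross3 a y \<bullet> b) *\<^sub>R Dx b F (t, r, y)) has_derivative
      (\<lambda>v. \<Sum>b\<in>Basis. (cross3 a y \<bullet> b) *\<^sub>R Dx v (Dx b F) (t, r, y) + (cross3 a v \<bullet> b) *\<^sub>R Dx b F (t, r, y))) (at y)"
  proof (intro has_derivative_sum has_derivative_scaleR has_derivative_Dx[OF smooth_on_pd[OF F] r])
    fix b
    have "bounded_linear (\<lambda>y. cross3 a y \<bullet> b)"
      by (intro linear_conv_bounded_linear[THEN iffD1] linearI) (simp_all add: cross_add_right cross_mult_right inner_add_left)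
    then show "((\<lambda>y. cross3 a y \<bullet> b) has_derivative (\<lambda>v. cross3 a v \<bullet> b)) (at y)"
      by (rule bounded_linear_imp_has_derivative)
  qed
  moreover have "(\<Sum>b\<in>Basis. (cross3 a y \<bullet> b) *\<^sub>R Dx v (Dx b F) (t, r, y) + (cross3 a v \<bullet> b) *\<^sub>R Dx b F (t, r, y))
      = Dx (cross3 a v) F (t, r, y) + Dx v (Dx (cross3 a y) F) (t, r, y)" for v
  proof -
    from linear_expand[OF linear_pd_Dx[OF F ext, of "(0, 0, v)"], of "cross3 a y"] exp[OF r(2), of "cross3 a v"] show ?thesis
      by (simp add: sum.distrib)
  qed
  ultimately have "((\<lambda>y. \<Sum>b\<in>Basis. (cross3 a y \<bullet> b) *\<^sub>R Dx b F (t, r, y)) has_derivative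
      (\<lambda>v. Dx (cross3 a v) F (t, r, y) + Dx v (Dx (cross3 a y) F) (t, r, y))) (at y)" by simp
  then show ?thesis
    by (rule has_derivative_transform_within_open[where s = "- {0}"]) (use r exp in auto)
qed

lemma sum_Basis_3: "(\<Sum>b\<in>Basis. f (b :: real^3)) = f (axis 1 1) + f (axis 2 1) + f (axis 3 1)"
proof -
  have "Basis = range (\<lambda>i::3. axis i (1::real))" by (auto simp: Basis_vec_def)
  moreover have inj: "inj (\<lambda>i::3. axis i (1::real))" by (auto simp: inj_on_def axis_eq_axis)
  ultimately show ?thesis
    using sum.reindex[OF inj, of f] by (simp add: sum_3 o_def)
qed

text \<open>Each summand is (a . y) a - y, and these add up to y - 3 y.\<close>

lemma sum_cross_cross: "(\<Sum>a\<in>Basis. cross3 a (cross3 a y)) = - 2 *\<^sub>R y"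
  by (simp add: sum_Basis_3 cross3_def vec_eq_iff forall_3 vector_def axis_def)

text \<open>The tensor squares of the three vectors a x y add up to |y|^2 times the identity minus
  the tensor square of y. For a Hessian \<open>B\<close> this splits the Laplacian into an angular
  and a radial part.\<close>

lemma sum_bilinear_cross:
  assumes "bilinear B"
  shows "(\<Sum>a\<in>Basis. B (cross3 a y) (cross3 a y)) + B y y = (y \<bullet> y) *\<^sub>R (\<Sum>b\<in>Basis. B b b)"
proof -
  let ?e = "\<lambda>i::3. axis i (1::real)"
  have y: "y = y $ 1 *\<^sub>R ?e 1 + y $ 2 *\<^sub>R ?e 2 + y $ 3 *\<^sub>R ?e 3"
    by (simp add: vec_eq_iff forall_3 axis_def)
  have c: "cross3 (?e 1) y = y $ 2 *\<^sub>R ?e 3 - y $ 3 *\<^sub>R ?e 2"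
    "cross3 (?e 2) y = y $ 3 *\<^sub>R ?e 1 - y $ 1 *\<^sub>R ?e 3"
    "cross3 (?e 3) y = y $ 1 *\<^sub>R ?e 2 - y $ 2 *\<^sub>R ?e 1"
    by (simp_all add: cross3_def vec_eq_iff forall_3 vector_def axis_def)
  have yy: "y \<bullet> y = y $ 1 * y $ 1 + y $ 2 * y $ 2 + y $ 3 * y $ 3"
    by (simp add: inner_vec_def sum_3)
  have yyB: "B y y = B (y $ 1 *\<^sub>R ?e 1 + y $ 2 *\<^sub>R ?e 2 + y $ 3 *\<^sub>R ?e 3) (y $ 1 *\<^sub>R ?e 1 + y $ 2 *\<^sub>R ?e 2 + y $ 3 *\<^sub>R ?e 3)"
    using y by simp
  show ?thesis
    unfolding sum_Basis_3 c yy yyB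
    by (simp add: bilinear_ladd[OF assms] bilinear_radd[OF assms] bilinear_lsub[OF assms] bilinear_rsub[OF assms]
        bilinear_lmul[OF assms] bilinear_rmul[OF assms] algebra_simps)
qed

text \<open>
  The vector field \<open>y \<mapsto> a \<times> y\<close> generates the rotations about \<open>a\<close>; its second power acts on \<open>F\<close> as
  \<open>D\<^sup>2F(a \<times> y, a \<times> y) + DF(a \<times> (a \<times> y))\<close>, and these operators are antisymmetric on the sphere.
\<close>

lemma spherical_laplacian_angular:
  assumes F: "smooth_on F (exterior M)" and r: "2 * M < r" and y: "y \<in> sphere 0 1"
    and hom: "\<And>c. 0 < c \<Longrightarrow> F (t, r, c *\<^sub>R y) = F (t, r, y)"
  shows "(\<Sum>b\<in>Basis. Dx b (Dx b F) (t, r, y)) =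
    (\<Sum>a\<in>Basis. Dx (cross3 a y) (Dx (cross3 a y) F) (t, r, y) + Dx (cross3 a (cross3 a y)) F (t, r, y))"
proof -
  have y0: "y \<noteq> 0" and yy: "y \<bullet> y = 1" using y by (auto simp: norm_eq_1)
  have ext: "(t, r, y) \<in> exterior M" using r y0 by simp
  have ray: "y + s *\<^sub>R y = (1 + s) *\<^sub>R y" for s by (simp add: algebra_simps)
  \<comment> \<open>By homogeneity \<open>F\<close> is constant along the ray, as long as the factor
    1 + s is positive. The claim for all such \<open>s\<close> allows a second
    differentiation.\<close>
  have Dy: "Dx y F (t, r, y + s *\<^sub>R y) = 0" if s: "-1 < s" for s
  proof (rule derivative_zero_if_locally_zero)
    have "y + s *\<^sub>R y \<noteq> 0" using s y0 by (simp add: ray)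
    from has_vector_derivative_diff[OF has_vector_derivative_Dx[OF F r this] has_vector_derivative_const[of "F (t, r, y)"]]
    show "((\<lambda>s. F (t, r, y + s *\<^sub>R y) - F (t, r, y)) has_vector_derivative Dx y F (t, r, y + s *\<^sub>R y)) (at s)" by simp
    have "\<forall>\<^sub>F s in nhds s. s \<in> {-1<..}" using s by (intro eventually_nhds_in_open) auto
    then show "\<forall>\<^sub>F s in nhds s. F (t, r, y + s *\<^sub>R y) - F (t, r, y) = 0"
      by eventually_elim (simp add: ray hom)
  qed
  have Dyy: "Dx y (Dx y F) (t, r, y) = 0"
  proof (rule derivative_zero_if_locally_zero)
    show "((\<lambda>s. Dx y F (t, r, y + s *\<^sub>R y)) has_vector_derivative Dx y (Dx y F) (t, r, y)) (at 0)"
      using has_vector_derivative_Dx[OF smooth_on_pd[OF F] r, of y 0 y] y0 by simp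
    have "\<forall>\<^sub>F s in nhds (0::real). s \<in> {-1<..}" by (intro eventually_nhds_in_open) auto
    then show "\<forall>\<^sub>F s in nhds 0. Dx y F (t, r, y + s *\<^sub>R y) = 0"
      by eventually_elim (simp add: Dy)
  qed
  have "bilinear (\<lambda>v w. Dx v (Dx w F) (t, r, y))"
    unfolding bilinear_def using linear_Dx[OF smooth_on_pd[OF F] ext] linear_pd_Dx[OF F ext] by blast
  from sum_bilinear_cross[OF this, of y]
  have 1: "(\<Sum>b\<in>Basis. Dx b (Dx b F) (t, r, y)) = (\<Sum>a\<in>Basis. Dx (cross3 a y) (Dx (cross3 a y) F) (t, r, y))"
    by (simp add: Dyy yy)
  note lin = linear_Dx[OF F ext]
  \<comment> \<open>The first-order terms combine to a multiple of the radial derivative, which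
    vanishes too.\<close>
  have "(\<Sum>a\<in>Basis. Dx (cross3 a (cross3 a y)) F (t, r, y)) = Dx (- 2 *\<^sub>R y) F (t, r, y)"
    unfolding sum_cross_cross[symmetric] by (rule linear_sum[OF lin, symmetric])
  also have "\<dots> = 0" using Dy[of 0] linear_cmul[OF lin, of "-2" y] by simp
  finally show ?thesis by (simp add: 1 sum.distrib)
qed

text \<open>The integrand is the derivative along the rotation field of \<open>prod\<close> applied
  to \<open>p\<close> and the rotation derivative of \<open>F\<close>. The product is abstract
  because it is scalar multiplication for the moments and the real inner product for the
  energy.\<close>

lemma angular_integration_by_parts:
  fixes F :: "real \<times> real \<times> (real^3) \<Rightarrow> complex" and prod :: "'x::{second_countable_topology, banach} \<Rightarrow> complex \<Rightarrow> 'z::{second_countable_topology, banach}"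
  assumes F: "smooth_on F (exterior M)" and r: "2 * M < r" and a: "norm a = 1"
    and P: "bounded_bilinear prod"
    and p: "\<And>y. y \<noteq> 0 \<Longrightarrow> (p has_derivative p' y) (at y)"
    and p'_cont: "\<And>v. continuous_on (- {0}) (\<lambda>y. p' y v)"
  shows "(\<integral>\<omega>. prod (p \<omega>) (Dx (cross3 a \<omega>) (Dx (cross3 a \<omega>) F) (t, r, \<omega>) + Dx (cross3 a (cross3 a \<omega>)) F (t, r, \<omega>))
      + prod (p' \<omega> (cross3 a \<omega>)) (Dx (cross3 a \<omega>) F (t, r, \<omega>)) \<partial>sphere_measure) = 0"
proof -
  let ?f' = "\<lambda>y v. prod (p y) (Dx (cross3 a v) F (t, r, y) + Dx v (Dx (cross3 a y) F) (t, r, y))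
      + prod (p' y v) (Dx (cross3 a y) F (t, r, y))"
  have p_cont: "continuous_on (- {0}) p"
    using p by (intro continuous_at_imp_continuous_on) (auto intro: has_derivative_continuous)
  have "(\<integral>\<omega>. ?f' \<omega> (cross3 a \<omega>) \<partial>sphere_measure) = 0"
  proof (rule integral_sphere_angular_derivative[OF a, where f = "\<lambda>y. prod (p y) (Dx (cross3 a y) F (t, r, y))" and f' = ?f'])
    show "((\<lambda>y. prod (p y) (Dx (cross3 a y) F (t, r, y))) has_derivative ?f' y) (at y)" if "y \<noteq> 0" for y
      by (rule bounded_bilinear.FDERIV[OF P p[OF that] has_derivative_angular[OF F r that]])
    show "continuous_on (- {0}) (\<lambda>y. ?f' y v)" for v
      by (intro continuous_on_add bounded_bilinear.continuous_on[OF P] p_cont p'_cont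
          continuous_on_slice[OF smooth_on_pd[OF F] r] continuous_on_slice_Dx[OF F r continuous_on_cross_right(1)])
  qed
  then show ?thesis by (simp add: add.commute)
qed

lemma pd_commute3:
  assumes F: "smooth_on F S" and S: "open S" "p \<in> S"
  shows "pd w (pd v (pd v' F)) p = pd v (pd v' (pd w F)) p"
proof -
  have "pd w (pd v (pd v' F)) p = pd v (pd w (pd v' F)) p"
    by (rule pd_commute[OF smooth_on_pd[OF F] S])
  also have "\<dots> = pd v (pd v' (pd w F)) p"
    by (rule pd_cong[OF S]) (rule pd_commute[OF F S(1)])
  finally show ?thesis .
qed

section \<open>Moments over the sphere\<close>

definition moment :: "real^3 \<Rightarrow> nat \<Rightarrow> (real \<times> real \<times> (real^3) \<Rightarrow> complex) \<Rightarrow> real \<Rightarrow> real \<Rightarrow> complex" where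
  "moment \<xi> n F t r = (\<integral>\<omega>. (\<omega> \<bullet> \<xi>) ^ n *\<^sub>R F (t, r, \<omega>) \<partial>sphere_measure)"

lemma continuous_on_slice_weighted:
  assumes F: "smooth_on F (exterior M)" and r: "2 * M < r" and p: "continuous_on (sphere 0 1) p"
  shows "continuous_on (sphere 0 1) (\<lambda>\<omega>. p \<omega> *\<^sub>R F (t, r, \<omega>))"
proof -
  have "continuous_on (sphere 0 1) (\<lambda>\<omega>. F (t, r, \<omega>))"
    by (rule continuous_on_compose2[OF smooth_on_continuous[OF F]]) (use r in \<open>auto intro!: continuous_intros\<close>)
  then show ?thesis using p by (intro continuous_intros)
qed

lemma moment_has_derivative:
  assumes F: "smooth_on F (exterior M)" and r: "2 * M < r"
  shows "((\<lambda>(t, r). moment \<xi> n F t r) has_derivative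
    (\<lambda>(a, b). a *\<^sub>R moment \<xi> n (Dt F) t r + b *\<^sub>R moment \<xi> n (Dr F) t r)) (at (t, r))"
proof -
  let ?F' = "\<lambda>q \<omega> h. (\<omega> \<bullet> \<xi>) ^ n *\<^sub>R (fst h *\<^sub>R Dt F (fst q, snd q, \<omega>) + snd h *\<^sub>R Dr F (fst q, snd q, \<omega>))"
  let ?U = "UNIV \<times> {2 * M<..} :: (real \<times> real) set"
  have cont: "continuous_on (?U \<times> sphere 0 1) (\<lambda>(q, \<omega>). G (fst q, snd q, \<omega>))"
    if "smooth_on G (exterior M)" for G
    unfolding case_prod_unfold
    by (rule continuous_on_compose2[OF smooth_on_continuous[OF that]]) (auto simp: exterior_def intro!: continuous_intros)
  have "((\<lambda>q. \<integral>\<omega>. (\<omega> \<bullet> \<xi>) ^ n *\<^sub>R F (fst q, snd q, \<omega>) \<partial>sphere_measure) has_derivative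
    (\<lambda>h. \<integral>\<omega>. ?F' (t, r) \<omega> h \<partial>sphere_measure)) (at (t, r))"
  proof (rule has_derivative_sphere_integral[where U = ?U and F = "\<lambda>q \<omega>. (\<omega> \<bullet> \<xi>) ^ n *\<^sub>R F (fst q, snd q, \<omega>)"
        and F' = ?F'])
    show "open ?U" by (intro open_Times) auto
    show "(t, r) \<in> ?U" using r by simp
    show "continuous_on (sphere 0 1) (\<lambda>\<omega>. (\<omega> \<bullet> \<xi>) ^ n *\<^sub>R F (fst q, snd q, \<omega>))" if "q \<in> ?U" for q
      by (rule continuous_on_slice_weighted[OF F]) (use that in \<open>auto intro!: continuous_intros\<close>)
    show "((\<lambda>q. (\<omega> \<bullet> \<xi>) ^ n *\<^sub>R F (fst q, snd q, \<omega>)) has_derivative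
        ?F' q \<omega>) (at q)"
      if "q \<in> ?U" "\<omega> \<in> sphere 0 1" for q \<omega>
    proof -
      have "\<omega> \<noteq> 0" using that by auto
      with has_derivative_DtDr[OF F, of "snd q" \<omega> "fst q"] that
      have "((\<lambda>q. F (fst q, snd q, \<omega>)) has_derivative
          (\<lambda>h. fst h *\<^sub>R Dt F (fst q, snd q, \<omega>) + snd h *\<^sub>R Dr F (fst q, snd q, \<omega>))) (at q)"
        by (auto simp: case_prod_unfold)
      then show ?thesis by (rule has_derivative_scaleR_right)
    qed
    show "continuous_on (?U \<times> sphere 0 1) (\<lambda>(q, \<omega>). ?F' q \<omega> h)" for h
      using cont[OF smooth_on_pd[OF F, of "(1, 0, 0)"]] cont[OF smooth_on_pd[OF F, of "(0, 1, 0)"]]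
      unfolding case_prod_unfold by (intro continuous_intros)
  qed
  moreover have "(\<integral>\<omega>. (\<omega> \<bullet> \<xi>) ^ n *\<^sub>R (a *\<^sub>R Dt F (t, r, \<omega>) + b *\<^sub>R Dr F (t, r, \<omega>)) \<partial>sphere_measure)
      = a *\<^sub>R moment \<xi> n (Dt F) t r + b *\<^sub>R moment \<xi> n (Dr F) t r" for a b
  proof -
    have int: "integrable sphere_measure (\<lambda>\<omega>. (\<omega> \<bullet> \<xi>) ^ n *\<^sub>R G (t, r, \<omega>))" if "smooth_on G (exterior M)" for G :: "real \<times> real \<times> (real^3) \<Rightarrow> complex"
      by (intro integrable_sphere continuous_on_slice_weighted[OF that r] continuous_intros)
    have "(\<integral>\<omega>. (\<omega> \<bullet> \<xi>) ^ n *\<^sub>R (a *\<^sub>R Dt F (t, r, \<omega>) + b *\<^sub>R Dr F (t, r, \<omega>)) \<partial>sphere_measure)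
      = (\<integral>\<omega>. a *\<^sub>R ((\<omega> \<bullet> \<xi>) ^ n *\<^sub>R Dt F (t, r, \<omega>)) + b *\<^sub>R ((\<omega> \<bullet> \<xi>) ^ n *\<^sub>R Dr F (t, r, \<omega>)) \<partial>sphere_measure)"
      by (simp add: scaleR_add_right mult.commute)
    also have "\<dots> = a *\<^sub>R moment \<xi> n (Dt F) t r + b *\<^sub>R moment \<xi> n (Dr F) t r"
      using int[OF smooth_on_pd[OF F, of "(1, 0, 0)"]] int[OF smooth_on_pd[OF F, of "(0, 1, 0)"]]
      by (simp add: moment_def del: scaleR_scaleR)
    finally show ?thesis .
  qed
  ultimately show ?thesis by (simp add: case_prod_unfold moment_def)
qed

lemma continuous_on_sphere_angular:
  fixes F :: "real \<times> real \<times> (real^3) \<Rightarrow> complex"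
  assumes F: "smooth_on F (exterior M)" and r: "2 * M < r"
  shows "continuous_on (sphere 0 1) (\<lambda>\<omega>. F (t, r, \<omega>))"
    and "continuous_on (sphere 0 1) (\<lambda>\<omega>. Dx (cross3 a \<omega>) F (t, r, \<omega>))"
    and "continuous_on (sphere 0 1) (\<lambda>\<omega>. Dx (cross3 a \<omega>) (Dx (cross3 a \<omega>) F) (t, r, \<omega>) + Dx (cross3 a (cross3 a \<omega>)) F (t, r, \<omega>))"
proof -
  have sub: "continuous_on (- {0}) g \<Longrightarrow> continuous_on (sphere 0 1) g" for g :: "real^3 \<Rightarrow> complex"
    by (erule continuous_on_subset) auto
  note c = continuous_on_slice[OF F r] continuous_on_slice_Dx[OF F r] continuous_on_cross_right
  show "continuous_on (sphere 0 1) (\<lambda>\<omega>. F (t, r, \<omega>))"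
    and "continuous_on (sphere 0 1) (\<lambda>\<omega>. Dx (cross3 a \<omega>) F (t, r, \<omega>))"
    and "continuous_on (sphere 0 1) (\<lambda>\<omega>. Dx (cross3 a \<omega>) (Dx (cross3 a \<omega>) F) (t, r, \<omega>) + Dx (cross3 a (cross3 a \<omega>)) F (t, r, \<omega>))"
    by (intro sub continuous_on_add c)+
qed

text \<open>For \<open>n < 2\<close> the truncated index \<open>n - 2\<close> is harmless since its coefficient vanishes.\<close>

lemma moment_angular:
  fixes F :: "real \<times> real \<times> (real^3) \<Rightarrow> complex"
  assumes F: "smooth_on F (exterior M)" and r: "2 * M < r"
    and hom: "\<And>y c. y \<noteq> 0 \<Longrightarrow> 0 < c \<Longrightarrow> F (t, r, c *\<^sub>R y) = F (t, r, y)"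
  shows "(\<integral>\<omega>. (\<omega> \<bullet> \<xi>) ^ n *\<^sub>R (\<Sum>b\<in>Basis. Dx b (Dx b F) (t, r, \<omega>)) \<partial>sphere_measure)
    = (real (n * (n - 1)) * (\<xi> \<bullet> \<xi>)) *\<^sub>R moment \<xi> (n - 2) F t r - real (n * (n + 1)) *\<^sub>R moment \<xi> n F t r"
proof -
  let ?LL = "\<lambda>a \<omega>. Dx (cross3 a \<omega>) (Dx (cross3 a \<omega>) F) (t, r, \<omega>) + Dx (cross3 a (cross3 a \<omega>)) F (t, r, \<omega>)"
  \<comment> \<open>\<open>?p'\<close> is the derivative of the weight, and \<open>?p''\<close> the
    derivative of its rotation derivative; both are evaluated in the direction a x y below.\<close>
  let ?p' = "\<lambda>y v. real n * (y \<bullet> \<xi>) ^ (n - 1) * (v \<bullet> \<xi>)"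
  let ?p'' = "\<lambda>a y v. real n * (real (n - 1) * (y \<bullet> \<xi>) ^ (n - 2) * (v \<bullet> \<xi>)) * (cross3 a y \<bullet> \<xi>) + real n * (y \<bullet> \<xi>) ^ (n - 1) * (cross3 a v \<bullet> \<xi>)"
  note slice = continuous_on_slice[OF _ r] and cross_cont = continuous_on_cross_right(1) and cross2_cont = continuous_on_cross_right(2)
  note cF = continuous_on_sphere_angular(1)[OF F r, of t] and cL = continuous_on_sphere_angular(2)[OF F r, of _ t]
    and cLL = continuous_on_sphere_angular(3)[OF F r, of _ t]
  \<comment> \<open>Two integrations by parts move the squared rotation derivative from
    \<open>F\<close> to the weight; the sphere has no boundary terms.\<close>
  have parts: "(\<integral>\<omega>. (\<omega> \<bullet> \<xi>) ^ n *\<^sub>R ?LL a \<omega> \<partial>sphere_measure) = (\<integral>\<omega>. ?p'' a \<omega> (cross3 a \<omega>) *\<^sub>R F (t, r, \<omega>) \<partial>sphere_measure)"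
    if a: "norm a = 1" for a
  proof -
    have i1: "integrable sphere_measure (\<lambda>\<omega>. (\<omega> \<bullet> \<xi>) ^ n *\<^sub>R ?LL a \<omega>)"
      and i2: "integrable sphere_measure (\<lambda>\<omega>. ?p' \<omega> (cross3 a \<omega>) *\<^sub>R Dx (cross3 a \<omega>) F (t, r, \<omega>))"
      and i3: "integrable sphere_measure (\<lambda>\<omega>. ?p'' a \<omega> (cross3 a \<omega>) *\<^sub>R F (t, r, \<omega>))"
      by (rule integrable_sphere[OF continuous_on_scaleR[OF _ cLL]] integrable_sphere[OF continuous_on_scaleR[OF _ cL]]
          integrable_sphere[OF continuous_on_scaleR[OF _ cF]], intro continuous_intros cross_cont cross2_cont)+
    have "(\<integral>\<omega>. (\<omega> \<bullet> \<xi>) ^ n *\<^sub>R ?LL a \<omega> + ?p' \<omega> (cross3 a \<omega>) *\<^sub>R Dx (cross3 a \<omega>) F (t, r, \<omega>) \<partial>sphere_measure) = 0"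
    proof (rule angular_integration_by_parts[OF F r a bounded_bilinear_scaleR])
      show "((\<lambda>y. (y \<bullet> \<xi>) ^ n) has_derivative ?p' y) (at y)" for y
        by (auto intro!: derivative_eq_intros simp: algebra_simps)
      show "continuous_on (- {0}) (\<lambda>y. ?p' y v)" for v by (intro continuous_intros)
    qed
    moreover have "(\<integral>\<omega>. ?p' \<omega> (cross3 a \<omega>) *\<^sub>R Dx (cross3 a \<omega>) F (t, r, \<omega>) + ?p'' a \<omega> (cross3 a \<omega>) *\<^sub>R F (t, r, \<omega>) \<partial>sphere_measure) = 0"
    proof (rule integral_sphere_angular_derivative[OF a, where f = "\<lambda>y. ?p' y (cross3 a y) *\<^sub>R F (t, r, y)"
          and f' = "\<lambda>y v. ?p' y (cross3 a y) *\<^sub>R Dx v F (t, r, y) + ?p'' a y v *\<^sub>R F (t, r, y)"])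
      fix y :: "real^3" assume y: "y \<noteq> 0"
      have "(cross3 a has_derivative cross3 a) (at y)"
        by (intro bounded_linear_imp_has_derivative linear_conv_bounded_linear[THEN iffD1] linearI)
          (simp_all add: cross_add_right cross_mult_right)
      then have dc: "((\<lambda>y. cross3 a y \<bullet> \<xi>) has_derivative (\<lambda>v. cross3 a v \<bullet> \<xi>)) (at y)"
        by (rule has_derivative_inner_left)
      have dp: "((\<lambda>y. real n * (y \<bullet> \<xi>) ^ (n - 1)) has_derivative (\<lambda>v. real n * (real (n - 1) * (y \<bullet> \<xi>) ^ (n - 2) * (v \<bullet> \<xi>)))) (at y)"
        by (auto intro!: derivative_eq_intros simp: algebra_simps numeral_2_eq_2)
      have "((\<lambda>y. ?p' y (cross3 a y)) has_derivative (\<lambda>v. ?p'' a y v)) (at y)"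
        by (rule has_derivative_eq_rhs[OF has_derivative_mult[OF dp dc]]) (simp add: algebra_simps fun_eq_iff)
      from has_derivative_scaleR[OF this has_derivative_Dx[OF F r y]]
      show "((\<lambda>y. ?p' y (cross3 a y) *\<^sub>R F (t, r, y)) has_derivative (\<lambda>v. ?p' y (cross3 a y) *\<^sub>R Dx v F (t, r, y) + ?p'' a y v *\<^sub>R F (t, r, y))) (at y)" .
    next
      show "continuous_on (- {0}) (\<lambda>y. ?p' y (cross3 a y) *\<^sub>R Dx v F (t, r, y) + ?p'' a y v *\<^sub>R F (t, r, y))" for v
        by (intro continuous_intros cross_cont slice smooth_on_pd F)
    qed
    ultimately show ?thesis using i1 i2 i3 by (simp add: add_eq_0_iff)
  qed
  \<comment> \<open>This is the spherical Laplacian of the weight. The term of degree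
    \<open>n - 2\<close>, which keeps the weight from being an eigenfunction, becomes the source in
    the moment equations.\<close>
  have sum_p'': "(\<Sum>a\<in>Basis. ?p'' a \<omega> (cross3 a \<omega>)) = real (n * (n - 1)) * (\<xi> \<bullet> \<xi>) * (\<omega> \<bullet> \<xi>) ^ (n - 2) - real (n * (n + 1)) * (\<omega> \<bullet> \<xi>) ^ n"
    if \<omega>: "\<omega> \<in> sphere 0 1" for \<omega>
  proof -
    have "\<omega> \<bullet> \<omega> = 1" using \<omega> by (simp add: norm_eq_1)
    have "bilinear (\<lambda>v w :: real^3. (v \<bullet> \<xi>) * (w \<bullet> \<xi>))"
      unfolding bilinear_def by (auto intro!: linearI simp: inner_add_left algebra_simps)
    from sum_bilinear_cross[OF this, of \<omega>]
    have 1: "(\<Sum>a\<in>Basis. (cross3 a \<omega> \<bullet> \<xi>) * (cross3 a \<omega> \<bullet> \<xi>)) = \<xi> \<bullet> \<xi> - (\<omega> \<bullet> \<xi>) * (\<omega> \<bullet> \<xi>)"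
      using \<open>\<omega> \<bullet> \<omega> = 1\<close> euclidean_inner[of \<xi> \<xi>] by (simp add: inner_commute)
    have 2: "(\<Sum>a\<in>Basis. cross3 a (cross3 a \<omega>) \<bullet> \<xi>) = - 2 * (\<omega> \<bullet> \<xi>)"
      unfolding inner_sum_left[symmetric] sum_cross_cross by simp
    have "(\<Sum>a\<in>Basis. ?p'' a \<omega> (cross3 a \<omega>)) =
      real n * real (n - 1) * (\<omega> \<bullet> \<xi>) ^ (n - 2) * (\<Sum>a\<in>Basis. (cross3 a \<omega> \<bullet> \<xi>) * (cross3 a \<omega> \<bullet> \<xi>)) +
      real n * (\<omega> \<bullet> \<xi>) ^ (n - 1) * (\<Sum>a\<in>Basis. cross3 a (cross3 a \<omega>) \<bullet> \<xi>)"
      by (simp add: sum.distrib sum_distrib_left mult.assoc)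
    also have "\<dots> = real n * real (n - 1) * (\<omega> \<bullet> \<xi>) ^ (n - 2) * (\<xi> \<bullet> \<xi>)
      - real n * real (n - 1) * ((\<omega> \<bullet> \<xi>) ^ (n - 2) * (\<omega> \<bullet> \<xi>) * (\<omega> \<bullet> \<xi>)) - 2 * real n * ((\<omega> \<bullet> \<xi>) ^ (n - 1) * (\<omega> \<bullet> \<xi>))"
      unfolding 1 2 by (simp add: algebra_simps)
    also have "real n * real (n - 1) * ((\<omega> \<bullet> \<xi>) ^ (n - 2) * (\<omega> \<bullet> \<xi>) * (\<omega> \<bullet> \<xi>)) = real n * real (n - 1) * (\<omega> \<bullet> \<xi>) ^ n"
    proof -
      consider "n = 0" | "n = 1" | k where "n = Suc (Suc k)"
        by (metis One_nat_def not0_implies_Suc)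
      then show ?thesis by cases auto
    qed
    also have "2 * real n * ((\<omega> \<bullet> \<xi>) ^ (n - 1) * (\<omega> \<bullet> \<xi>)) = 2 * real n * (\<omega> \<bullet> \<xi>) ^ n"
      by (cases n) auto
    finally show ?thesis by (cases n) (auto simp: algebra_simps)
  qed
  have "(\<integral>\<omega>. (\<omega> \<bullet> \<xi>) ^ n *\<^sub>R (\<Sum>b\<in>Basis. Dx b (Dx b F) (t, r, \<omega>)) \<partial>sphere_measure)
      = (\<integral>\<omega>. (\<Sum>a\<in>Basis. (\<omega> \<bullet> \<xi>) ^ n *\<^sub>R ?LL a \<omega>) \<partial>sphere_measure)"
  proof (rule Bochner_Integration.integral_cong[OF refl])
    fix \<omega> :: "real^3" assume "\<omega> \<in> space sphere_measure"
    then have \<omega>: "\<omega> \<in> sphere 0 1" by simp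
    then have "\<omega> \<noteq> 0" by auto
    then show "(\<omega> \<bullet> \<xi>) ^ n *\<^sub>R (\<Sum>b\<in>Basis. Dx b (Dx b F) (t, r, \<omega>)) = (\<Sum>a\<in>Basis. (\<omega> \<bullet> \<xi>) ^ n *\<^sub>R ?LL a \<omega>)"
      using spherical_laplacian_angular[OF F r \<omega> hom] by (simp add: scaleR_sum_right)
  qed
  also have "\<dots> = (\<Sum>a\<in>Basis. \<integral>\<omega>. (\<omega> \<bullet> \<xi>) ^ n *\<^sub>R ?LL a \<omega> \<partial>sphere_measure)"
    by (rule Bochner_Integration.integral_sum, rule integrable_sphere[OF continuous_on_scaleR[OF _ cLL]], intro continuous_intros)
  also have "\<dots> = (\<Sum>a\<in>Basis. \<integral>\<omega>. ?p'' a \<omega> (cross3 a \<omega>) *\<^sub>R F (t, r, \<omega>) \<partial>sphere_measure)"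
    by (intro sum.cong refl parts) simp
  also have "\<dots> = (\<integral>\<omega>. (\<Sum>a\<in>Basis. ?p'' a \<omega> (cross3 a \<omega>) *\<^sub>R F (t, r, \<omega>)) \<partial>sphere_measure)"
    by (rule Bochner_Integration.integral_sum[symmetric], rule integrable_sphere[OF continuous_on_scaleR[OF _ cF]], intro continuous_intros cross_cont cross2_cont)
  also have "\<dots> = (\<integral>\<omega>. (real (n * (n - 1)) * (\<xi> \<bullet> \<xi>)) *\<^sub>R ((\<omega> \<bullet> \<xi>) ^ (n - 2) *\<^sub>R F (t, r, \<omega>)) - real (n * (n + 1)) *\<^sub>R ((\<omega> \<bullet> \<xi>) ^ n *\<^sub>R F (t, r, \<omega>)) \<partial>sphere_measure)"
    by (rule Bochner_Integration.integral_cong[OF refl])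
      (simp only: scaleR_sum_left[symmetric] sum_p'' space_sphere_measure scaleR_diff_left scaleR_scaleR)
  also have "\<dots> = (real (n * (n - 1)) * (\<xi> \<bullet> \<xi>)) *\<^sub>R moment \<xi> (n - 2) F t r - real (n * (n + 1)) *\<^sub>R moment \<xi> n F t r"
  proof -
    have "integrable sphere_measure (\<lambda>\<omega>. (\<omega> \<bullet> \<xi>) ^ k *\<^sub>R F (t, r, \<omega>))" for k
      by (intro integrable_sphere continuous_intros cF)
    then show ?thesis unfolding moment_def by (simp del: scaleR_scaleR)
  qed
  finally show ?thesis .
qed

subsection \<open>The tortoise coordinate\<close>

definition tortoise :: "real \<Rightarrow> real \<Rightarrow> real" where
  "tortoise M r = r + 2 * M * ln (r - 2 * M)"

definition radius :: "real \<Rightarrow> real \<Rightarrow> real" where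
  "radius M x = (THE r. 2 * M < r \<and> tortoise M r = x)"

lemma tortoise_has_derivative:
  assumes "2 * M < r"
  shows "(tortoise M has_real_derivative r / (r - 2 * M)) (at r)"
  unfolding tortoise_def[abs_def]
  using assms by (auto intro!: derivative_eq_intros simp: field_simps)

lemma tortoise_strict_mono:
  assumes "0 < M" "2 * M < r" "r < s"
  shows "tortoise M r < tortoise M s"
  unfolding tortoise_def using assms by (intro add_strict_mono mult_strict_left_mono) auto

lemma tortoise_less_iff:
  assumes "0 < M" "2 * M < r" "2 * M < s"
  shows "tortoise M r < tortoise M s \<longleftrightarrow> r < s"
  using tortoise_strict_mono[OF assms(1)] assms by (metis linorder_neqE_linordered_idom order_less_asym)

lemma tortoise_surj:
  assumes M: "0 < M"
  shows "\<exists>r>2 * M. tortoise M r = x"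
proof -
  \<comment> \<open>At \<open>l\<close> the logarithm is at most (x - 2 M - 1) / (2 M) while
    \<open>l\<close> is at most 2 M + 1, so \<open>tortoise\<close> is at most x there. At
    \<open>h\<close> the logarithm is nonnegative and \<open>h\<close> is at least x.\<close>
  define l where "l = 2 * M + min 1 (exp ((x - 2 * M - 1) / (2 * M)))"
  define h where "h = max (2 * M + 1) x"
  have l: "2 * M < l" "l \<le> 2 * M + 1" by (auto simp: l_def)
  have h: "2 * M + 1 \<le> h" "x \<le> h" by (auto simp: h_def)
  have "ln (l - 2 * M) \<le> ln (exp ((x - 2 * M - 1) / (2 * M)))"
    using l by (subst ln_le_cancel_iff) (auto simp: l_def)
  then have "2 * M * ln (l - 2 * M) \<le> x - 2 * M - 1" using M by (simp add: field_simps)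
  then have "tortoise M l \<le> x" using l by (simp add: tortoise_def)
  moreover have "x \<le> tortoise M h"
  proof -
    have "0 \<le> 2 * M * ln (h - 2 * M)" using M h by simp
    then show ?thesis using h by (simp add: tortoise_def)
  qed
  moreover have "continuous_on {l..h} (tortoise M)"
    using l by (intro continuous_at_imp_continuous_on ballI DERIV_isCont[OF tortoise_has_derivative]) auto
  ultimately obtain r where "l \<le> r" "tortoise M r = x"
    using IVT'[of "tortoise M" l x h] l h by auto
  then show ?thesis using l by (intro exI[of _ r]) auto
qed

lemma radius:
  assumes "0 < M"
  shows "2 * M < radius M x" and tortoise_radius: "tortoise M (radius M x) = x"
proof -
  have "\<exists>!r. 2 * M < r \<and> tortoise M r = x"
    using tortoise_surj[OF assms, of x] tortoise_less_iff[OF assms] by (metis linorder_neqE_linordered_idom less_irrefl)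
  from theI'[OF this] show "2 * M < radius M x" "tortoise M (radius M x) = x"
    by (auto simp: radius_def)
qed

lemma radius_tortoise:
  assumes "0 < M" "2 * M < r"
  shows "radius M (tortoise M r) = r"
  using radius[OF assms(1), of "tortoise M r"] tortoise_less_iff[OF assms(1) assms(2)] tortoise_less_iff[OF assms(1) _ assms(2)]
  by (metis linorder_neqE_linordered_idom less_irrefl)

lemma radius_has_derivative:
  assumes M: "0 < M"
  shows "(radius M has_real_derivative (radius M x - 2 * M) / radius M x) (at x)"
proof -
  note r = radius[OF M, of x]
  show ?thesis
    unfolding has_field_derivative_def
  proof (rule has_derivative_inverse_strong_x[where S = "{2 * M<..}" and f = "tortoise M"
        and f' = "(*) (radius M x / (radius M x - 2 * M))"])
    show "(tortoise M has_derivative (*) (radius M x / (radius M x - 2 * M))) (at (radius M x))"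
      using tortoise_has_derivative[OF r(1)] by (simp add: has_field_derivative_def)
    show "continuous_on {2 * M<..} (tortoise M)"
      by (intro continuous_at_imp_continuous_on ballI DERIV_isCont[OF tortoise_has_derivative]) auto
    show "(*) (radius M x / (radius M x - 2 * M)) \<circ> (*) ((radius M x - 2 * M) / radius M x) = id"
      using r(1) M by (auto simp: fun_eq_iff)
  qed (use r M radius_tortoise in auto)
qed

lemma radius_less_iff:
  assumes "0 < M"
  shows "radius M x < radius M y \<longleftrightarrow> x < y"
  using tortoise_less_iff[OF assms radius(1)[OF assms] radius(1)[OF assms], of x y] by (simp add: tortoise_radius[OF assms])

lemma filterlim_radius_at_bot:
  assumes M: "0 < M"
  shows "filterlim (radius M) (at_right (2 * M)) at_bot"
  unfolding filterlim_at
proof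
  show "\<forall>\<^sub>F x in at_bot. radius M x \<in> {2 * M<..} \<and> radius M x \<noteq> 2 * M"
    using radius(1)[OF M] by (auto simp: less_imp_neq[symmetric] intro!: always_eventually)
  show "(radius M \<longlongrightarrow> 2 * M) at_bot"
  proof (rule order_tendstoI)
    show "\<forall>\<^sub>F x in at_bot. c < radius M x" if "c < 2 * M" for c
      using radius(1)[OF M] that by (auto intro!: always_eventually intro: less_trans)
    show "\<forall>\<^sub>F x in at_bot. radius M x < c" if "2 * M < c" for c
    proof -
      have "radius M x < c" if "x < tortoise M c" for x
        using radius_less_iff[OF M, of x "tortoise M c"] that radius_tortoise[OF M \<open>2 * M < c\<close>] by simp
      then show ?thesis by (rule eventually_mono[OF eventually_gt_at_bot[of "tortoise M c"], rotated])
    qed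
  qed
qed

lemma filterlim_radius_at_top:
  assumes M: "0 < M"
  shows "filterlim (radius M) at_top at_top"
  unfolding filterlim_at_top
proof
  fix Z :: real
  define c where "c = max Z (2 * M + 1)"
  have "Z \<le> radius M x" if "tortoise M c < x" for x
  proof -
    have "c < radius M x"
      using radius_less_iff[OF M, of "tortoise M c" x] that radius_tortoise[OF M, of c] by (simp add: c_def)
    then show ?thesis by (simp add: c_def)
  qed
  then show "\<forall>\<^sub>F x in at_top. Z \<le> radius M x"
    by (rule eventually_mono[OF eventually_gt_at_top[of "tortoise M c"], rotated])
qed

text \<open>\<open>Y\<close> and its first derivatives are sums of terms c(r) G(t, r); this
  differentiates one such term in (t, x), with dr/dx = (r - 2 M) / r.\<close>

lemma radius_chain:
  assumes M: "0 < M" and G: "((\<lambda>(t, r). G t r) has_derivative (\<lambda>(a, b). a *\<^sub>R Gt + b *\<^sub>R Gr)) (at (t, radius M x))"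
    and c: "(c has_real_derivative c') (at (radius M x))"
  shows "((\<lambda>(t, x). c (radius M x) *\<^sub>R G t (radius M x)) has_derivative
    (\<lambda>(a, b). a *\<^sub>R (c (radius M x) *\<^sub>R Gt) +
      b *\<^sub>R (((radius M x - 2 * M) / radius M x) *\<^sub>R (c' *\<^sub>R G t (radius M x) + c (radius M x) *\<^sub>R Gr)))) (at (t, x))"
proof -
  let ?f = "(radius M x - 2 * M) / radius M x"
  have rad: "(radius M has_derivative (\<lambda>h. ?f * h)) (at (snd (t, x)))"
    using radius_has_derivative[OF M, of x] unfolding has_field_derivative_def snd_conv .
  have "((\<lambda>q. radius M (snd q)) has_derivative (\<lambda>h. ?f * snd h)) (at (t, x))"
    by (rule has_derivative_compose[OF has_derivative_snd[OF has_derivative_ident] rad])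
  note rad2 = this
  have "((\<lambda>q. (fst q, radius M (snd q))) has_derivative (\<lambda>h. (fst h, ?f * snd h))) (at (t, x))"
    by (intro has_derivative_Pair has_derivative_fst has_derivative_ident rad2)
  moreover have "((\<lambda>q. G (fst q) (snd q)) has_derivative (\<lambda>h. fst h *\<^sub>R Gt + snd h *\<^sub>R Gr)) (at (fst (t, x), radius M (snd (t, x))))"
    using G by (simp add: case_prod_unfold)
  ultimately have G2: "((\<lambda>q. G (fst q) (radius M (snd q))) has_derivative (\<lambda>h. fst h *\<^sub>R Gt + (?f * snd h) *\<^sub>R Gr)) (at (t, x))"
    using has_derivative_compose[of "\<lambda>q. (fst q, radius M (snd q))" _ _ UNIV "\<lambda>q. G (fst q) (snd q)"] by fastforce
  have "(c has_derivative (\<lambda>h. c' * h)) (at (radius M (snd (t, x))))"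
    using c by (simp add: has_field_derivative_def)
  from has_derivative_compose[OF rad2 this]
  have c2: "((\<lambda>q. c (radius M (snd q))) has_derivative (\<lambda>h. c' * (?f * snd h))) (at (t, x))" .
  from has_derivative_scaleR[OF c2 G2] show ?thesis
    by (simp add: case_prod_unfold algebra_simps)
qed

subsection \<open>The time derivative of the solution\<close>

locale schwarzschild_wave =
  fixes M :: real and \<psi> :: "real \<Rightarrow> real^3 \<Rightarrow> complex" and u :: "real \<Rightarrow> real \<Rightarrow> real^3 \<Rightarrow> complex"
  assumes M: "0 < M" and data: "test_data M \<psi>" and sol: "wave_solution M (\<lambda>_ _. 0) \<psi> u"
begin

definition U :: "real \<times> real \<times> (real^3) \<Rightarrow> complex" where
  "U = (\<lambda>(t, r, x). u t r (sgn x))"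

text \<open>The factor r of the overview is left out here and reappears in \<open>Y\<close>,
  \<open>radial\<close>, \<open>sqnorm\<close> and the energy.\<close>

definition Z :: "real \<times> real \<times> (real^3) \<Rightarrow> complex" where
  "Z = Dt U"

lemma smooth_U: "smooth_on U (exterior M)"
  using sol by (simp add: wave_solution_def U_def exterior_def)

lemma smooth_Z: "smooth_on Z (exterior M)"
  unfolding Z_def by (rule smooth_on_pd[OF smooth_U])

lemma sphere_sgn: "\<omega> \<in> sphere 0 1 \<Longrightarrow> sgn \<omega> = \<omega>" for \<omega> :: "real^3"
  by (simp add: sgn_div_norm)

lemma u_eq_U: "\<omega> \<in> sphere 0 1 \<Longrightarrow> u t r \<omega> = U (t, r, \<omega>)"
  by (simp add: U_def sphere_sgn)

lemma D_u:
  assumes "2 * M < r" "\<omega> \<in> sphere 0 1"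
  shows "D (\<lambda>s. u s r \<omega>) t = Z (t, r, \<omega>)"
proof -
  have "\<omega> \<noteq> 0" using assms(2) by auto
  from vector_derivative_at[OF has_vector_derivative_Dt[OF smooth_U assms(1) this]] show ?thesis
    by (simp add: Z_def u_eq_U[OF assms(2)])
qed

lemma hom_Z:
  assumes "2 * M < r" "y \<noteq> 0" "0 < c"
  shows "Z (t, r, c *\<^sub>R y) = Z (t, r, y)"
proof -
  have "U (s, r, c *\<^sub>R y) = U (s, r, y)" for s
    using assms by (simp add: U_def sgn_scaleR)
  moreover have "((\<lambda>s. U (s, r, c *\<^sub>R y)) has_vector_derivative Z (t, r, c *\<^sub>R y)) (at t)"
    "((\<lambda>s. U (s, r, y)) has_vector_derivative Z (t, r, y)) (at t)"
    unfolding Z_def using assms by (auto intro!: has_vector_derivative_Dt[OF smooth_U])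
  ultimately show ?thesis using vector_derivative_unique_at by fastforce
qed

text \<open>Translates the iterated one-variable derivatives into partial derivatives of
  \<open>U\<close>. Under an outer derivative the inner one has to be identified on a whole
  neighbourhood.\<close>

lemma box_U:
  assumes r: "2 * M < r" and \<omega>: "\<omega> \<in> sphere 0 1"
  shows "- (r / (r - 2 * M)) *\<^sub>R Dt (Dt U) (t, r, \<omega>) + ((r - 2 * M) / r) *\<^sub>R Dr (Dr U) (t, r, \<omega>)
    + (1 / r\<^sup>2) *\<^sub>R (\<Sum>b\<in>Basis. Dx b (Dx b U) (t, r, \<omega>)) + (2 * (r - M) / r\<^sup>2) *\<^sub>R Dr U (t, r, \<omega>) = 0"
proof -
  have \<omega>0: "\<omega> \<noteq> 0" using \<omega> by auto
  have "(\<lambda>t. D (\<lambda>s. u s r \<omega>) t) = (\<lambda>t. Dt U (t, r, \<omega>))"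
    using D_u[OF r \<omega>] by (simp add: Z_def)
  then have tt: "D (D (\<lambda>s. u s r \<omega>)) t = Dt (Dt U) (t, r, \<omega>)"
    using vector_derivative_at[OF has_vector_derivative_Dt[OF smooth_on_pd[OF smooth_U] r \<omega>0]] by simp
  have Dru: "D (\<lambda>s. u t s \<omega>) r' = Dr U (t, r', \<omega>)" if "2 * M < r'" for r'
    using vector_derivative_at[OF has_vector_derivative_Dr[OF smooth_U that \<omega>0]] by (simp add: u_eq_U[OF \<omega>])
  have "(D (\<lambda>s. u t s \<omega>) has_vector_derivative Dr (Dr U) (t, r, \<omega>)) (at r)"
    by (rule has_vector_derivative_transform_within_open[OF has_vector_derivative_Dr[OF smooth_on_pd[OF smooth_U] r \<omega>0],
          where S = "{2 * M<..}"]) (use r Dru in auto)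
  then have rr: "D (D (\<lambda>s. u t s \<omega>)) r = Dr (Dr U) (t, r, \<omega>)" by (rule vector_derivative_at)
  have xx: "D (D (\<lambda>s. u t r (sgn (\<omega> + s *\<^sub>R b)))) 0 = Dx b (Dx b U) (t, r, \<omega>)" if b: "b \<in> Basis" for b
  proof -
    \<comment> \<open>Both vectors have length 1, so for |s| < 1 the line stays away from the
      origin, which the region excludes.\<close>
    have ne: "\<omega> + s *\<^sub>R b \<noteq> 0" if "\<bar>s\<bar> < 1" for s
    proof
      assume "\<omega> + s *\<^sub>R b = 0"
      then have "\<omega> = - (s *\<^sub>R b)" by (simp add: add_eq_0_iff2)
      then have "norm \<omega> = \<bar>s\<bar>" using b by simp
      then show False using that \<omega> by simp
    qed
    have d: "D (\<lambda>s. u t r (sgn (\<omega> + s *\<^sub>R b))) s = Dx b U (t, r, \<omega> + s *\<^sub>R b)" if "\<bar>s\<bar> < 1" for s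
      using vector_derivative_at[OF has_vector_derivative_Dx[OF smooth_U r ne[OF that]]] by (simp add: U_def)
    have "((\<lambda>s. Dx b U (t, r, \<omega> + s *\<^sub>R b)) has_vector_derivative Dx b (Dx b U) (t, r, \<omega> + 0 *\<^sub>R b)) (at 0)"
      by (rule has_vector_derivative_Dx[OF smooth_on_pd[OF smooth_U] r ne]) simp
    then have "(D (\<lambda>s. u t r (sgn (\<omega> + s *\<^sub>R b))) has_vector_derivative Dx b (Dx b U) (t, r, \<omega> + 0 *\<^sub>R b)) (at 0)"
      by (rule has_vector_derivative_transform_within_open[where S = "{-1<..<1}"]) (use d in auto)
    from vector_derivative_at[OF this] show ?thesis by simp
  qed
  have "schwarzschild_box M u t r \<omega> = 0" using sol r \<omega> by (simp add: wave_solution_def)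
  then show ?thesis
    by (simp add: schwarzschild_box_def sphere_laplacian_def laplacian_def tt rr Dru[OF r] xx)
qed

text \<open>The coefficients do not depend on t, so the time derivative passes through the operator
  once third derivatives are commuted.\<close>

lemma box_Z:
  assumes r: "2 * M < r" and \<omega>: "\<omega> \<in> sphere 0 1"
  shows "- (r / (r - 2 * M)) *\<^sub>R Dt (Dt Z) (t, r, \<omega>) + ((r - 2 * M) / r) *\<^sub>R Dr (Dr Z) (t, r, \<omega>)
    + (1 / r\<^sup>2) *\<^sub>R (\<Sum>b\<in>Basis. Dx b (Dx b Z) (t, r, \<omega>)) + (2 * (r - M) / r\<^sup>2) *\<^sub>R Dr Z (t, r, \<omega>) = 0"
proof -
  have \<omega>0: "\<omega> \<noteq> 0" using \<omega> by auto
  have ext: "(t, r, \<omega>) \<in> exterior M" using r \<omega>0 by simp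
  let ?B = "\<lambda>t. - (r / (r - 2 * M)) *\<^sub>R Dt (Dt U) (t, r, \<omega>) + ((r - 2 * M) / r) *\<^sub>R Dr (Dr U) (t, r, \<omega>)
    + (1 / r\<^sup>2) *\<^sub>R (\<Sum>b\<in>Basis. Dx b (Dx b U) (t, r, \<omega>)) + (2 * (r - M) / r\<^sup>2) *\<^sub>R Dr U (t, r, \<omega>)"
  note d = has_vector_derivative_Dt[OF _ r \<omega>0]
  note c = bounded_linear.has_vector_derivative[OF bounded_linear_scaleR_right]
  have "(?B has_vector_derivative
      - (r / (r - 2 * M)) *\<^sub>R Dt (Dt (Dt U)) (t, r, \<omega>) + ((r - 2 * M) / r) *\<^sub>R Dt (Dr (Dr U)) (t, r, \<omega>)
    + (1 / r\<^sup>2) *\<^sub>R (\<Sum>b\<in>Basis. Dt (Dx b (Dx b U)) (t, r, \<omega>)) + (2 * (r - M) / r\<^sup>2) *\<^sub>R Dt (Dr U) (t, r, \<omega>)) (at t)"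
    by (intro has_vector_derivative_add has_vector_derivative_sum c d smooth_on_pd smooth_U)
  moreover have "?B = (\<lambda>t. 0)" using box_U[OF r \<omega>] by auto
  ultimately have "- (r / (r - 2 * M)) *\<^sub>R Dt (Dt (Dt U)) (t, r, \<omega>) + ((r - 2 * M) / r) *\<^sub>R Dt (Dr (Dr U)) (t, r, \<omega>)
    + (1 / r\<^sup>2) *\<^sub>R (\<Sum>b\<in>Basis. Dt (Dx b (Dx b U)) (t, r, \<omega>)) + (2 * (r - M) / r\<^sup>2) *\<^sub>R Dt (Dr U) (t, r, \<omega>) = 0"
    using vector_derivative_unique_at[OF _ has_vector_derivative_const] by simp
  then show ?thesis
    unfolding Z_def pd_commute3[OF smooth_U open_exterior ext, of "(1, 0, 0)" "(0, 1, 0)"]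
      pd_commute3[OF smooth_U open_exterior ext, of "(1, 0, 0)" "(0, 0, _)"]
      pd_commute[OF smooth_U open_exterior ext, of "(1, 0, 0)" "(0, 1, 0)"] .
qed

lemma moment_equation:
  assumes r: "2 * M < r"
  shows "- (r / (r - 2 * M)) *\<^sub>R moment \<xi> n (Dt (Dt Z)) t r + ((r - 2 * M) / r) *\<^sub>R moment \<xi> n (Dr (Dr Z)) t r
    + (1 / r\<^sup>2) *\<^sub>R ((real (n * (n - 1)) * (\<xi> \<bullet> \<xi>)) *\<^sub>R moment \<xi> (n - 2) Z t r - real (n * (n + 1)) *\<^sub>R moment \<xi> n Z t r)
    + (2 * (r - M) / r\<^sup>2) *\<^sub>R moment \<xi> n (Dr Z) t r = 0"
proof -
  have int: "integrable sphere_measure (\<lambda>\<omega>. (\<omega> \<bullet> \<xi>) ^ n *\<^sub>R G (t, r, \<omega>))" if "smooth_on G (exterior M)" for G :: "real \<times> real \<times> (real^3) \<Rightarrow> complex"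
    by (intro integrable_sphere continuous_on_slice_weighted[OF that r] continuous_intros)
  have intS: "integrable sphere_measure (\<lambda>\<omega>. (\<omega> \<bullet> \<xi>) ^ n *\<^sub>R (\<Sum>b\<in>Basis. Dx b (Dx b Z) (t, r, \<omega>)))"
    unfolding scaleR_sum_right by (intro Bochner_Integration.integrable_sum int smooth_on_pd smooth_Z)
  have "0 = (\<integral>\<omega>. (\<omega> \<bullet> \<xi>) ^ n *\<^sub>R (- (r / (r - 2 * M)) *\<^sub>R Dt (Dt Z) (t, r, \<omega>) + ((r - 2 * M) / r) *\<^sub>R Dr (Dr Z) (t, r, \<omega>)
    + (1 / r\<^sup>2) *\<^sub>R (\<Sum>b\<in>Basis. Dx b (Dx b Z) (t, r, \<omega>)) + (2 * (r - M) / r\<^sup>2) *\<^sub>R Dr Z (t, r, \<omega>)) \<partial>sphere_measure)"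
    (is "_ = integral\<^sup>L _ ?I")
    by (subst Bochner_Integration.integral_cong[OF refl, of _ ?I "\<lambda>_. 0"]) (simp_all only: box_Z[OF r] space_sphere_measure scaleR_zero_right integral_zero)
  also have "\<dots> = (\<integral>\<omega>. - (r / (r - 2 * M)) *\<^sub>R ((\<omega> \<bullet> \<xi>) ^ n *\<^sub>R Dt (Dt Z) (t, r, \<omega>)) + ((r - 2 * M) / r) *\<^sub>R ((\<omega> \<bullet> \<xi>) ^ n *\<^sub>R Dr (Dr Z) (t, r, \<omega>))
    + (1 / r\<^sup>2) *\<^sub>R ((\<omega> \<bullet> \<xi>) ^ n *\<^sub>R (\<Sum>b\<in>Basis. Dx b (Dx b Z) (t, r, \<omega>))) + (2 * (r - M) / r\<^sup>2) *\<^sub>R ((\<omega> \<bullet> \<xi>) ^ n *\<^sub>R Dr Z (t, r, \<omega>)) \<partial>sphere_measure)"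
    by (simp only: scaleR_add_right scaleR_left_commute[of "(_ \<bullet> \<xi>) ^ n"])
  also have "\<dots> = - (r / (r - 2 * M)) *\<^sub>R moment \<xi> n (Dt (Dt Z)) t r + ((r - 2 * M) / r) *\<^sub>R moment \<xi> n (Dr (Dr Z)) t r
    + (1 / r\<^sup>2) *\<^sub>R (\<integral>\<omega>. (\<omega> \<bullet> \<xi>) ^ n *\<^sub>R (\<Sum>b\<in>Basis. Dx b (Dx b Z) (t, r, \<omega>)) \<partial>sphere_measure)
    + (2 * (r - M) / r\<^sup>2) *\<^sub>R moment \<xi> n (Dr Z) t r"
    unfolding moment_def
    using int[OF smooth_on_pd[OF smooth_on_pd[OF smooth_Z]]] int[OF smooth_on_pd[OF smooth_Z]] intS
    by (simp del: scaleR_scaleR scaleR_minus_left)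
  also have "(\<integral>\<omega>. (\<omega> \<bullet> \<xi>) ^ n *\<^sub>R (\<Sum>b\<in>Basis. Dx b (Dx b Z) (t, r, \<omega>)) \<partial>sphere_measure)
      = (real (n * (n - 1)) * (\<xi> \<bullet> \<xi>)) *\<^sub>R moment \<xi> (n - 2) Z t r - real (n * (n + 1)) *\<^sub>R moment \<xi> n Z t r"
    by (rule moment_angular[OF smooth_Z r]) (rule hom_Z[OF r])
  finally show ?thesis by (rule sym)
qed

text \<open>This is dr/dx for the tortoise coordinate x, so dividing by it turns an integral over r
  into one over x.\<close>

definition lapse :: "real \<Rightarrow> real" where
  "lapse r = (r - 2 * M) / r"

text \<open>Multiplication by r (r - 2 M) clears the denominators, and 2 (r - M) / r = 1 +
  \<open>lapse r\<close> gives the last coefficient. \<open>S\<close> is the angular term, either at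
  a point or integrated against a weight.\<close>

lemma wave_operator_solved:
  fixes a b c S :: complex
  assumes r: "2 * M < r"
    and eq: "- (r / (r - 2 * M)) *\<^sub>R a + ((r - 2 * M) / r) *\<^sub>R b + (1 / r\<^sup>2) *\<^sub>R S + (2 * (r - M) / r\<^sup>2) *\<^sub>R c = 0"
  shows "r\<^sup>2 *\<^sub>R a = (r * lapse r)\<^sup>2 *\<^sub>R b + lapse r *\<^sub>R S + (r * lapse r * (1 + lapse r)) *\<^sub>R c"
proof -
  have r0: "0 < r" "0 < r - 2 * M" using M r by auto
  have k: "r * (r - 2 * M) * (- (r / (r - 2 * M))) = - r\<^sup>2" "r * (r - 2 * M) * ((r - 2 * M) / r) = (r * lapse r)\<^sup>2"
    "r * (r - 2 * M) * (1 / r\<^sup>2) = lapse r" "r * (r - 2 * M) * (2 * (r - M) / r\<^sup>2) = r * lapse r * (1 + lapse r)"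
    using r0 by (simp_all add: lapse_def power2_eq_square field_simps)
  have "0 = (r * (r - 2 * M)) *\<^sub>R (- (r / (r - 2 * M)) *\<^sub>R a + ((r - 2 * M) / r) *\<^sub>R b + (1 / r\<^sup>2) *\<^sub>R S + (2 * (r - M) / r\<^sup>2) *\<^sub>R c)"
    by (simp only: eq scaleR_zero_right)
  also have "\<dots> = - r\<^sup>2 *\<^sub>R a + (r * lapse r)\<^sup>2 *\<^sub>R b + lapse r *\<^sub>R S + (r * lapse r * (1 + lapse r)) *\<^sub>R c"
    by (simp only: scaleR_add_right scaleR_scaleR k)
  finally show ?thesis by (simp add: algebra_simps)
qed

definition Y :: "real^3 \<Rightarrow> nat \<Rightarrow> real \<Rightarrow> real \<Rightarrow> complex" where
  "Y \<xi> n t x = radius M x *\<^sub>R moment \<xi> n Z t (radius M x)"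

text \<open>The Regge-Wheeler potential of scalar waves, with \<open>n\<close> as angular
  momentum.\<close>

definition potential :: "nat \<Rightarrow> real \<Rightarrow> real" where
  "potential n x = (let r = radius M x in (r - 2 * M) / r * (2 * M / r ^ 3 + n * (n + 1) / r\<^sup>2))"

text \<open>The factor r in \<open>Y\<close> absorbs the first-order radial term, at the price of 2
  M / r^3 in the potential. The source carries the factor n (n - 1) and so disappears for the two
  lowest orders.\<close>

lemma Y_jet:
  "\<exists>Yt Yx Ytt Ytx Yxx. C2_jet (Y \<xi> n) Yt Yx Ytt Ytx Yxx \<and>
    (\<forall>t x. Yt t x = radius M x *\<^sub>R moment \<xi> n (Dt Z) t (radius M x)) \<and>
    (\<forall>t x. Ytt t x - Yxx t x = - (potential n x *\<^sub>R Y \<xi> n t x) +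
      ((radius M x - 2 * M) / radius M x ^ 3 * (n * (n - 1)) * (\<xi> \<bullet> \<xi>)) *\<^sub>R Y \<xi> (n - 2) t x)"
proof -
  note md = moment_has_derivative[OF _ radius(1)[OF M], where \<xi> = \<xi> and n = n]
  define f where "f = lapse"
  then have f_def: "f r = (r - 2 * M) / r" for r by (simp add: lapse_def)
  have rad0: "radius M x \<noteq> 0" for x using radius(1)[OF M, of x] M by linarith
  have id: "((\<lambda>r. r) has_real_derivative 1) (at r)" for r by (auto intro!: derivative_eq_intros)
  have f': "(f has_real_derivative 2 * M / (radius M x)\<^sup>2) (at (radius M x))" for x
    unfolding f_def[abs_def] using rad0[of x] by (auto intro!: derivative_eq_intros simp: field_simps power2_eq_square)
  have sub: "((\<lambda>r. r - 2 * M) has_real_derivative 1) (at r)" for r by (auto intro!: derivative_eq_intros)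
  let ?\<rho> = "radius M"
  let ?m = "\<lambda>G t x. moment \<xi> n G t (radius M x)"
  define Yt where "Yt t x = ?\<rho> x *\<^sub>R ?m (Dt Z) t x" for t x
  define Yx where "Yx t x = f (?\<rho> x) *\<^sub>R ?m Z t x + (?\<rho> x - 2 * M) *\<^sub>R ?m (Dr Z) t x" for t x
  define Ytt where "Ytt t x = ?\<rho> x *\<^sub>R ?m (Dt (Dt Z)) t x" for t x
  define Ytx where "Ytx t x = f (?\<rho> x) *\<^sub>R ?m (Dt Z) t x + (?\<rho> x - 2 * M) *\<^sub>R ?m (Dt (Dr Z)) t x" for t x
  define Yxx where "Yxx t x = f (?\<rho> x) *\<^sub>R ((2 * M / (?\<rho> x)\<^sup>2) *\<^sub>R ?m Z t x + f (?\<rho> x) *\<^sub>R ?m (Dr Z) t x)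
      + f (?\<rho> x) *\<^sub>R (1 *\<^sub>R ?m (Dr Z) t x + (?\<rho> x - 2 * M) *\<^sub>R ?m (Dr (Dr Z)) t x)" for t x
  have fr: "f (?\<rho> x) * ?\<rho> x = ?\<rho> x - 2 * M" for x using rad0[of x] by (simp add: f_def)
  \<comment> \<open>The jet admits one mixed derivative, so the two orders have to be identified
    under the integral.\<close>
  have comm: "moment \<xi> n (Dr (Dt Z)) t (?\<rho> x) = moment \<xi> n (Dt (Dr Z)) t (?\<rho> x)" for t x
    unfolding moment_def
  proof (rule Bochner_Integration.integral_cong[OF refl])
    fix \<omega> :: "real^3" assume "\<omega> \<in> space sphere_measure"
    then have "(t, ?\<rho> x, \<omega>) \<in> exterior M" using radius(1)[OF M] by auto
    from pd_commute[OF smooth_Z open_exterior this]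
    show "(\<omega> \<bullet> \<xi>) ^ n *\<^sub>R Dr (Dt Z) (t, ?\<rho> x, \<omega>) = (\<omega> \<bullet> \<xi>) ^ n *\<^sub>R Dt (Dr Z) (t, ?\<rho> x, \<omega>)" by simp
  qed
  have "C2_jet (Y \<xi> n) Yt Yx Ytt Ytx Yxx"
    unfolding C2_jet_def
  proof (intro allI conjI)
    fix t x
    show "((\<lambda>(t, x). Y \<xi> n t x) has_derivative (\<lambda>(a, b). a *\<^sub>R Yt t x + b *\<^sub>R Yx t x)) (at (t, x))"
      using radius_chain[OF M md[OF smooth_Z] id, where t = t and x = x]
      by (simp add: Y_def Yt_def Yx_def f_def[symmetric] scaleR_add_right fr)
    show "((\<lambda>(t, x). Yt t x) has_derivative (\<lambda>(a, b). a *\<^sub>R Ytt t x + b *\<^sub>R Ytx t x)) (at (t, x))"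
      using radius_chain[OF M md[OF smooth_on_pd[OF smooth_Z]] id, where t = t and x = x, of "(1, 0, 0)"]
      by (simp add: Yt_def Ytt_def Ytx_def f_def[symmetric] scaleR_add_right fr comm)
    show "((\<lambda>(t, x). Yx t x) has_derivative (\<lambda>(a, b). a *\<^sub>R Ytx t x + b *\<^sub>R Yxx t x)) (at (t, x))"
    proof -
      have A: "((\<lambda>(t, x). f (?\<rho> x) *\<^sub>R ?m Z t x) has_derivative (\<lambda>(a, b). a *\<^sub>R (f (?\<rho> x) *\<^sub>R ?m (Dt Z) t x)
          + b *\<^sub>R (f (?\<rho> x) *\<^sub>R ((2 * M / (?\<rho> x)\<^sup>2) *\<^sub>R ?m Z t x + f (?\<rho> x) *\<^sub>R ?m (Dr Z) t x)))) (at (t, x))"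
        using radius_chain[OF M md[OF smooth_Z] f', where t = t and x = x] unfolding f_def[symmetric] .
      have B: "((\<lambda>(t, x). (?\<rho> x - 2 * M) *\<^sub>R ?m (Dr Z) t x) has_derivative (\<lambda>(a, b). a *\<^sub>R ((?\<rho> x - 2 * M) *\<^sub>R ?m (Dt (Dr Z)) t x)
          + b *\<^sub>R (f (?\<rho> x) *\<^sub>R (1 *\<^sub>R ?m (Dr Z) t x + (?\<rho> x - 2 * M) *\<^sub>R ?m (Dr (Dr Z)) t x)))) (at (t, x))"
        using radius_chain[OF M md[OF smooth_on_pd[OF smooth_Z]] sub, where t = t and x = x, of "(0, 1, 0)"]
        unfolding f_def[symmetric] .
      show ?thesis
        using has_derivative_add[OF A B]
        by (simp add: Yx_def Ytx_def Yxx_def case_prod_unfold scaleR_add_right add_ac)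
    qed
  qed
  moreover have "Ytt t x - Yxx t x = - (potential n x *\<^sub>R Y \<xi> n t x) +
      ((?\<rho> x - 2 * M) / ?\<rho> x ^ 3 * (n * (n - 1)) * (\<xi> \<bullet> \<xi>)) *\<^sub>R Y \<xi> (n - 2) t x" for t x
  proof -
    let ?S = "(real (n * (n - 1)) * (\<xi> \<bullet> \<xi>)) *\<^sub>R moment \<xi> (n - 2) Z t (?\<rho> x) - real (n * (n + 1)) *\<^sub>R ?m Z t x"
    have rf: "?\<rho> x - 2 * M = ?\<rho> x * f (?\<rho> x)" "(?\<rho> x - 2 * M) / (?\<rho> x)\<^sup>2 = f (?\<rho> x) / ?\<rho> x"
      using rad0[of x] by (simp_all add: f_def power2_eq_square)
    have "?\<rho> x *\<^sub>R Ytt t x = (?\<rho> x)\<^sup>2 *\<^sub>R ?m (Dt (Dt Z)) t x" by (simp add: Ytt_def power2_eq_square)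
    also have "\<dots> = (?\<rho> x * f (?\<rho> x))\<^sup>2 *\<^sub>R ?m (Dr (Dr Z)) t x + f (?\<rho> x) *\<^sub>R ?S + (?\<rho> x * f (?\<rho> x) * (1 + f (?\<rho> x))) *\<^sub>R ?m (Dr Z) t x"
      unfolding \<open>f = lapse\<close> by (rule wave_operator_solved[OF radius(1)[OF M] moment_equation[OF radius(1)[OF M]]])
    also have "\<dots> = ?\<rho> x *\<^sub>R (((?\<rho> x - 2 * M) / (?\<rho> x)\<^sup>2) *\<^sub>R ?S - (f (?\<rho> x) * (2 * M / (?\<rho> x)\<^sup>2)) *\<^sub>R ?m Z t x + Yxx t x)"
      unfolding rf(2) Yxx_def unfolding rf(1) using rad0[of x]
      by (simp add: power2_eq_square algebra_simps)
    finally have "Ytt t x - Yxx t x = ((?\<rho> x - 2 * M) / (?\<rho> x)\<^sup>2) *\<^sub>R ?S - ((?\<rho> x - 2 * M) / ?\<rho> x * (2 * M / (?\<rho> x)\<^sup>2)) *\<^sub>R ?m Z t x"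
      using rad0[of x] by (simp add: f_def)
    also have "\<dots> = ((?\<rho> x - 2 * M) / (?\<rho> x)\<^sup>2 * (real (n * (n - 1)) * (\<xi> \<bullet> \<xi>))) *\<^sub>R moment \<xi> (n - 2) Z t (?\<rho> x)
        - ((?\<rho> x - 2 * M) / (?\<rho> x)\<^sup>2 * real (n * (n + 1)) + (?\<rho> x - 2 * M) / ?\<rho> x * (2 * M / (?\<rho> x)\<^sup>2)) *\<^sub>R ?m Z t x"
      by (simp only: scaleR_diff_right scaleR_add_left scaleR_scaleR diff_diff_eq)
    also have "(?\<rho> x - 2 * M) / (?\<rho> x)\<^sup>2 * (real (n * (n - 1)) * (\<xi> \<bullet> \<xi>)) = (?\<rho> x - 2 * M) / ?\<rho> x ^ 3 * (n * (n - 1)) * (\<xi> \<bullet> \<xi>) * ?\<rho> x"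
      using rad0[of x] by (simp add: power2_eq_square power3_eq_cube)
    also have "(?\<rho> x - 2 * M) / (?\<rho> x)\<^sup>2 * real (n * (n + 1)) + (?\<rho> x - 2 * M) / ?\<rho> x * (2 * M / (?\<rho> x)\<^sup>2) = potential n x * ?\<rho> x"
      using rad0[of x] by (simp add: potential_def Let_def power2_eq_square power3_eq_cube field_simps)
    finally show ?thesis by (simp add: Y_def)
  qed
  ultimately show ?thesis using Yt_def by blast
qed

text \<open>The majorant is a multiple of (dr/dx) / r^2 and thus has an explicit primitive in x; 2 M
  < r absorbs the mass term.\<close>

lemma potential_bound:
  "\<bar>potential n x\<bar> \<le> (1 + real n * (real n + 1)) * ((radius M x - 2 * M) / radius M x ^ 3)"
proof -
  let ?r = "radius M x"
  have r: "0 < ?r" "2 * M < ?r" using radius(1)[OF M, of x] M by auto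
  have "2 * M / ?r ^ 3 \<le> 1 / ?r\<^sup>2" using r by (simp add: power2_eq_square power3_eq_cube field_simps)
  then have "2 * M / ?r ^ 3 + real n * (real n + 1) / ?r\<^sup>2 \<le> (1 + real n * (real n + 1)) / ?r\<^sup>2" by (simp add: add_divide_distrib)
  then have "(?r - 2 * M) / ?r * (2 * M / ?r ^ 3 + real n * (real n + 1) / ?r\<^sup>2) \<le> (?r - 2 * M) / ?r * ((1 + real n * (real n + 1)) / ?r\<^sup>2)"
    using r by (intro mult_left_mono) auto
  moreover have "0 \<le> (?r - 2 * M) / ?r * (2 * M / ?r ^ 3 + real n * (real n + 1) / ?r\<^sup>2)"
    using r M by (intro mult_nonneg_nonneg add_nonneg_nonneg) auto
  ultimately have "\<bar>potential n x\<bar> \<le> (?r - 2 * M) / ?r * ((1 + real n * (real n + 1)) / ?r\<^sup>2)"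
    unfolding potential_def Let_def by (simp only: abs_of_nonneg)
  also have "\<dots> = (1 + real n * (real n + 1)) * ((?r - 2 * M) / ?r ^ 3)"
    by (simp add: power2_eq_square power3_eq_cube mult_ac)
  finally show ?thesis .
qed

lemma continuous_potential: "continuous_on UNIV (potential n)"
proof -
  have "continuous_on UNIV (radius M)"
    by (intro continuous_at_imp_continuous_on ballI DERIV_isCont[OF radius_has_derivative[OF M]])
  moreover have "radius M x \<noteq> 0" for x using radius(1)[OF M, of x] M by linarith
  ultimately show ?thesis unfolding potential_def[abs_def] Let_def by (intro continuous_intros) auto
qed

lemma locally_zero_derivatives:
  fixes G :: "real \<times> real \<times> (real^3) \<Rightarrow> complex"
  assumes G: "smooth_on G (exterior M)" and S: "open S" "r \<in> S" "S \<subseteq> {2 * M<..}"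
    and zero: "\<And>r y. r \<in> S \<Longrightarrow> y \<noteq> 0 \<Longrightarrow> G (t, r, y) = 0" and y: "y \<noteq> 0"
  shows "Dr G (t, r, y) = 0" "Dx v G (t, r, y) = 0"
proof -
  have r: "2 * M < r" using S by auto
  show "Dr G (t, r, y) = 0"
  proof (rule derivative_zero_if_locally_zero[OF has_vector_derivative_Dr[OF G r y]])
    have "\<forall>\<^sub>F s in nhds r. s \<in> S" using S by (intro eventually_nhds_in_open)
    then show "\<forall>\<^sub>F s in nhds r. G (t, s, y) = 0" by eventually_elim (rule zero[OF _ y])
  qed
  have "(\<lambda>v. Dx v G (t, r, y)) = (\<lambda>v. 0)"
  proof (rule has_derivative_unique)
    show "((\<lambda>y. G (t, r, y)) has_derivative (\<lambda>v. Dx v G (t, r, y))) (at y)"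
      by (rule has_derivative_Dx[OF G r y])
    show "((\<lambda>y. G (t, r, y)) has_derivative (\<lambda>v. 0)) (at y)"
      by (rule has_derivative_transform_within_open[OF has_derivative_const[of 0], where s = "- {0}"])
        (use y S zero in auto)
  qed
  then show "Dx v G (t, r, y) = 0" by meson
qed

lemma Z_initial: "2 * M < r \<Longrightarrow> \<omega> \<in> sphere 0 1 \<Longrightarrow> Z (0, r, \<omega>) = \<psi> r \<omega>"
  using D_u[of r \<omega> 0] sol by (simp add: wave_solution_def)

text \<open>\<open>U\<close> vanishes on the whole initial slice together with its space
  derivatives, so the wave equation leaves only the second time derivative.\<close>

lemma Dt_Z_initial:
  assumes r: "2 * M < r" and \<omega>: "\<omega> \<in> sphere 0 1"
  shows "Dt Z (0, r, \<omega>) = 0"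
proof -
  have \<omega>0: "\<omega> \<noteq> 0" using \<omega> by auto
  have U0: "U (0, r, y) = 0" if "r \<in> {2 * M<..}" "y \<noteq> 0" for r y
    using sol that by (simp add: U_def wave_solution_def norm_sgn)
  note d = locally_zero_derivatives[where S = "{2 * M<..}", OF _ open_greaterThan _ subset_refl]
  have 1: "Dr U (0, r, y) = 0" "Dx b U (0, r, y) = 0" if "r \<in> {2 * M<..}" "y \<noteq> 0" for r y b
    using d[OF smooth_U that(1) U0 that(2)] by auto
  have 2: "Dr (Dr U) (0, r, \<omega>) = 0" "Dx b (Dx b U) (0, r, \<omega>) = 0" for b
    using d(1)[OF smooth_on_pd[OF smooth_U] _ 1(1) \<omega>0] d(2)[OF smooth_on_pd[OF smooth_U] _ 1(2) \<omega>0] r by auto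
  have "- (r / (r - 2 * M)) *\<^sub>R Dt (Dt U) (0, r, \<omega>) = 0"
    using box_U[OF r \<omega>, of 0] 1(1)[of r \<omega>] r \<omega>0 by (simp add: 2)
  then show ?thesis using r M by (simp add: Z_def)
qed

lemma support_bounds:
  obtains a b where "a \<le> b" "\<And>x \<omega>. x < a \<or> b < x \<Longrightarrow> \<omega> \<in> sphere 0 1 \<Longrightarrow> \<psi> (radius M x) \<omega> = 0"
proof -
  obtain K where K: "compact K" "K \<subseteq> {2 * M<..} \<times> sphere 0 1"
      "\<And>r \<omega>. 2 * M < r \<Longrightarrow> \<omega> \<in> sphere 0 1 \<Longrightarrow> (r, \<omega>) \<notin> K \<Longrightarrow> \<psi> r \<omega> = 0"
    using data unfolding test_data_def by blast
  \<comment> \<open>The extra point keeps \<open>R\<close> nonempty when \<open>K\<close> is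
    empty.\<close>
  define R where "R = insert (2 * M + 1) (fst ` K)"
  have R: "compact R" "R \<noteq> {}" "R \<subseteq> {2 * M<..}"
    using K by (auto simp: R_def intro!: compact_insert compact_continuous_image continuous_intros)
  obtain l where l: "l \<in> R" "\<And>r. r \<in> R \<Longrightarrow> l \<le> r" using compact_attains_inf[OF R(1,2)] by blast
  obtain h where h: "h \<in> R" "\<And>r. r \<in> R \<Longrightarrow> r \<le> h" using compact_attains_sup[OF R(1,2)] by blast
  have lM: "2 * M < l" "2 * M < h" using l h R by auto
  show ?thesis
  proof (rule that)
    show "tortoise M l \<le> tortoise M h"
      using l(2)[OF h(1)] tortoise_strict_mono[OF M lM(1), of h] by (cases "l = h") auto
    fix x and \<omega> :: "real^3" assume x: "x < tortoise M l \<or> tortoise M h < x" and \<omega>: "\<omega> \<in> sphere 0 1"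
    have "radius M x < l \<or> h < radius M x"
      using x radius_less_iff[OF M, of x "tortoise M l"] radius_less_iff[OF M, of "tortoise M h" x]
      by (simp add: radius_tortoise[OF M lM(1)] radius_tortoise[OF M lM(2)])
    then have "radius M x \<notin> R" using l(2) h(2) by force
    then have "(radius M x, \<omega>) \<notin> K" by (force simp: R_def)
    then show "\<psi> (radius M x) \<omega> = 0" using K(3) radius(1)[OF M] \<omega> by blast
  qed
qed

lemma Y_initial:
  assumes "\<And>\<omega>. \<omega> \<in> sphere 0 1 \<Longrightarrow> \<psi> (radius M x) \<omega> = 0"
  shows "Y \<xi> n 0 x = 0"
proof -
  have "moment \<xi> n Z 0 (radius M x) = (\<integral>\<omega>. 0 \<partial>sphere_measure)"
    unfolding moment_def
    by (rule Bochner_Integration.integral_cong[OF refl]) (use assms Z_initial[OF radius(1)[OF M]] in simp)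
  then show ?thesis by (simp add: Y_def)
qed

lemma moment_Dt_initial: "moment \<xi> n (Dt Z) 0 (radius M x) = 0"
proof -
  have "moment \<xi> n (Dt Z) 0 (radius M x) = (\<integral>\<omega>. 0 \<partial>sphere_measure)"
    unfolding moment_def
    by (rule Bochner_Integration.integral_cong[OF refl]) (use Dt_Z_initial[OF radius(1)[OF M]] in simp)
  then show ?thesis by simp
qed

text \<open>By induction the source, a moment of order \<open>n - 2\<close>, vanishes on the same
  cone, and the one-dimensional statement applies. Finite speed of propagation for \<open>Z\<close>
  then follows from that of all its moments.\<close>

lemma Y_domain_of_dependence:
  assumes init: "\<And>z \<omega>. \<bar>z - c\<bar> < h \<Longrightarrow> \<omega> \<in> sphere 0 1 \<Longrightarrow> \<psi> (radius M z) \<omega> = 0"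
    and tx: "0 \<le> t" "\<bar>x - c\<bar> < h - t"
  shows "Y \<xi> n t x = 0"
  using tx
proof (induction n arbitrary: t x rule: less_induct)
  case (less n)
  obtain Yt Yx Ytt Ytx Yxx where J: "C2_jet (Y \<xi> n) Yt Yx Ytt Ytx Yxx"
    and Yt: "\<And>t x. Yt t x = radius M x *\<^sub>R moment \<xi> n (Dt Z) t (radius M x)"
    and pde: "\<And>t x. Ytt t x - Yxx t x = - (potential n x *\<^sub>R Y \<xi> n t x) +
      ((radius M x - 2 * M) / radius M x ^ 3 * (n * (n - 1)) * (\<xi> \<bullet> \<xi>)) *\<^sub>R Y \<xi> (n - 2) t x"
    using Y_jet[of \<xi> n] by blast
  obtain C where C: "\<And>z. z \<in> cball c h \<Longrightarrow> norm (potential n z) \<le> C"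
    by (rule continuous_on_compact_bound[OF compact_cball continuous_on_subset[OF continuous_potential subset_UNIV]]) blast
  show ?case
  proof (rule domain_of_dependence[OF J, where c = c and h = h and C = C])
    fix s z assume s: "0 \<le> s" "\<bar>z - c\<bar> < h - s"
    have "(real (n * (n - 1))) *\<^sub>R Y \<xi> (n - 2) s z = 0"
    proof (cases "n < 2")
      case True
      then show ?thesis by (auto simp: less_2_cases_iff)
    next
      case False
      then show ?thesis using less.IH[OF _ s, of "n - 2"] by simp
    qed
    then have "Ytt s z - Yxx s z = - (potential n z *\<^sub>R Y \<xi> n s z)" by (auto simp: pde)
    moreover have "norm (potential n z) \<le> C" using s by (intro C) (simp add: dist_real_def abs_minus_commute)
    ultimately show "norm (Ytt s z - Yxx s z) \<le> C * norm (Y \<xi> n s z)"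
      by (simp add: mult_right_mono)
  qed (use less.prems init in \<open>auto intro!: Y_initial simp: Yt moment_Dt_initial\<close>)
qed

lemma Z_eq_0_if_Y:
  assumes "\<And>\<xi> n. Y \<xi> n t x = 0" and \<omega>: "\<omega> \<in> sphere 0 1"
  shows "Z (t, radius M x, \<omega>) = 0"
proof (rule zero_if_moments_zero[OF _ _ \<omega>, where f = "\<lambda>\<omega>. Z (t, radius M x, \<omega>)"])
  show "continuous_on (sphere 0 1) (\<lambda>\<omega>. Z (t, radius M x, \<omega>))"
    using continuous_on_slice_weighted[OF smooth_Z radius(1)[OF M], of "\<lambda>_. 1"] by simp
  show "(\<integral>\<omega>. (\<omega> \<bullet> \<xi>) ^ n *\<^sub>R Z (t, radius M x, \<omega>) \<partial>sphere_measure) = 0" for \<xi> n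
    using assms(1)[of \<xi> n] radius(1)[OF M, of x] M by (simp add: Y_def moment_def)
qed

lemma Z_domain_of_dependence:
  assumes "\<And>z \<omega>. \<bar>z - c\<bar> < h \<Longrightarrow> \<omega> \<in> sphere 0 1 \<Longrightarrow> \<psi> (radius M z) \<omega> = 0"
    and "0 \<le> t" "\<bar>x - c\<bar> < h - t" "\<omega> \<in> sphere 0 1"
  shows "Z (t, radius M x, \<omega>) = 0"
  by (rule Z_eq_0_if_Y[OF Y_domain_of_dependence[OF assms(1-3)] assms(4)])

section \<open>The energy and its conservation\<close>

definition angular :: "real^3 \<Rightarrow> (real \<times> real \<times> (real^3) \<Rightarrow> complex) \<Rightarrow> real \<times> real \<times> (real^3) \<Rightarrow> complex" where
  "angular a G p = Dx (cross3 a (snd (snd p))) G p"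

definition radial :: "real \<times> real \<times> (real^3) \<Rightarrow> complex" where
  "radial p = Z p + fst (snd p) *\<^sub>R Dr Z p"

text \<open>With z = r \<open>Z\<close> and x the tortoise coordinate this is half of z_t^2 + z_x^2
  + V z^2 + q |grad z|^2, where z_x = \<open>lapse\<close> times \<open>radial\<close>, V =
  \<open>lapse\<close> 2 M / r^3 and q = \<open>lapse\<close> / r^2. On the unit sphere the squares
  of the three rotation derivatives add up to that of the spherical gradient.\<close>

definition energy_density :: "real \<times> real \<times> (real^3) \<Rightarrow> real" where
  "energy_density p = (let r = fst (snd p) in
     (1 / 2) * (r\<^sup>2 * (Dt Z p \<bullet> Dt Z p) + (lapse r)\<^sup>2 * (radial p \<bullet> radial p) + lapse r * (2 * M / r) * (Z p \<bullet> Z p)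
       + lapse r * (\<Sum>a\<in>Basis. angular a Z p \<bullet> angular a Z p)))"

definition energy_density_dt :: "real \<times> real \<times> (real^3) \<Rightarrow> real" where
  "energy_density_dt p = (let r = fst (snd p) in
     r\<^sup>2 * (Dt Z p \<bullet> Dt (Dt Z) p) + (lapse r)\<^sup>2 * (radial p \<bullet> (Dt Z p + r *\<^sub>R Dt (Dr Z) p)) + lapse r * (2 * M / r) * (Z p \<bullet> Dt Z p)
       + lapse r * (\<Sum>a\<in>Basis. angular a Z p \<bullet> angular a (Dt Z) p))"

text \<open>This is the inner product of z_t and z_x for z = r \<open>Z\<close>, since r - 2 M = r
  \<open>lapse r\<close>.\<close>

definition flux_density :: "real \<times> real \<times> (real^3) \<Rightarrow> real" where
  "flux_density p = (fst (snd p) - 2 * M) * (Dt Z p \<bullet> radial p)"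

definition flux_density_dr :: "real \<times> real \<times> (real^3) \<Rightarrow> real" where
  "flux_density_dr p = (let r = fst (snd p) in
     Dt Z p \<bullet> radial p + (r - 2 * M) * (Dt (Dr Z) p \<bullet> radial p + Dt Z p \<bullet> (2 *\<^sub>R Dr Z p + r *\<^sub>R Dr (Dr Z) p)))"

lemma continuous_on_angular:
  assumes G: "smooth_on G (exterior M)"
  shows "continuous_on (exterior M) (angular a G)"
  unfolding angular_def[abs_def]
proof (rule continuous_on_linear_family[where f' = "\<lambda>p w. Dx w G p" and w = "\<lambda>p. cross3 a (snd (snd p))"])
  show "continuous_on (exterior M) (\<lambda>p. cross3 a (snd (snd p)))"
    by (intro continuous_on_cross continuous_intros)
  show "linear (\<lambda>w. Dx w G p)" if "p \<in> exterior M" for p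
  proof -
    have "linear (\<lambda>w. (0::real, 0::real, w::real^3))" by (auto intro!: linearI)
    from linear_compose[OF this linear_pd[OF G that]] show ?thesis by (simp add: o_def)
  qed
qed (rule smooth_on_continuous[OF smooth_on_pd[OF G]])

lemma continuous_densities:
  "continuous_on (exterior M) energy_density" "continuous_on (exterior M) energy_density_dt"
  "continuous_on (exterior M) flux_density" "continuous_on (exterior M) flux_density_dr"
  "continuous_on (exterior M) radial"
proof -
  note s = smooth_on_continuous[OF smooth_Z] smooth_on_continuous[OF smooth_on_pd[OF smooth_Z]]
    smooth_on_continuous[OF smooth_on_pd[OF smooth_on_pd[OF smooth_Z]]]
    continuous_on_angular[OF smooth_Z] continuous_on_angular[OF smooth_on_pd[OF smooth_Z]]
  have r: "continuous_on (exterior M) (\<lambda>p. fst (snd p))" by (intro continuous_intros)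
  have r0: "fst (snd p) \<noteq> 0" if "p \<in> exterior M" for p
    using that M by (auto simp: exterior_def)
  have l: "continuous_on (exterior M) (\<lambda>p. lapse (fst (snd p)))" "continuous_on (exterior M) (\<lambda>p. 2 * M / fst (snd p))"
    unfolding lapse_def using r0 by (intro continuous_intros; auto)+
  show rad: "continuous_on (exterior M) radial"
    unfolding radial_def[abs_def] by (intro continuous_intros s r)
  show "continuous_on (exterior M) energy_density" "continuous_on (exterior M) energy_density_dt"
    "continuous_on (exterior M) flux_density" "continuous_on (exterior M) flux_density_dr"
    unfolding energy_density_def[abs_def] energy_density_dt_def[abs_def] flux_density_def[abs_def] flux_density_dr_def[abs_def] Let_def
    by (intro continuous_on_add continuous_on_mult continuous_on_power continuous_on_inner continuous_on_sum continuous_on_scaleR continuous_on_diff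
        continuous_on_divide continuous_on_const s r l rad; simp)+
qed

lemma energy_density_has_derivative:
  assumes r: "2 * M < r" and \<omega>: "\<omega> \<noteq> 0"
  shows "((\<lambda>t. energy_density (t, r, \<omega>)) has_derivative (\<lambda>h. h * energy_density_dt (t, r, \<omega>))) (at t)"
proof -
  note d = has_vector_derivative_Dt[OF _ r \<omega>, unfolded has_vector_derivative_def, where t = t and T = UNIV]
  have ext: "(t, r, \<omega>) \<in> exterior M" using r \<omega> by simp
  have ang: "((\<lambda>t. angular a Z (t, r, \<omega>)) has_derivative (\<lambda>h. h *\<^sub>R angular a (Dt Z) (t, r, \<omega>))) (at t)" for a
    using d[OF smooth_on_pd[OF smooth_Z], of "(0, 0, cross3 a \<omega>)"] pd_commute[OF smooth_Z open_exterior ext]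
    by (simp add: angular_def)
  have rad: "((\<lambda>t. radial (t, r, \<omega>)) has_derivative (\<lambda>h. h *\<^sub>R (Dt Z (t, r, \<omega>) + r *\<^sub>R Dt (Dr Z) (t, r, \<omega>)))) (at t)"
    unfolding radial_def using has_derivative_add[OF d[OF smooth_Z] has_derivative_scaleR_right[OF d[OF smooth_on_pd[OF smooth_Z], of "(0, 1, 0)"], of r]]
    by (simp add: scaleR_add_right mult.commute[of r])
  have sq: "((\<lambda>t. v t \<bullet> v t) has_derivative (\<lambda>h. h * (2 * (v t \<bullet> v')))) (at t)"
    if "(v has_derivative (\<lambda>h. h *\<^sub>R v')) (at t)" for v :: "real \<Rightarrow> complex" and v' t
    using has_derivative_inner[OF that that] by (simp add: inner_commute algebra_simps)
  have "((\<lambda>t. (1 / 2) * (r\<^sup>2 * (Dt Z (t, r, \<omega>) \<bullet> Dt Z (t, r, \<omega>)) + (lapse r)\<^sup>2 * (radial (t, r, \<omega>) \<bullet> radial (t, r, \<omega>))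
       + lapse r * (2 * M / r) * (Z (t, r, \<omega>) \<bullet> Z (t, r, \<omega>))
       + lapse r * (\<Sum>a\<in>Basis. angular a Z (t, r, \<omega>) \<bullet> angular a Z (t, r, \<omega>)))) has_derivative
    (\<lambda>h. (1 / 2) * (r\<^sup>2 * (h * (2 * (Dt Z (t, r, \<omega>) \<bullet> Dt (Dt Z) (t, r, \<omega>))))
       + (lapse r)\<^sup>2 * (h * (2 * (radial (t, r, \<omega>) \<bullet> (Dt Z (t, r, \<omega>) + r *\<^sub>R Dt (Dr Z) (t, r, \<omega>)))))
       + lapse r * (2 * M / r) * (h * (2 * (Z (t, r, \<omega>) \<bullet> Dt Z (t, r, \<omega>))))
       + lapse r * (\<Sum>a\<in>Basis. h * (2 * (angular a Z (t, r, \<omega>) \<bullet> angular a (Dt Z) (t, r, \<omega>))))))) (at t)"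
    by (intro has_derivative_add has_derivative_mult_right has_derivative_sum sq ang rad d smooth_Z smooth_on_pd)
  then show ?thesis
    unfolding energy_density_def energy_density_dt_def Let_def fst_conv snd_conv
    by (rule has_derivative_eq_rhs) (simp add: fun_eq_iff algebra_simps sum_distrib_left)
qed

lemma flux_density_has_derivative:
  assumes r: "2 * M < r" and \<omega>: "\<omega> \<noteq> 0"
  shows "((\<lambda>r. flux_density (t, r, \<omega>)) has_derivative (\<lambda>h. h * flux_density_dr (t, r, \<omega>))) (at r)"
proof -
  note d = has_vector_derivative_Dr[OF _ r \<omega>, unfolded has_vector_derivative_def, where t = t and T = UNIV]
  have ext: "(t, r, \<omega>) \<in> exterior M" using r \<omega> by simp
  have rad: "((\<lambda>r. radial (t, r, \<omega>)) has_derivative (\<lambda>h. h *\<^sub>R (2 *\<^sub>R Dr Z (t, r, \<omega>) + r *\<^sub>R Dr (Dr Z) (t, r, \<omega>)))) (at r)"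
    unfolding radial_def fst_conv snd_conv
    by (rule has_derivative_eq_rhs[OF has_derivative_add[OF d[OF smooth_Z]
        has_derivative_scaleR[OF has_derivative_ident d[OF smooth_on_pd[OF smooth_Z]]]]])
      (simp add: fun_eq_iff algebra_simps scaleR_2)
  have DtZ: "((\<lambda>r. Dt Z (t, r, \<omega>)) has_derivative (\<lambda>h. h *\<^sub>R Dt (Dr Z) (t, r, \<omega>))) (at r)"
    using d[OF smooth_on_pd[OF smooth_Z], of "(1, 0, 0)"]
    by (simp add: pd_commute[OF smooth_Z open_exterior ext, of "(0, 1, 0)" "(1, 0, 0)"])
  have "((\<lambda>r. r - 2 * M) has_derivative (\<lambda>h. h)) (at r)" by (auto intro!: derivative_eq_intros)
  from has_derivative_mult[OF this has_derivative_inner[OF DtZ rad]]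
  show ?thesis
    unfolding flux_density_def flux_density_dr_def Let_def fst_conv snd_conv
    by (rule has_derivative_eq_rhs) (simp add: fun_eq_iff algebra_simps)
qed

text \<open>The local conservation law with all functions replaced by their values at a point:
  \<open>f\<close> is the lapse, \<open>1 - f\<close> is 2 M / r, and the term with \<open>S\<close>
  is the angular part that is still to be integrated.\<close>

lemma energy_identity_algebra:
  fixes z zt zr zrt zrr ztt S :: "'v::real_inner"
  assumes r: "0 < r" and eq: "r\<^sup>2 *\<^sub>R ztt = (r * f)\<^sup>2 *\<^sub>R zrr + f *\<^sub>R S + (r * f * (1 + f)) *\<^sub>R zr"
  shows "r\<^sup>2 * (zt \<bullet> ztt) + f\<^sup>2 * ((z + r *\<^sub>R zr) \<bullet> (zt + r *\<^sub>R zrt)) + f * (1 - f) * (z \<bullet> zt)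
    = f * (zt \<bullet> (z + r *\<^sub>R zr) + (r * f) * (zrt \<bullet> (z + r *\<^sub>R zr) + zt \<bullet> (2 *\<^sub>R zr + r *\<^sub>R zrr))) + f * (zt \<bullet> S)"
proof -
  have "r\<^sup>2 * (zt \<bullet> ztt) = zt \<bullet> ((r * f)\<^sup>2 *\<^sub>R zrr + f *\<^sub>R S + (r * f * (1 + f)) *\<^sub>R zr)"
    by (simp only: eq[symmetric] inner_scaleR_right)
  then show ?thesis
    by (simp add: inner_simps inner_commute power2_eq_square algebra_simps)
qed

definition energy :: "real \<Rightarrow> real \<Rightarrow> real" where
  "energy t r = (\<integral>\<omega>. energy_density (t, r, \<omega>) \<partial>sphere_measure)"

definition energy_dt :: "real \<Rightarrow> real \<Rightarrow> real" where
  "energy_dt t r = (\<integral>\<omega>. energy_density_dt (t, r, \<omega>) \<partial>sphere_measure)"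

definition flux :: "real \<Rightarrow> real \<Rightarrow> real" where
  "flux t r = (\<integral>\<omega>. flux_density (t, r, \<omega>) \<partial>sphere_measure)"

definition flux_dr :: "real \<Rightarrow> real \<Rightarrow> real" where
  "flux_dr t r = (\<integral>\<omega>. flux_density_dr (t, r, \<omega>) \<partial>sphere_measure)"

lemma continuous_on_slices:
  assumes G: "continuous_on (exterior M) G" 
  shows "continuous_on ((UNIV \<times> {2 * M<..}) \<times> sphere 0 1) (\<lambda>(q, \<omega>). G (fst q, snd q, \<omega>))"
    and "2 * M < r \<Longrightarrow> continuous_on (UNIV \<times> sphere 0 1) (\<lambda>(t, \<omega>). G (t, r, \<omega>))"
    and "continuous_on ({2 * M<..} \<times> sphere 0 1) (\<lambda>(r, \<omega>). G (t, r, \<omega>))"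
    and "2 * M < r \<Longrightarrow> continuous_on (sphere 0 1) (\<lambda>\<omega>. G (t, r, \<omega>))"
  unfolding case_prod_unfold
  by (rule continuous_on_compose2[OF G]; auto simp: exterior_def intro!: continuous_intros)+

lemma continuous_on_energies:
  "continuous_on (UNIV \<times> {2 * M<..}) (\<lambda>q. energy (fst q) (snd q))"
  "continuous_on (UNIV \<times> {2 * M<..}) (\<lambda>q. energy_dt (fst q) (snd q))"
  unfolding energy_def energy_dt_def
  by (intro continuous_on_sphere_integral continuous_on_slices continuous_densities)+

lemma energy_has_derivative:
  assumes r: "2 * M < r"
  shows "((\<lambda>t. energy t r) has_real_derivative energy_dt t r) (at t)"
proof -
  have "((\<lambda>t. \<integral>\<omega>. energy_density (t, r, \<omega>) \<partial>sphere_measure) has_derivative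
      (\<lambda>h. \<integral>\<omega>. h * energy_density_dt (t, r, \<omega>) \<partial>sphere_measure)) (at t)"
  proof (rule has_derivative_sphere_integral[where U = UNIV and F = "\<lambda>t \<omega>. energy_density (t, r, \<omega>)"
        and F' = "\<lambda>t \<omega> h. h * energy_density_dt (t, r, \<omega>)"])
    show "((\<lambda>t. energy_density (t, r, \<omega>)) has_derivative (\<lambda>h. h * energy_density_dt (t, r, \<omega>))) (at t)"
      if "\<omega> \<in> sphere 0 1" for t \<omega>
      using that by (intro energy_density_has_derivative r) auto
    show "continuous_on (UNIV \<times> sphere 0 1) (\<lambda>(t, \<omega>). h * energy_density_dt (t, r, \<omega>))" for h
      using continuous_on_slices(2)[OF continuous_densities(2) r] unfolding case_prod_unfold by (intro continuous_intros)
  qed (auto intro!: continuous_on_slices continuous_densities r)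
  then show ?thesis unfolding has_field_derivative_def energy_def energy_dt_def
    by (rule has_derivative_eq_rhs) (auto simp: mult.commute)
qed

lemma flux_has_derivative:
  assumes r: "2 * M < r"
  shows "((\<lambda>r. flux t r) has_real_derivative flux_dr t r) (at r)"
proof -
  have "((\<lambda>r. \<integral>\<omega>. flux_density (t, r, \<omega>) \<partial>sphere_measure) has_derivative
      (\<lambda>h. \<integral>\<omega>. h * flux_density_dr (t, r, \<omega>) \<partial>sphere_measure)) (at r)"
  proof (rule has_derivative_sphere_integral[where U = "{2 * M<..}" and F = "\<lambda>r \<omega>. flux_density (t, r, \<omega>)"
        and F' = "\<lambda>r \<omega> h. h * flux_density_dr (t, r, \<omega>)"])
    show "((\<lambda>r. flux_density (t, r, \<omega>)) has_derivative (\<lambda>h. h * flux_density_dr (t, r, \<omega>))) (at r)"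
      if "r \<in> {2 * M<..}" "\<omega> \<in> sphere 0 1" for r \<omega>
      using that by (intro flux_density_has_derivative) auto
    show "continuous_on ({2 * M<..} \<times> sphere 0 1) (\<lambda>(r, \<omega>). h * flux_density_dr (t, r, \<omega>))" for h
      using continuous_on_slices(3)[OF continuous_densities(4)] unfolding case_prod_unfold by (intro continuous_intros)
  qed (use r in \<open>auto intro!: continuous_on_slices continuous_densities\<close>)
  then show ?thesis unfolding has_field_derivative_def flux_def flux_dr_def
    by (rule has_derivative_eq_rhs) (auto simp: mult.commute)
qed

text \<open>At a point the energy balance has an angular remainder. It is the expression from
  integration by parts with the weight \<open>Dt Z\<close>, hence integrates to zero over the
  sphere.\<close>

lemma energy_flux:
  assumes r: "2 * M < r"
  shows "energy_dt t r = lapse r * flux_dr t r"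
proof -
  let ?I = "\<lambda>a \<omega>. Dt Z (t, r, \<omega>) \<bullet> (Dx (cross3 a \<omega>) (Dx (cross3 a \<omega>) Z) (t, r, \<omega>) + Dx (cross3 a (cross3 a \<omega>)) Z (t, r, \<omega>))
      + Dx (cross3 a \<omega>) (Dt Z) (t, r, \<omega>) \<bullet> Dx (cross3 a \<omega>) Z (t, r, \<omega>)"
  have r0: "0 < r" using M r by simp
  have rf: "r - 2 * M = r * lapse r" "2 * M / r = 1 - lapse r"
    using r0 by (auto simp: lapse_def field_simps)
  have pt: "energy_density_dt (t, r, \<omega>) - lapse r * flux_density_dr (t, r, \<omega>) = lapse r * (\<Sum>a\<in>Basis. ?I a \<omega>)"
    if \<omega>: "\<omega> \<in> sphere 0 1" for \<omega>
  proof -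
    let ?S = "\<Sum>b\<in>Basis. Dx b (Dx b Z) (t, r, \<omega>)"
    have S: "?S = (\<Sum>a\<in>Basis. Dx (cross3 a \<omega>) (Dx (cross3 a \<omega>) Z) (t, r, \<omega>) + Dx (cross3 a (cross3 a \<omega>)) Z (t, r, \<omega>))"
      by (rule spherical_laplacian_angular[OF smooth_Z r \<omega>]) (rule hom_Z[OF r], use \<omega> in auto)
    have "(\<Sum>a\<in>Basis. ?I a \<omega>) = Dt Z (t, r, \<omega>) \<bullet> ?S + (\<Sum>a\<in>Basis. angular a Z (t, r, \<omega>) \<bullet> angular a (Dt Z) (t, r, \<omega>))"
      unfolding S inner_sum_right sum.distrib[symmetric]
      by (intro sum.cong refl) (simp add: angular_def inner_commute)
    then show ?thesis
      using energy_identity_algebra[OF r0 wave_operator_solved[OF r box_Z[OF r \<omega>, of t]], of "Dt Z (t, r, \<omega>)" "Z (t, r, \<omega>)" "Dt (Dr Z) (t, r, \<omega>)"]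
      unfolding energy_density_dt_def flux_density_dr_def Let_def fst_conv snd_conv rf radial_def
      by (simp add: distrib_left)
  qed
  have I0: "(\<integral>\<omega>. ?I a \<omega> \<partial>sphere_measure) = 0" if "a \<in> Basis" for a
  proof (rule angular_integration_by_parts[OF smooth_Z r _ bounded_bilinear_inner])
    show "norm a = 1" using that by simp
    show "((\<lambda>y. Dt Z (t, r, y)) has_derivative (\<lambda>v. Dx v (Dt Z) (t, r, y))) (at y)" if "y \<noteq> 0" for y
      by (rule has_derivative_Dx[OF smooth_on_pd[OF smooth_Z] r that])
    show "continuous_on (- {0}) (\<lambda>y. Dx v (Dt Z) (t, r, y))" for v
      by (rule continuous_on_compose2[OF smooth_on_continuous[OF smooth_on_pd[OF smooth_on_pd[OF smooth_Z]]]])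
        (use r in \<open>auto intro!: continuous_intros\<close>)
  qed
  have intI: "integrable sphere_measure (?I a)" for a
    by (rule integrable_sphere[OF continuous_on_add[OF continuous_on_inner continuous_on_inner]];
        rule continuous_on_sphere_angular[OF smooth_Z r] continuous_on_sphere_angular[OF smooth_on_pd[OF smooth_Z] r])
  have "energy_dt t r - lapse r * flux_dr t r = (\<integral>\<omega>. energy_density_dt (t, r, \<omega>) - lapse r * flux_density_dr (t, r, \<omega>) \<partial>sphere_measure)"
    unfolding energy_dt_def flux_dr_def
    using integrable_sphere[OF continuous_on_slices(4)[OF continuous_densities(2) r]] integrable_sphere[OF continuous_on_slices(4)[OF continuous_densities(4) r]]
    by simp
  also have "\<dots> = (\<integral>\<omega>. lapse r * (\<Sum>a\<in>Basis. ?I a \<omega>) \<partial>sphere_measure)"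
    by (rule Bochner_Integration.integral_cong[OF refl]) (use pt in simp)
  also have "\<dots> = lapse r * (\<Sum>a\<in>Basis. \<integral>\<omega>. ?I a \<omega> \<partial>sphere_measure)"
    using intI by (simp del: integral_add)
  also have "\<dots> = 0" by (simp add: I0)
  finally show ?thesis by simp
qed

subsection \<open>Energy bounds along characteristic lines\<close>

lemma lapse_pos: "2 * M < r \<Longrightarrow> 0 < lapse r"
  using M by (simp add: lapse_def)

lemma continuous_on_lapse: "continuous_on {2 * M<..} lapse"
  unfolding lapse_def[abs_def] using M by (intro continuous_intros) auto

lemma continuous_on_energy_over_lapse:
  assumes "2 * M < r0"
  shows "continuous_on {r0..r1} (\<lambda>r. energy t r / lapse r)"
proof (rule continuous_on_divide)
  show "continuous_on {r0..r1} (energy t)"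
  proof -
    have "(\<lambda>r. (t, r)) ` {r0..r1} \<subseteq> UNIV \<times> {2 * M<..}" using assms by auto
    from continuous_on_compose2[OF continuous_on_energies(1) continuous_on_Pair[OF continuous_on_const continuous_on_id] this]
    show ?thesis by simp
  qed
  show "continuous_on {r0..r1} lapse" by (rule continuous_on_subset[OF continuous_on_lapse]) (use assms in auto)
  show "\<forall>r\<in>{r0..r1}. lapse r \<noteq> 0"
  proof
    fix r assume "r \<in> {r0..r1}"
    then have "2 * M < r" using assms by simp
    from lapse_pos[OF this] show "lapse r \<noteq> 0" by simp
  qed
qed

lemma energy_density_nonneg:
  assumes "2 * M < r"
  shows "0 \<le> energy_density (t, r, \<omega>)"
  using lapse_pos[OF assms] assms M unfolding energy_density_def Let_def fst_conv snd_conv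
  by (intro mult_nonneg_nonneg add_nonneg_nonneg sum_nonneg inner_ge_zero zero_le_power2) auto

lemma energy_nonneg: "2 * M < r \<Longrightarrow> 0 \<le> energy t r"
  unfolding energy_def by (intro integral_nonneg_AE AE_I2 energy_density_nonneg)

text \<open>Division by the lapse turns the time derivative of the energy into
  \<open>flux_dr\<close>, so the total changes only by the boundary fluxes, which vanish by
  assumption.\<close>

lemma energy_conserved:
  assumes r: "2 * M < r0" "r0 \<le> r1" and T: "0 \<le> T"
    and flux: "\<And>t. 0 \<le> t \<Longrightarrow> t \<le> T \<Longrightarrow> flux t r0 = 0" "\<And>t. 0 \<le> t \<Longrightarrow> t \<le> T \<Longrightarrow> flux t r1 = 0"
  shows "integral {r0..r1} (\<lambda>r. energy T r / lapse r) = integral {r0..r1} (\<lambda>r. energy 0 r / lapse r)"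
proof -
  have "((\<lambda>t. integral (cbox r0 r1) (\<lambda>r. energy t r / lapse r)) has_derivative (\<lambda>h. 0)) (at t within {0..T})"
    if t: "t \<in> {0..T}" for t
  proof -
    have "((\<lambda>t. integral (cbox r0 r1) (\<lambda>r. energy t r / lapse r)) has_vector_derivative
        integral (cbox r0 r1) (\<lambda>r. energy_dt t r / lapse r)) (at t within {0..T})"
    proof (rule leibniz_rule_vector_derivative)
      show "((\<lambda>t. energy t r / lapse r) has_vector_derivative energy_dt s r / lapse r) (at s within {0..T})"
        if "s \<in> {0..T}" "r \<in> cbox r0 r1" for s r
        using DERIV_cdivide[OF energy_has_derivative[of r s], of "lapse r"] that r
        by (simp add: has_real_derivative_iff_has_vector_derivative has_vector_derivative_at_within)
      show "(\<lambda>r. energy s r / lapse r) integrable_on cbox r0 r1" for s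
        using integrable_continuous_real[OF continuous_on_energy_over_lapse[OF r(1)]] by simp
      show "continuous_on ({0..T} \<times> cbox r0 r1) (\<lambda>(s, r). energy_dt s r / lapse r)"
        unfolding case_prod_unfold
      proof (rule continuous_on_divide)
        show "continuous_on ({0..T} \<times> cbox r0 r1) (\<lambda>q. energy_dt (fst q) (snd q))"
          by (rule continuous_on_subset[OF continuous_on_energies(2)]) (use r in auto)
        show "continuous_on ({0..T} \<times> cbox r0 r1) (\<lambda>q. lapse (snd q))"
          by (rule continuous_on_compose2[OF continuous_on_lapse]) (use r in \<open>auto intro!: continuous_intros\<close>)
        show "\<forall>q\<in>{0..T} \<times> cbox r0 r1. lapse (snd q) \<noteq> 0"
        proof
          fix q assume "q \<in> {0..T} \<times> cbox r0 r1"
          then have "2 * M < snd q" using r by auto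
          from lapse_pos[OF this] show "lapse (snd q) \<noteq> 0" by simp
        qed
      qed
    qed (use t in auto)
    moreover have "integral (cbox r0 r1) (\<lambda>r. energy_dt t r / lapse r) = flux t r1 - flux t r0"
    proof -
      have "(flux_dr t has_integral (flux t r1 - flux t r0)) {r0..r1}"
        by (rule fundamental_theorem_of_calculus[OF r(2)])
          (rule has_vector_derivative_at_within, rule flux_has_derivative[unfolded has_real_derivative_iff_has_vector_derivative],
            use r in simp)
      then have "((\<lambda>r. energy_dt t r / lapse r) has_integral (flux t r1 - flux t r0)) {r0..r1}"
      proof (rule has_integral_eq[rotated])
        fix r assume "r \<in> {r0..r1}"
        then have "2 * M < r" using r by simp
        then show "flux_dr t r = energy_dt t r / lapse r"
          using lapse_pos[of r] by (simp add: energy_flux)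
      qed
      then show ?thesis by (simp add: integral_unique)
    qed
    ultimately show ?thesis using flux[of t] t by (simp add: has_vector_derivative_def)
  qed
  from has_derivative_zero_unique[OF _ this, of T 0] T show ?thesis by simp
qed

definition sqnorm :: "real \<Rightarrow> real \<Rightarrow> real" where
  "sqnorm t r = (\<integral>\<omega>. r\<^sup>2 * (Z (t, r, \<omega>) \<bullet> Z (t, r, \<omega>)) \<partial>sphere_measure)"

definition sqnorm_dr :: "real \<Rightarrow> real \<Rightarrow> real" where
  "sqnorm_dr t r = (\<integral>\<omega>. 2 * r * (Z (t, r, \<omega>) \<bullet> radial (t, r, \<omega>)) \<partial>sphere_measure)"

lemma sqnorm_has_derivative:
  assumes r: "2 * M < r"
  shows "((\<lambda>r. sqnorm t r) has_real_derivative sqnorm_dr t r) (at r)"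
proof -
  let ?F' = "\<lambda>r \<omega>. 2 * r * (Z (t, r, \<omega>) \<bullet> radial (t, r, \<omega>))"
  have "((\<lambda>r. \<integral>\<omega>. r\<^sup>2 * (Z (t, r, \<omega>) \<bullet> Z (t, r, \<omega>)) \<partial>sphere_measure) has_derivative
      (\<lambda>h. \<integral>\<omega>. h * ?F' r \<omega> \<partial>sphere_measure)) (at r)"
  proof (rule has_derivative_sphere_integral[where U = "{2 * M<..}" and F = "\<lambda>r \<omega>. r\<^sup>2 * (Z (t, r, \<omega>) \<bullet> Z (t, r, \<omega>))"
        and F' = "\<lambda>r \<omega> h. h * ?F' r \<omega>"])
    fix r and \<omega> :: "real^3" assume "r \<in> {2 * M<..}" "\<omega> \<in> sphere 0 1"
    then have r: "2 * M < r" "\<omega> \<noteq> 0" by auto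
    note d = has_vector_derivative_Dr[OF smooth_Z r, unfolded has_vector_derivative_def, where t = t and T = UNIV]
    have "((\<lambda>r. r\<^sup>2) has_derivative (\<lambda>h. h * (2 * r))) (at r)"
      by (auto intro!: derivative_eq_intros)
    from has_derivative_mult[OF this has_derivative_inner[OF d d]]
    show "((\<lambda>r. r\<^sup>2 * (Z (t, r, \<omega>) \<bullet> Z (t, r, \<omega>))) has_derivative (\<lambda>h. h * ?F' r \<omega>)) (at r)"
      by (rule has_derivative_eq_rhs)
        (simp add: fun_eq_iff radial_def inner_simps inner_commute power2_eq_square algebra_simps)
  next
    show "continuous_on ({2 * M<..} \<times> sphere 0 1) (\<lambda>(r, \<omega>). h * ?F' r \<omega>)" for h
      using continuous_on_slices(3)[OF continuous_densities(5), of t] continuous_on_slices(3)[OF smooth_on_continuous[OF smooth_Z], of t]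
      unfolding case_prod_unfold by (intro continuous_intros)
    show "continuous_on (sphere 0 1) (\<lambda>\<omega>. r\<^sup>2 * (Z (t, r, \<omega>) \<bullet> Z (t, r, \<omega>)))" if "r \<in> {2 * M<..}" for r
      using that by (intro continuous_intros continuous_on_slices(4)[OF smooth_on_continuous[OF smooth_Z]]) auto
  qed (use r in auto)
  then show ?thesis unfolding has_field_derivative_def sqnorm_def sqnorm_dr_def
    by (rule has_derivative_eq_rhs) (auto simp: mult.commute simp flip: integral_mult_right_zero)
qed

text \<open>Expand the square of z_x - (s / l) z, which is nonnegative, and divide by the lapse; the
  term in z_x is at most twice the energy density. The negative term on the left is what
  differentiating the weight 1 / l will produce.\<close>

lemma sqnorm_derivative_bound:
  assumes r: "2 * M < r" and s: "s\<^sup>2 = 1" and l: "0 < l"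
  shows "s * sqnorm_dr t r / l - sqnorm t r / (l\<^sup>2 * lapse r) \<le> 2 * (energy t r / lapse r)"
proof -
  note f = lapse_pos[OF r]
  have r0: "0 < r" using r M by simp
  have ints: "integrable sphere_measure (\<lambda>\<omega>. 2 * r * (Z (t, r, \<omega>) \<bullet> radial (t, r, \<omega>)))"
    "integrable sphere_measure (\<lambda>\<omega>. r\<^sup>2 * (Z (t, r, \<omega>) \<bullet> Z (t, r, \<omega>)))"
    "integrable sphere_measure (\<lambda>\<omega>. energy_density (t, r, \<omega>))"
    by (intro integrable_sphere continuous_intros continuous_on_slices(4)[OF _ r] continuous_densities smooth_on_continuous[OF smooth_Z])+
  have "s * sqnorm_dr t r / l - sqnorm t r / (l\<^sup>2 * lapse r) =
      (\<integral>\<omega>. s / l * (2 * r * (Z (t, r, \<omega>) \<bullet> radial (t, r, \<omega>))) - 1 / (l\<^sup>2 * lapse r) * (r\<^sup>2 * (Z (t, r, \<omega>) \<bullet> Z (t, r, \<omega>))) \<partial>sphere_measure)"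
    unfolding sqnorm_def sqnorm_dr_def
    by (subst Bochner_Integration.integral_diff) (use ints in simp_all)
  also have "\<dots> \<le> (\<integral>\<omega>. 2 / lapse r * energy_density (t, r, \<omega>) \<partial>sphere_measure)"
  proof (rule integral_mono)
    fix \<omega> :: "real^3"
    let ?z = "Z (t, r, \<omega>)" and ?v = "radial (t, r, \<omega>)"
    define k where "k = s * r / l"
    have "0 \<le> (lapse r *\<^sub>R ?v - k *\<^sub>R ?z) \<bullet> (lapse r *\<^sub>R ?v - k *\<^sub>R ?z)" by simp
    also have "\<dots> = (lapse r)\<^sup>2 * (?v \<bullet> ?v) - lapse r * (2 * k * (?z \<bullet> ?v)) + k\<^sup>2 * (?z \<bullet> ?z)"
      by (simp add: inner_diff_left inner_diff_right inner_commute power2_eq_square algebra_simps)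
    finally have "0 \<le> ((lapse r)\<^sup>2 * (?v \<bullet> ?v) - lapse r * (2 * k * (?z \<bullet> ?v)) + k\<^sup>2 * (?z \<bullet> ?z)) / lapse r"
      using f by simp
    also have "\<dots> = lapse r * (?v \<bullet> ?v) - 2 * k * (?z \<bullet> ?v) + k\<^sup>2 * (?z \<bullet> ?z) / lapse r"
      using f by (simp add: add_divide_distrib diff_divide_distrib power2_eq_square)
    also have "2 * k * (?z \<bullet> ?v) = s / l * (2 * r * (?z \<bullet> ?v))" by (simp add: k_def)
    also have "k\<^sup>2 * (?z \<bullet> ?z) / lapse r = 1 / (l\<^sup>2 * lapse r) * (r\<^sup>2 * (?z \<bullet> ?z))"
      by (simp add: k_def power_divide power_mult_distrib s)
    finally have 1: "s / l * (2 * r * (?z \<bullet> ?v)) - 1 / (l\<^sup>2 * lapse r) * (r\<^sup>2 * (?z \<bullet> ?z)) \<le> lapse r * (?v \<bullet> ?v)"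
      by simp
    have "(lapse r)\<^sup>2 * (?v \<bullet> ?v) \<le> 2 * energy_density (t, r, \<omega>)"
    proof -
      have "0 \<le> r\<^sup>2 * (Dt Z (t, r, \<omega>) \<bullet> Dt Z (t, r, \<omega>))" "0 \<le> lapse r * (2 * M / r) * (?z \<bullet> ?z)"
        "0 \<le> lapse r * (\<Sum>a\<in>Basis. angular a Z (t, r, \<omega>) \<bullet> angular a Z (t, r, \<omega>))"
        using f r0 M by (intro mult_nonneg_nonneg sum_nonneg inner_ge_zero zero_le_power2; simp)+
      then show ?thesis by (simp add: energy_density_def Let_def)
    qed
    then have "lapse r * (?v \<bullet> ?v) \<le> 2 / lapse r * energy_density (t, r, \<omega>)"
      using f by (simp add: field_simps power2_eq_square)
    with 1 show "s / l * (2 * r * (?z \<bullet> ?v)) - 1 / (l\<^sup>2 * lapse r) * (r\<^sup>2 * (?z \<bullet> ?z)) \<le> 2 / lapse r * energy_density (t, r, \<omega>)"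
      by linarith
  qed (use ints in auto)
  also have "\<dots> = 2 * (energy t r / lapse r)" by (simp add: energy_def)
  finally show ?thesis .
qed

text \<open>
  Dividing by the weight before differentiating replaces the Cauchy--Schwarz inequality for
  \<open>z(x) = \<integral> z\<^sub>x\<close>: the growth is linear in the distance \<open>|x - x\<^sub>0|\<close>. The sign \<open>s\<close> selects the
  direction in which one leaves the zero set of \<open>z\<close>.
\<close>

lemma sqnorm_weighted_bound:
  assumes r: "2 * M < r0" "r0 \<le> r1" and s: "s\<^sup>2 = 1"
    and l: "\<And>r. r0 \<le> r \<Longrightarrow> r \<le> r1 \<Longrightarrow> 0 < 1 + s * (tortoise M r - x0)"
  shows "s * sqnorm t r1 / (1 + s * (tortoise M r1 - x0)) - s * sqnorm t r0 / (1 + s * (tortoise M r0 - x0))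
    \<le> 2 * integral {r0..r1} (\<lambda>r. energy t r / lapse r)"
proof -
  let ?l = "\<lambda>r. 1 + s * (tortoise M r - x0)"
  let ?N' = "\<lambda>r. s * sqnorm_dr t r / ?l r - sqnorm t r / ((?l r)\<^sup>2 * lapse r)"
  have N': "((\<lambda>r. s * sqnorm t r / ?l r) has_real_derivative ?N' r) (at r)" if "r \<in> {r0..r1}" for r
  proof -
    have r': "2 * M < r" and lr: "0 < ?l r" using that r l by auto
    have "(tortoise M has_real_derivative 1 / lapse r) (at r)"
      using tortoise_has_derivative[OF r'] by (simp add: lapse_def)
    then have dl: "(?l has_real_derivative s * (1 / lapse r)) (at r)"
      by (auto intro!: derivative_eq_intros)
    have "((\<lambda>r. s * sqnorm t r / ?l r) has_real_derivative
        (s * sqnorm_dr t r * ?l r - s * sqnorm t r * (s * (1 / lapse r))) / (?l r * ?l r)) (at r)"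
      by (rule DERIV_divide[OF DERIV_cmult[OF sqnorm_has_derivative[OF r']] dl]) (use lr in simp)
    moreover have "(s * sqnorm_dr t r * ?l r - s * sqnorm t r * (s * (1 / lapse r))) / (?l r * ?l r) = ?N' r"
    proof -
      define L where "L = ?l r"
      have "s * sqnorm t r * (s * (1 / lapse r)) = s\<^sup>2 * sqnorm t r / lapse r" by (simp add: power2_eq_square)
      also have "\<dots> = sqnorm t r / lapse r" by (simp add: s)
      finally show ?thesis using lr unfolding L_def[symmetric]
        by (simp add: diff_divide_distrib power2_eq_square mult.commute)
    qed
    ultimately show ?thesis by simp
  qed
  have "(?N' has_integral (s * sqnorm t r1 / ?l r1 - s * sqnorm t r0 / ?l r0)) {r0..r1}"
    by (rule fundamental_theorem_of_calculus[OF r(2)])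
      (rule has_vector_derivative_at_within, rule N'[unfolded has_real_derivative_iff_has_vector_derivative])
  moreover have "((\<lambda>r. 2 * (energy t r / lapse r)) has_integral 2 * integral {r0..r1} (\<lambda>r. energy t r / lapse r)) {r0..r1}"
    using integrable_integral[OF integrable_continuous_real[OF continuous_on_energy_over_lapse[OF r(1)]]]
    by (rule has_integral_mult_right)
  ultimately show ?thesis
  proof (rule has_integral_le)
    fix r assume "r \<in> {r0..r1}"
    then show "?N' r \<le> 2 * (energy t r / lapse r)"
      using r l by (intro sqnorm_derivative_bound s) auto
  qed
qed

context
  fixes a b :: real
  assumes ab: "a \<le> b" and supp: "\<And>x \<omega>. x < a \<or> b < x \<Longrightarrow> \<omega> \<in> sphere 0 1 \<Longrightarrow> \<psi> (radius M x) \<omega> = 0"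
begin

lemma Z_zero_outside:
  assumes t: "0 \<le> t" and x: "t + x < a \<or> b < x - t" and \<omega>: "\<omega> \<in> sphere 0 1"
  shows "Z (t, radius M x, \<omega>) = 0"
  using x
proof
  assume "t + x < a"
  then show ?thesis
    by (intro Z_domain_of_dependence[of x "a - x"] t \<omega> supp) auto
next
  assume "b < x - t"
  then show ?thesis
    by (intro Z_domain_of_dependence[of x "x - b"] t \<omega> supp) auto
qed

lemma sqnorm_zero_outside:
  assumes "0 \<le> t" "t + x < a \<or> b < x - t"
  shows "sqnorm t (radius M x) = 0"
proof -
  have "sqnorm t (radius M x) = (\<integral>\<omega>. 0 \<partial>sphere_measure)"
    unfolding sqnorm_def
    by (rule Bochner_Integration.integral_cong[OF refl]) (use Z_zero_outside[OF assms] in simp)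
  then show ?thesis by simp
qed

lemma flux_zero_outside:
  assumes t: "0 \<le> t" and x: "t + x < a \<or> b < x - t"
  shows "flux t (radius M x) = 0"
proof -
  have r: "2 * M < radius M x" by (rule radius(1)[OF M])
  have "Dt Z (t, radius M x, \<omega>) = 0" if \<omega>: "\<omega> \<in> sphere 0 1" for \<omega>
  \<comment> \<open>\<open>Z\<close> is known to vanish for nonnegative times only, so at t = 0
    there is no neighbourhood to differentiate in; the initial condition takes over.\<close>
  proof (cases "t = 0")
    case True
    then show ?thesis using Dt_Z_initial[OF r \<omega>] by simp
  next
    case False
    define S where "S = {0<..} \<inter> {s. s + x < a \<or> b < x - s}"
    have "open S" unfolding S_def
      by (intro open_Int open_greaterThan open_Collect_disj open_Collect_less continuous_intros)
    then have "\<forall>\<^sub>F s in nhds t. s \<in> S"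
      using t x False by (intro eventually_nhds_in_open) (auto simp: S_def)
    then have "\<forall>\<^sub>F s in nhds t. Z (s, radius M x, \<omega>) = 0"
      by eventually_elim (auto simp: S_def intro!: Z_zero_outside \<omega>)
    moreover have "\<omega> \<noteq> 0" using \<omega> by auto
    ultimately show ?thesis
      using derivative_zero_if_locally_zero[OF has_vector_derivative_Dt[OF smooth_Z r]] by blast
  qed
  then have "flux t (radius M x) = (\<integral>\<omega>. 0 \<partial>sphere_measure)"
    unfolding flux_def flux_density_def
    by (intro Bochner_Integration.integral_cong[OF refl]) simp
  then show ?thesis by simp
qed

lemma initial_energy_zero_outside:
  assumes x: "x < a \<or> b < x"
  shows "energy 0 (radius M x) = 0"
proof -
  let ?r = "radius M x"
  have r: "2 * M < ?r" by (rule radius(1)[OF M])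
  define S where "S = {2 * M<..<radius M a} \<union> {radius M b<..}"
  have S: "open S" "?r \<in> S" "S \<subseteq> {2 * M<..}"
    using x radius_less_iff[OF M] r radius(1)[OF M, of b] by (auto simp: S_def)
  have zero: "Z (0, r', y) = 0" if r': "r' \<in> S" and y: "y \<noteq> 0" for r' y
  proof -
    have rM: "2 * M < r'" using r' S by auto
    have sg: "sgn y \<in> sphere 0 1" using y by (simp add: norm_sgn)
    define x' where "x' = tortoise M r'"
    have x': "r' = radius M x'" using radius_tortoise[OF M rM] by (simp add: x'_def)
    have "x' < a \<or> b < x'" using r' by (auto simp: S_def x' radius_less_iff[OF M])
    then have "\<psi> r' (sgn y) = 0" unfolding x' using supp sg by blast
    then have "Z (0, r', sgn y) = 0" using Z_initial[OF rM sg] by simp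
    moreover have "Z (0, r', inverse (norm y) *\<^sub>R y) = Z (0, r', y)"
      using y by (intro hom_Z rM) auto
    ultimately show ?thesis by (simp add: sgn_div_norm)
  qed
  have "energy_density (0, ?r, \<omega>) = 0" if \<omega>: "\<omega> \<in> sphere 0 1" for \<omega>
  proof -
    have "\<omega> \<noteq> 0" using \<omega> by auto
    then show ?thesis
      using locally_zero_derivatives[OF smooth_Z S zero, of \<omega>] zero[OF S(2)] Dt_Z_initial[OF r \<omega>]
      by (simp add: energy_density_def radial_def angular_def Let_def)
  qed
  then have "energy 0 ?r = (\<integral>\<omega>. 0 \<partial>sphere_measure)"
    unfolding energy_def by (intro Bochner_Integration.integral_cong[OF refl]) simp
  then show ?thesis by simp
qed

text \<open>Both end points stay outside the light cone of the support up to time t, so no energy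
  crosses them. The value is therefore independent of \<open>t\<close>, \<open>x0\<close> and
  \<open>x1\<close>.\<close>

lemma total_energy:
  assumes t: "0 \<le> t" and x: "x0 < a - t" "b + t < x1"
  shows "integral {radius M x0..radius M x1} (\<lambda>r. energy t r / lapse r)
    = integral {radius M a..radius M b} (\<lambda>r. energy 0 r / lapse r)"
proof -
  have le: "radius M y \<le> radius M z" if "y \<le> z" for y z
    using that radius_less_iff[OF M, of y z] by (cases "y = z") auto
  have "integral {radius M x0..radius M x1} (\<lambda>r. energy t r / lapse r) = integral {radius M x0..radius M x1} (\<lambda>r. energy 0 r / lapse r)"
    by (rule energy_conserved[OF radius(1)[OF M] _ t]) (use ab x t in \<open>auto intro!: le flux_zero_outside\<close>)
  also have "\<dots> = integral {radius M a..radius M b} (\<lambda>r. energy 0 r / lapse r)"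
  proof (rule integral_unique)
    let ?e = "\<lambda>r. energy 0 r / lapse r"
    let ?S = "{radius M a..radius M b}" and ?T = "{radius M x0..radius M x1}"
    have sub: "?S \<subseteq> ?T" using x t by (auto intro: order_trans le)
    have zero: "?e r = 0" if r: "r \<in> ?T" "r \<notin> ?S" for r
    proof -
      have "2 * M < r" using r radius(1)[OF M, of x0] by auto
      then have eq: "r = radius M (tortoise M r)" by (simp add: radius_tortoise[OF M])
      then have "tortoise M r < a \<or> b < tortoise M r"
        using r(2) radius_less_iff[OF M] by (metis atLeastAtMost_iff linorder_not_less)
      from initial_energy_zero_outside[OF this] eq show ?thesis by simp
    qed
    have "(?e has_integral integral ?S ?e) ?S"
      by (intro integrable_integral integrable_continuous_real continuous_on_energy_over_lapse radius(1)[OF M])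
    then have "((\<lambda>r. if r \<in> ?T then ?e r else 0) has_integral integral ?S ?e) ?S"
      by (rule has_integral_eq[rotated]) (use sub in auto)
    then have "((\<lambda>r. if r \<in> ?T then ?e r else 0) has_integral integral ?S ?e) ?T"
      by (rule has_integral_on_superset) (use zero sub in auto)
    then show "(?e has_integral integral ?S ?e) ?T"
      by (rule has_integral_eq[rotated]) auto
  qed
  finally show ?thesis .
qed

text \<open>One bound for each end: the first is constant along t + x = const, the incoming lines
  towards the horizon, and the second along t - x = const, the outgoing lines towards null
  infinity.\<close>

lemma sqnorm_bound:
  obtains E where "0 \<le> E"
    "\<And>t x. 0 \<le> t \<Longrightarrow> sqnorm t (radius M x) \<le> E * (2 + \<bar>t + x - a\<bar>)"
    "\<And>t x. 0 \<le> t \<Longrightarrow> sqnorm t (radius M x) \<le> E * (2 + \<bar>b + t - x\<bar>)"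
proof -
  define E where "E = 2 * integral {radius M a..radius M b} (\<lambda>r. energy 0 r / lapse r)"
  have le: "radius M y \<le> radius M z \<longleftrightarrow> y \<le> z" for y z
    using radius_less_iff[OF M, of z y] by (simp add: linorder_not_less[symmetric])
  have pos: "0 \<le> energy t r / lapse r" if "2 * M < r" for t r
    using energy_nonneg[OF that] lapse_pos[OF that] by (intro divide_nonneg_nonneg) auto
  have E: "0 \<le> E"
    unfolding E_def using radius(1)[OF M, of a]
    by (intro mult_nonneg_nonneg integral_nonneg pos integrable_continuous_real continuous_on_energy_over_lapse) auto
  have mono: "2 * integral {r0..r1} (\<lambda>r. energy t r / lapse r) \<le> E"
    if t: "0 \<le> t" and x: "x0 < a - t" "b + t < x1" and sub: "{r0..r1} \<subseteq> {radius M x0..radius M x1}" "2 * M < r0" for t x0 x1 r0 r1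
  proof -
    have "integral {r0..r1} (\<lambda>r. energy t r / lapse r) \<le> integral {radius M x0..radius M x1} (\<lambda>r. energy t r / lapse r)"
      by (intro integral_subset_le sub integrable_continuous_real continuous_on_energy_over_lapse radius(1)[OF M] ballI pos)
        (use radius(1)[OF M, of x0] in auto)
    then show ?thesis unfolding total_energy[OF t x] E_def by simp
  qed
  have "sqnorm t (radius M x) \<le> E * (2 + \<bar>t + x - a\<bar>)" if t: "0 \<le> t" for t x
  proof (cases "t + x < a")
    case True
    then show ?thesis using sqnorm_zero_outside[OF t] E by simp
  next
    case False
    \<comment> \<open>One unit outside the light cone, where \<open>sqnorm\<close> vanishes; the
      weight at \<open>x\<close> is then 2 + (t + x - a). The point \<open>x1\<close> only enlarges
      the interval until it carries the total energy.\<close>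
    define x0 where "x0 = a - t - 1"
    define x1 where "x1 = max x (b + t + 1)"
    have tx: "x0 \<le> x" using False by (simp add: x0_def)
    have "1 * sqnorm t (radius M x) / (1 + 1 * (tortoise M (radius M x) - x0)) - 1 * sqnorm t (radius M x0) / (1 + 1 * (tortoise M (radius M x0) - x0))
      \<le> 2 * integral {radius M x0..radius M x} (\<lambda>r. energy t r / lapse r)"
    proof (rule sqnorm_weighted_bound[OF radius(1)[OF M]])
      fix r assume "radius M x0 \<le> r"
      then have "tortoise M (radius M x0) \<le> tortoise M r"
        using tortoise_strict_mono[OF M radius(1)[OF M], of x0 r] by (cases "radius M x0 = r") auto
      then show "0 < 1 + 1 * (tortoise M r - x0)" by (simp add: tortoise_radius[OF M])
    qed (use tx le in auto)
    also have "\<dots> \<le> E"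
      by (rule mono[OF t, of x0 x1]) (auto simp: x0_def x1_def le radius(1)[OF M] intro: order_trans)
    also have "sqnorm t (radius M x0) = 0" by (rule sqnorm_zero_outside[OF t]) (simp add: x0_def)
    finally have "sqnorm t (radius M x) / (2 + (t + x - a)) \<le> E"
      by (simp add: tortoise_radius[OF M] x0_def algebra_simps)
    then show ?thesis using False by (simp add: divide_le_eq)
  qed
  moreover have "sqnorm t (radius M x) \<le> E * (2 + \<bar>b + t - x\<bar>)" if t: "0 \<le> t" for t x
  proof (cases "b < x - t")
    case True
    then show ?thesis using sqnorm_zero_outside[OF t] E by simp
  next
    case False
    \<comment> \<open>The mirror image: now \<open>x1\<close> is the point where
      \<open>sqnorm\<close> vanishes, and \<open>x0\<close> enlarges the interval.\<close>
    define x0 where "x0 = min x (a - t - 1)"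
    define x1 where "x1 = b + t + 1"
    have tx: "x \<le> x1" using False by (simp add: x1_def)
    have "- 1 * sqnorm t (radius M x1) / (1 + - 1 * (tortoise M (radius M x1) - x1)) - - 1 * sqnorm t (radius M x) / (1 + - 1 * (tortoise M (radius M x) - x1))
      \<le> 2 * integral {radius M x..radius M x1} (\<lambda>r. energy t r / lapse r)"
    proof (rule sqnorm_weighted_bound[OF radius(1)[OF M]])
      fix r assume r: "radius M x \<le> r" "r \<le> radius M x1"
      then have "2 * M < r" using radius(1)[OF M, of x] by simp
      then have "tortoise M r \<le> tortoise M (radius M x1)"
        using r(2) tortoise_strict_mono[OF M, of r "radius M x1"] by (cases "r = radius M x1") auto
      then show "0 < 1 + - 1 * (tortoise M r - x1)" by (simp add: tortoise_radius[OF M])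
    qed (use tx le in auto)
    also have "\<dots> \<le> E"
      by (rule mono[OF t, of x0 x1]) (auto simp: x0_def x1_def le radius(1)[OF M] intro: order_trans)
    also have "sqnorm t (radius M x1) = 0" by (rule sqnorm_zero_outside[OF t]) (simp add: x1_def)
    finally have "sqnorm t (radius M x) / (2 + (b + t - x)) \<le> E"
      by (simp add: tortoise_radius[OF M] x1_def algebra_simps)
    then show ?thesis using False by (simp add: divide_le_eq)
  qed
  ultimately show ?thesis using that E by blast
qed

end

subsection \<open>Vanishing radiation fields\<close>

lemma integrable_Y:
  "integrable sphere_measure (\<lambda>\<omega>. (\<omega> \<bullet> \<xi>) ^ n *\<^sub>R (radius M x *\<^sub>R Z (t, radius M x, \<omega>)))"
  "integrable sphere_measure (\<lambda>\<omega>. ((\<omega> \<bullet> \<xi>) ^ n)\<^sup>2)"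
  "integrable sphere_measure (\<lambda>\<omega>. (radius M x)\<^sup>2 * (Z (t, radius M x, \<omega>) \<bullet> Z (t, radius M x, \<omega>)))"
  by (intro integrable_sphere continuous_intros continuous_on_sphere_angular(1)[OF smooth_Z radius(1)[OF M]])+

lemma Y_eq_integral:
  "Y \<xi> n t x = (\<integral>\<omega>. (\<omega> \<bullet> \<xi>) ^ n *\<^sub>R (radius M x *\<^sub>R Z (t, radius M x, \<omega>)) \<partial>sphere_measure)"
proof -
  have "Y \<xi> n t x = (\<integral>\<omega>. radius M x *\<^sub>R ((\<omega> \<bullet> \<xi>) ^ n *\<^sub>R Z (t, radius M x, \<omega>)) \<partial>sphere_measure)"
    unfolding Y_def moment_def by (rule integral_scaleR_right[symmetric])
  then show ?thesis by (simp add: mult.commute)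
qed

text \<open>The inequality 2 |a b| \<le> a^2 + b^2 under the integral takes the place of
  Cauchy-Schwarz; any finite bound serves the purpose.\<close>

lemma norm_Y_le:
  "norm (Y \<xi> n t x) \<le> ((\<integral>\<omega>. ((\<omega> \<bullet> \<xi>) ^ n)\<^sup>2 \<partial>sphere_measure) + sqnorm t (radius M x)) / 2"
proof -
  have "norm (Y \<xi> n t x) \<le> (\<integral>\<omega>. (((\<omega> \<bullet> \<xi>) ^ n)\<^sup>2 + (radius M x)\<^sup>2 * (Z (t, radius M x, \<omega>) \<bullet> Z (t, radius M x, \<omega>))) / 2 \<partial>sphere_measure)"
    unfolding Y_eq_integral
  proof (rule Bochner_Integration.integral_norm_bound_integral[OF integrable_Y(1)])
    show "integrable sphere_measure (\<lambda>\<omega>. (((\<omega> \<bullet> \<xi>) ^ n)\<^sup>2 + (radius M x)\<^sup>2 * (Z (t, radius M x, \<omega>) \<bullet> Z (t, radius M x, \<omega>))) / 2)"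
      using integrable_Y(2,3) by simp
    fix \<omega> :: "real^3"
    have "2 * \<bar>(\<omega> \<bullet> \<xi>) ^ n\<bar> * norm (radius M x *\<^sub>R Z (t, radius M x, \<omega>)) \<le> \<bar>(\<omega> \<bullet> \<xi>) ^ n\<bar>\<^sup>2 + (norm (radius M x *\<^sub>R Z (t, radius M x, \<omega>)))\<^sup>2"
      by (rule sum_squares_bound)
    then show "norm ((\<omega> \<bullet> \<xi>) ^ n *\<^sub>R (radius M x *\<^sub>R Z (t, radius M x, \<omega>)))
        \<le> (((\<omega> \<bullet> \<xi>) ^ n)\<^sup>2 + (radius M x)\<^sup>2 * (Z (t, radius M x, \<omega>) \<bullet> Z (t, radius M x, \<omega>))) / 2"
      by (simp add: power_mult_distrib dot_square_norm abs_mult mult_ac)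
  qed
  then show ?thesis using integrable_Y(2,3) by (simp add: sqnorm_def)
qed

lemma Y_tendsto_0:
  fixes t x :: "real \<Rightarrow> real"
  assumes lim: "\<And>\<omega>. \<omega> \<in> sphere 0 1 \<Longrightarrow> ((\<lambda>s. radius M (x s) *\<^sub>R Z (t s, radius M (x s), \<omega>)) \<longlongrightarrow> 0) at_top"
    and bd: "\<forall>\<^sub>F s in at_top. sqnorm (t s) (radius M (x s)) \<le> C"
  shows "((\<lambda>s. Y \<xi> n (t s) (x s)) \<longlongrightarrow> 0) at_top"
proof -
  let ?F = "\<lambda>s \<omega>. (\<omega> \<bullet> \<xi>) ^ n *\<^sub>R (radius M (x s) *\<^sub>R Z (t s, radius M (x s), \<omega>))"
  show ?thesis
    unfolding Y_eq_integral
  proof (rule sphere_integral_tendsto_0[where F = ?F])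
    show "continuous_on (sphere 0 1) (?F s)" for s
      by (intro continuous_intros continuous_on_sphere_angular(1)[OF smooth_Z radius(1)[OF M]])
    show "((\<lambda>s. ?F s \<omega>) \<longlongrightarrow> 0) at_top" if "\<omega> \<in> sphere 0 1" for \<omega>
      using tendsto_scaleR[OF tendsto_const lim[OF that], of "(\<omega> \<bullet> \<xi>) ^ n"] by simp
    show "\<forall>\<^sub>F s in at_top. (\<integral>\<omega>. (norm (?F s \<omega>))\<^sup>2 \<partial>sphere_measure)
        \<le> (norm \<xi> ^ n)\<^sup>2 * C"
      using bd
    proof eventually_elim
      case (elim s)
      let ?z = "\<lambda>\<omega>. (radius M (x s))\<^sup>2 * (Z (t s, radius M (x s), \<omega>) \<bullet> Z (t s, radius M (x s), \<omega>))"
      have "(\<integral>\<omega>. (norm (?F s \<omega>))\<^sup>2 \<partial>sphere_measure)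
          \<le> (\<integral>\<omega>. (norm \<xi> ^ n)\<^sup>2 * ?z \<omega> \<partial>sphere_measure)"
      proof (rule integral_mono)
        show "integrable sphere_measure (\<lambda>\<omega>. (norm (?F s \<omega>))\<^sup>2)"
          by (intro integrable_sphere continuous_intros continuous_on_sphere_angular(1)[OF smooth_Z radius(1)[OF M]])
        show "integrable sphere_measure (\<lambda>\<omega>. (norm \<xi> ^ n)\<^sup>2 * ?z \<omega>)"
          using integrable_Y(3) by simp
        fix \<omega> :: "real^3" assume "\<omega> \<in> space sphere_measure"
        then have "\<bar>\<omega> \<bullet> \<xi>\<bar> \<le> norm \<xi>" using Cauchy_Schwarz_ineq2[of \<omega> \<xi>] by simp
        then have "\<bar>(\<omega> \<bullet> \<xi>) ^ n\<bar> \<le> norm \<xi> ^ n" by (simp add: power_abs power_mono)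
        then have "((\<omega> \<bullet> \<xi>) ^ n)\<^sup>2 \<le> (norm \<xi> ^ n)\<^sup>2" using power_mono[of "\<bar>(\<omega> \<bullet> \<xi>) ^ n\<bar>" _ 2] by simp
        then have "((\<omega> \<bullet> \<xi>) ^ n)\<^sup>2 * ?z \<omega> \<le> (norm \<xi> ^ n)\<^sup>2 * ?z \<omega>" by (intro mult_right_mono) auto
        then show "(norm (?F s \<omega>))\<^sup>2 \<le> (norm \<xi> ^ n)\<^sup>2 * ?z \<omega>"
          by (simp add: power_mult_distrib dot_square_norm mult.assoc)
      qed
      also have "\<dots> = (norm \<xi> ^ n)\<^sup>2 * sqnorm (t s) (radius M (x s))"
        by (simp add: sqnorm_def)
      also have "\<dots> \<le> (norm \<xi> ^ n)\<^sup>2 * C" using elim by (intro mult_left_mono) auto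
      finally show ?case .
    qed
  qed
qed

lemma initial_data_zero_if_Y_zero:
  assumes "\<And>\<xi> n t x. Y \<xi> n t x = 0" and r: "2 * M < r" and \<omega>: "\<omega> \<in> sphere 0 1"
  shows "\<psi> r \<omega> = 0"
  using Z_eq_0_if_Y[OF assms(1) \<omega>, of 0 "tortoise M r"] Z_initial[OF r \<omega>] radius_tortoise[OF M r] by simp

text \<open>In the tortoise coordinate the limit runs along t + x = v. The factor r, absent from the
  field at the horizon, converges to 2 M; at null infinity it belongs to the radiation field
  itself.\<close>

lemma horizon_tendsto:
  assumes rad: "has_horizon_radiation_field M u (\<lambda>_ _. 0)" and \<omega>: "\<omega> \<in> sphere 0 1"
  shows "((\<lambda>s. radius M (- s) *\<^sub>R Z (v + s, radius M (- s), \<omega>)) \<longlongrightarrow> 0) at_top"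
proof -
  have rl: "filterlim (\<lambda>s. radius M (- s)) (at_right (2 * M)) at_top"
    by (rule filterlim_compose[OF filterlim_radius_at_bot[OF M] filterlim_uminus_at_bot_at_top])
  have "((\<lambda>r. D (\<lambda>s. u s r \<omega>) (v - r - 2 * M * ln (r - 2 * M))) \<longlongrightarrow> 0) (at_right (2 * M))"
    using rad \<omega> unfolding has_horizon_radiation_field_def by blast
  from filterlim_compose[OF this rl]
  have "((\<lambda>s. Z (v - radius M (- s) - 2 * M * ln (radius M (- s) - 2 * M), radius M (- s), \<omega>)) \<longlongrightarrow> 0) at_top"
    by (simp add: D_u[OF radius(1)[OF M] \<omega>])
  moreover have "v - radius M (- s) - 2 * M * ln (radius M (- s) - 2 * M) = v + s" for s
    using tortoise_radius[OF M, of "- s"] by (simp add: tortoise_def)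
  ultimately have "((\<lambda>s. Z (v + s, radius M (- s), \<omega>)) \<longlongrightarrow> 0) at_top" by simp
  from tendsto_scaleR[OF filterlim_mono[OF rl at_le[OF subset_UNIV, THEN order_trans[OF _ at_within_le_nhds]] order_refl] this]
  show ?thesis by simp
qed

lemma null_infinity_tendsto:
  assumes rad: "has_null_infinity_radiation_field M u (\<lambda>_ _. 0)" and \<omega>: "\<omega> \<in> sphere 0 1"
  shows "((\<lambda>s. radius M s *\<^sub>R Z (v + s, radius M s, \<omega>)) \<longlongrightarrow> 0) at_top"
proof -
  have "((\<lambda>r. r *\<^sub>R D (\<lambda>s. u s r \<omega>) (v + r + 2 * M * ln (r - 2 * M))) \<longlongrightarrow> 0) at_top"
    using rad \<omega> unfolding has_null_infinity_radiation_field_def by blast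
  from filterlim_compose[OF this filterlim_radius_at_top[OF M]]
  have "((\<lambda>s. radius M s *\<^sub>R Z (v + radius M s + 2 * M * ln (radius M s - 2 * M), radius M s, \<omega>)) \<longlongrightarrow> 0) at_top"
    by (simp add: D_u[OF radius(1)[OF M] \<omega>])
  moreover have "v + radius M s + 2 * M * ln (radius M s - 2 * M) = v + s" for s
    using tortoise_radius[OF M, of s] by (simp add: tortoise_def)
  ultimately show ?thesis by simp
qed

text \<open>Substituting r for x, the majorant of the potential integrates to - N / r and then to a
  logarithm. The first primitive is bounded by its size at the horizon; the second is unbounded at
  both ends.\<close>

lemma potential_primitives:
  fixes n :: nat
  defines "N \<equiv> 1 + real n * (real n + 1)"
  shows "((\<lambda>x. - N / radius M x) has_real_derivative N * ((radius M x - 2 * M) / radius M x ^ 3)) (at x)"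
    and "((\<lambda>x. - N * ln (radius M x - 2 * M)) has_real_derivative - N / radius M x) (at x)"
    and "\<bar>- N / radius M x\<bar> \<le> N / (2 * M)"
proof -
  note r = radius(1)[OF M, of x] and d = radius_has_derivative[OF M, of x]
  have r0: "0 < radius M x" using r M by simp
  have N: "0 < N" unfolding N_def by (intro add_pos_nonneg mult_nonneg_nonneg) auto
  show "((\<lambda>x. - N / radius M x) has_real_derivative N * ((radius M x - 2 * M) / radius M x ^ 3)) (at x)"
    using r0 by (auto intro!: derivative_eq_intros d simp: power3_eq_cube power2_eq_square field_simps)
  show "((\<lambda>x. - N * ln (radius M x - 2 * M)) has_real_derivative - N / radius M x) (at x)"
    using r r0 by (auto intro!: derivative_eq_intros d simp: field_simps)
  show "\<bar>- N / radius M x\<bar> \<le> N / (2 * M)"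
    using N r r0 M by (simp add: abs_mult frac_le)
qed

context
  fixes a b :: real
  assumes ab: "a \<le> b" and supp: "\<And>x \<omega>. x < a \<or> b < x \<Longrightarrow> \<omega> \<in> sphere 0 1 \<Longrightarrow> \<psi> (radius M x) \<omega> = 0"
begin

lemma Y_zero_outside:
  assumes "0 \<le> t" "t + x < a \<or> b < x - t"
  shows "Y \<xi> n t x = 0"
proof -
  have "Y \<xi> n t x = (\<integral>\<omega>. 0 \<partial>sphere_measure)"
    unfolding Y_eq_integral
    by (rule Bochner_Integration.integral_cong[OF refl]) (use Z_zero_outside[OF ab supp assms] in simp)
  then show ?thesis by simp
qed

lemma Y_zero_if_horizon:
  assumes rad: "has_horizon_radiation_field M u (\<lambda>_ _. 0)"
  shows "Y \<xi> n t x = 0"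
proof (induction n arbitrary: t x rule: less_induct)
  case (less n)
  obtain Yt Yx Ytt Ytx Yxx where J: "C2_jet (Y \<xi> n) Yt Yx Ytt Ytx Yxx"
    and Yt: "\<And>t x. Yt t x = radius M x *\<^sub>R moment \<xi> n (Dt Z) t (radius M x)"
    and pde: "\<And>t x. Ytt t x - Yxx t x = - (potential n x *\<^sub>R Y \<xi> n t x) +
      ((radius M x - 2 * M) / radius M x ^ 3 * (n * (n - 1)) * (\<xi> \<bullet> \<xi>)) *\<^sub>R Y \<xi> (n - 2) t x"
    using Y_jet[of \<xi> n] by blast
  obtain E where E: "0 \<le> E" "\<And>t x. 0 \<le> t \<Longrightarrow> sqnorm t (radius M x) \<le> E * (2 + \<bar>t + x - a\<bar>)"
    by (rule sqnorm_bound[OF ab supp]) auto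
  note P = potential_primitives[of n]
  show ?case
  proof (rule wave_zero_if_radiation_zero[OF J _ continuous_potential _ P(1) P(3) P(2), where a = a])
    fix t x
    have "real (n * (n - 1)) *\<^sub>R Y \<xi> (n - 2) t x = 0"
    proof (cases "n < 2")
      case True
      then show ?thesis by (auto simp: less_2_cases_iff)
    next
      case False
      then show ?thesis using less.IH[of "n - 2"] by simp
    qed
    then show "Ytt t x - Yxx t x = - (potential n x *\<^sub>R Y \<xi> n t x)" by (auto simp: pde)
  next
    show "\<bar>potential n x\<bar> \<le> (1 + real n * (real n + 1)) * ((radius M x - 2 * M) / radius M x ^ 3)" for x
      by (rule potential_bound)
    show "Yt 0 x = 0" for x by (simp add: Yt moment_Dt_initial)
    show "Y \<xi> n 0 x = 0" if "x < a" for x using that by (intro Y_zero_outside) auto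
  next
    fix v
    let ?I = "\<integral>\<omega>. ((\<omega> \<bullet> \<xi>) ^ n)\<^sup>2 \<partial>sphere_measure"
    have "norm (Y \<xi> n t x) \<le> (?I + E * (2 + \<bar>v - a\<bar>)) / 2" if t: "0 \<le> t" "t + x \<le> v" for t x
    \<comment> \<open>Below \<open>a\<close> the bound |t + x - a| is not controlled by
      \<open>v\<close>, but there the moment vanishes.\<close>
    proof (cases "t + x < a")
      case True
      have "0 \<le> ?I" by simp
      then show ?thesis using Y_zero_outside[of t x] True t E(1) by simp
    next
      case False
      have "sqnorm t (radius M x) \<le> E * (2 + \<bar>t + x - a\<bar>)" by (rule E(2)[OF t(1)])
      also have "\<dots> \<le> E * (2 + \<bar>v - a\<bar>)" using False t E(1) by (intro mult_left_mono) auto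
      finally have "(?I + sqnorm t (radius M x)) / 2 \<le> (?I + E * (2 + \<bar>v - a\<bar>)) / 2" by simp
      with norm_Y_le show ?thesis by (rule order_trans)
    qed
    then show "\<exists>K. \<forall>t x. 0 \<le> t \<longrightarrow> t + x \<le> v \<longrightarrow> norm (Y \<xi> n t x) \<le> K" by blast
    show "((\<lambda>s. Y \<xi> n (v + s) (- s)) \<longlongrightarrow> 0) at_top"
    proof (rule Y_tendsto_0)
      show "\<forall>\<^sub>F s in at_top. sqnorm (v + s) (radius M (- s)) \<le> E * (2 + \<bar>v - a\<bar>)"
        using eventually_ge_at_top[of "- v"]
      proof eventually_elim
        case (elim s)
        then show ?case using E(2)[of "v + s" "- s"] by simp
      qed
    qed (rule horizon_tendsto[OF rad])
  qed
qed

text \<open>Reflecting x turns outgoing lines into incoming ones and the right end \<open>b\<close>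
  of the support into the left end \<open>- b\<close>.\<close>

lemma Y_zero_if_null_infinity:
  assumes rad: "has_null_infinity_radiation_field M u (\<lambda>_ _. 0)"
  shows "Y \<xi> n t x = 0"
proof (induction n arbitrary: t x rule: less_induct)
  case (less n)
  obtain Yt Yx Ytt Ytx Yxx where J: "C2_jet (Y \<xi> n) Yt Yx Ytt Ytx Yxx"
    and Yt: "\<And>t x. Yt t x = radius M x *\<^sub>R moment \<xi> n (Dt Z) t (radius M x)"
    and pde: "\<And>t x. Ytt t x - Yxx t x = - (potential n x *\<^sub>R Y \<xi> n t x) +
      ((radius M x - 2 * M) / radius M x ^ 3 * (n * (n - 1)) * (\<xi> \<bullet> \<xi>)) *\<^sub>R Y \<xi> (n - 2) t x"
    using Y_jet[of \<xi> n] by blast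
  have J': "C2_jet (\<lambda>t x. Y \<xi> n t (- x)) (\<lambda>t x. Yt t (- x)) (\<lambda>t x. - Yx t (- x))
      (\<lambda>t x. Ytt t (- x)) (\<lambda>t x. - Ytx t (- x)) (\<lambda>t x. Yxx t (- x))"
    using C2_jet_affine[OF J, where p = 0 and \<sigma> = 1 and q = 0 and \<tau> = "-1"] by simp
  obtain E where E: "0 \<le> E" "\<And>t x. 0 \<le> t \<Longrightarrow> sqnorm t (radius M x) \<le> E * (2 + \<bar>b + t - x\<bar>)"
    by (rule sqnorm_bound[OF ab supp]) auto
  let ?N = "1 + real n * (real n + 1)"
  have neg: "(uminus has_real_derivative - 1) (at x)" for x :: real
    by (auto intro!: derivative_eq_intros)
  \<comment> \<open>Under the reflection the first primitive changes its sign and the second does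
    not, so that each is still the derivative of the next.\<close>
  have P1: "((\<lambda>x. - (- ?N / radius M (- x))) has_real_derivative ?N * ((radius M (- x) - 2 * M) / radius M (- x) ^ 3)) (at x)" for x
    using DERIV_minus[OF DERIV_chain2[OF potential_primitives(1)[of n "- x"] neg]] by simp
  have P2: "((\<lambda>x. - ?N * ln (radius M (- x) - 2 * M)) has_real_derivative - (- ?N / radius M (- x))) (at x)" for x
    using DERIV_chain2[OF potential_primitives(2)[of n "- x"] neg] by simp
  have "Y \<xi> n t (- (- x)) = 0"
  proof (rule wave_zero_if_radiation_zero[OF J', where W = "\<lambda>x. potential n (- x)" and a = "- b" and B = "?N / (2 * M)", OF _ _ _ P1 _ P2])
    fix t x
    have "real (n * (n - 1)) *\<^sub>R Y \<xi> (n - 2) t (- x) = 0"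
    proof (cases "n < 2")
      case True
      then show ?thesis by (auto simp: less_2_cases_iff)
    next
      case False
      then show ?thesis using less.IH[of "n - 2"] by simp
    qed
    then show "Ytt t (- x) - Yxx t (- x) = - (potential n (- x) *\<^sub>R Y \<xi> n t (- x))" by (auto simp: pde)
  next
    show "continuous_on UNIV (\<lambda>x. potential n (- x))"
      by (rule continuous_on_compose2[OF continuous_potential]) (auto intro!: continuous_intros)
    show "\<bar>potential n (- x)\<bar> \<le> ?N * ((radius M (- x) - 2 * M) / radius M (- x) ^ 3)" for x
      by (rule potential_bound)
    show "\<bar>- (- ?N / radius M (- x))\<bar> \<le> ?N / (2 * M)" for x
      using potential_primitives(3)[of n "- x"] by simp
    show "Yt 0 (- x) = 0" for x by (simp add: Yt moment_Dt_initial)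
    show "Y \<xi> n 0 (- x) = 0" if "x < - b" for x using that by (intro Y_zero_outside) auto
  next
    fix v
    let ?I = "\<integral>\<omega>. ((\<omega> \<bullet> \<xi>) ^ n)\<^sup>2 \<partial>sphere_measure"
    have "norm (Y \<xi> n t (- x)) \<le> (?I + E * (2 + \<bar>b + v\<bar>)) / 2" if t: "0 \<le> t" "t + x \<le> v" for t x
    proof (cases "b + t + x < 0")
      case True
      have "0 \<le> ?I" by simp
      then show ?thesis using Y_zero_outside[of t "- x"] True t E(1) by simp
    next
      case False
      have "sqnorm t (radius M (- x)) \<le> E * (2 + \<bar>b + t - (- x)\<bar>)" by (rule E(2)[OF t(1)])
      also have "\<dots> \<le> E * (2 + \<bar>b + v\<bar>)" using False t E(1) by (intro mult_left_mono) auto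
      finally have "(?I + sqnorm t (radius M (- x))) / 2 \<le> (?I + E * (2 + \<bar>b + v\<bar>)) / 2" by simp
      with norm_Y_le show ?thesis by (rule order_trans)
    qed
    then show "\<exists>K. \<forall>t x. 0 \<le> t \<longrightarrow> t + x \<le> v \<longrightarrow> norm (Y \<xi> n t (- x)) \<le> K" by blast
    have "((\<lambda>s. Y \<xi> n (v + s) s) \<longlongrightarrow> 0) at_top"
    proof (rule Y_tendsto_0)
      show "\<forall>\<^sub>F s in at_top. sqnorm (v + s) (radius M s) \<le> E * (2 + \<bar>b + v\<bar>)"
        using eventually_ge_at_top[of "- v"]
      proof eventually_elim
        case (elim s)
        then show ?case using E(2)[of "v + s" s] by simp
      qed
    qed (rule null_infinity_tendsto[OF rad])
    then show "((\<lambda>s. Y \<xi> n (v + s) (- (- s))) \<longlongrightarrow> 0) at_top" by simp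
  qed
  then show ?case by simp
qed

end

end

theorem corollary1p6:
  fixes M :: real
    and \<psi> :: "real \<Rightarrow> real ^ 3 \<Rightarrow> complex"
    and u :: "real \<Rightarrow> real \<Rightarrow> real ^ 3 \<Rightarrow> complex"
  assumes "M > 0"
    and "test_data M \<psi>"
    and "wave_solution M (\<lambda>_ _. 0) \<psi> u"
  shows "(has_horizon_radiation_field M u (\<lambda>_ _. 0)
            \<longrightarrow> (\<forall>r>2 * M. \<forall>\<omega>\<in>sphere 0 1. \<psi> r \<omega> = 0)) \<and>
         (has_null_infinity_radiation_field M u (\<lambda>_ _. 0)
            \<longrightarrow> (\<forall>r>2 * M. \<forall>\<omega>\<in>sphere 0 1. \<psi> r \<omega> = 0))"
proof -
  interpret schwarzschild_wave M \<psi> u using assms by unfold_locales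
  show ?thesis
  proof (rule support_bounds)
    fix a b
    assume ab: "a \<le> b" and supp: "\<And>x \<omega>. x < a \<or> b < x \<Longrightarrow> \<omega> \<in> sphere 0 1 \<Longrightarrow> \<psi> (radius M x) \<omega> = 0"
    show ?thesis
      using initial_data_zero_if_Y_zero[OF Y_zero_if_horizon[OF ab supp]]
        initial_data_zero_if_Y_zero[OF Y_zero_if_null_infinity[OF ab supp]] by blast
  qed
qed

end
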